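(* Let $(V,\omega)$ be a complex symplectic vector space of dimension $2n$, let $\alpha_1,\alpha_2$ be two Lagrangian subspaces with $V=\alpha_1\oplus\alpha_2$, put $\tilde\alpha_1:=\alpha_1\times\alpha_1$, and let $\alpha$ be a Lagrangian subspace of $V$. Let $\tilde\gamma\in\mathcal P_{\tau_1+\tau_2}(V)$ be the iteration of $\gamma_1\in\mathcal P_{\tau_1}(V)$ and $\gamma_2\in\mathcal P_{\tau_2}(V)$, and set $M_j:=\gamma_j(\tau_j)$, $j=1,2$. Then $$i_{\alpha\times\alpha_1}(\tilde\gamma)-i_{\alpha\times\alpha_1}(\gamma_1)-i_{\tilde\alpha_1}(\gamma_2)\ \ge\ \dim\frac{\mathrm{Gr}(M_2)\cap\tilde\alpha_1}{\mathrm{Gr}(M_2)\cap\big((\alpha_1\cap(M_1\alpha))\times\alpha_1\big)}+\dim\big((M_1\alpha)\cap\alpha_1\big)-n.$$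
   Context: A symplectic form on a finite-dimensional complex vector space $V$ is a non-degenerate skew-Hermitian (sesquilinear, linear in the first variable) form $\omega$; $\mathrm{Sp}(V)$ is the group of invertible linear maps preserving $\omega$. A subspace is Lagrangian if it equals its $\omega$-annihilator. $\mathcal P_\tau(V):=\{\gamma\in C([0,\tau],\mathrm{Sp}(V)):\gamma(0)=I_V\}$. $\mathrm{Gr}(A)=\{(x,Ax):x\in V\}$. Iteration of $\gamma_1,\gamma_2$: $\tilde\gamma(t)=\gamma_1(t)$ for $0\le t\le\tau_1$ and $\tilde\gamma(t)=\gamma_2(t-\tau_1)\gamma_1(\tau_1)$ for $\tau_1\le t\le\tau_1+\tau_2$. Maslov index. Let $(X,\Omega)$ be a complex symplectic vector space of dimension $2N$ possessing Lagrangian subspaces. Choose an inner product (linear in the first variable) and $J\in \mathrm{GL}(X)$ with $\Omega(x,y)=\langle Jx,y\rangle$; $iJ$ is self-adjoint. Let $X^-$ (resp. $X^+$) be the span of eigenvectors of $iJ$ with positive (resp. negative) eigenvalues. For a continuous path $(\lambda(s),\mu(s))$, $s\in[a,b]$, of pairs of Lagrangian subspaces, write them as graphs of $U_\lambda(s),U_\mu(s):X^-\to X^+$; the operators $U_\lambda(s)U_\mu(s)^{-1}$ are unitary on $(X^+,-i\Omega|_{X^+})$ with eigenvalues $e^{i\theta_j(s)}$, $\theta_j$ continuous real, $j=1,\dots,N$. With $E(x)$ the smallest integer $\ge x$, $\mathrm{Mas}\{\lambda,\mu\}:=\sum_j\big(E(\theta_j(b)/2\pi)-E(\theta_j(a)/2\pi)\big)$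 (independent of choices). A single Lagrangian in place of a path means the constant path. Maslov-type index. $V\times V$ carries the symplectic form $(-\omega)\oplus\omega$; graphs of elements of $\mathrm{Sp}(V)$ and products of Lagrangian subspaces of $V$ are Lagrangian in it. For a Lagrangian $W\subset V\times V$ and a path $\gamma$ in $\mathrm{Sp}(V)$, $i_W(\gamma):=\mathrm{Mas}\{\mathrm{Gr}\circ\gamma,W\}$. *)

theory Defs
  imports "HOL-Analysis.Analysis"
begin

text \<open>
  Vector spaces are whole types with an explicit complex scalar multiplication \<open>sc\<close>, as in the
  library locale \<^locale>\<open>vector_space\<close>. Linear operators are functions on the type.
\<close>

section \<open>Symplectic linear algebra\<close>

text \<open>Both symplectic forms and inner products are linear in the first variable.\<close>

definition sesquilinear :: "(complex \<Rightarrow> 'a::ab_group_add \<Rightarrow> 'a) \<Rightarrow> ('a \<Rightarrow> 'a \<Rightarrow> complex) \<Rightarrow> bool"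
  where "sesquilinear sc h \<longleftrightarrow>
    (\<forall>x y z. h (x + y) z = h x z + h y z) \<and>
    (\<forall>x y z. h x (y + z) = h x y + h x z) \<and>
    (\<forall>c x y. h (sc c x) y = c * h x y) \<and>
    (\<forall>c x y. h x (sc c y) = cnj c * h x y)"

locale complex_symplectic_space = finite_dimensional_vector_space sc Basis
  for sc :: "complex \<Rightarrow> 'a::ab_group_add \<Rightarrow> 'a" and Basis :: "'a set" +
  fixes \<omega> :: "'a \<Rightarrow> 'a \<Rightarrow> complex"
  assumes sesquilinear_form: "sesquilinear sc \<omega>"
    and skew_hermitian: "\<omega> x y = - cnj (\<omega> y x)"
    and nondegenerate: "(\<And>y. \<omega> x y = 0) \<Longrightarrow> x = 0"

definition symplectic_group ::
  "(complex \<Rightarrow> 'a::ab_group_add \<Rightarrow> 'a) \<Rightarrow> ('a \<Rightarrow> 'a \<Rightarrow> complex) \<Rightarrow> ('a \<Rightarrow> 'a) set"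
  where "symplectic_group sc \<omega> =
    {A. Vector_Spaces.linear sc sc A \<and> bij A \<and> (\<forall>x y. \<omega> (A x) (A y) = \<omega> x y)}"

definition annihilator :: "('a \<Rightarrow> 'a \<Rightarrow> complex) \<Rightarrow> 'a set \<Rightarrow> 'a set"
  where "annihilator \<omega> W = {x. \<forall>y\<in>W. \<omega> x y = 0}"

definition lagrangian ::
  "(complex \<Rightarrow> 'a::ab_group_add \<Rightarrow> 'a) \<Rightarrow> ('a \<Rightarrow> 'a \<Rightarrow> complex) \<Rightarrow> 'a set \<Rightarrow> bool"
  where "lagrangian sc \<omega> W \<longleftrightarrow> module.subspace sc W \<and> annihilator \<omega> W = W"

definition direct_sum_decomposition :: "'a::ab_group_add set \<Rightarrow> 'a set \<Rightarrow> bool"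
  where "direct_sum_decomposition A B \<longleftrightarrow> A \<inter> B = {0} \<and> {x + y |x y. x \<in> A \<and> y \<in> B} = UNIV"

definition graph_of :: "('a \<Rightarrow> 'a) \<Rightarrow> ('a \<times> 'a) set"
  where "graph_of A = {(x, A x) |x. True}"

definition neg_plus_form :: "('a \<Rightarrow> 'a \<Rightarrow> complex) \<Rightarrow> ('a \<times> 'a) \<Rightarrow> ('a \<times> 'a) \<Rightarrow> complex"
  where "neg_plus_form \<omega> p q = - \<omega> (fst p) (fst q) + \<omega> (snd p) (snd q)"

text \<open>
  Dimension of the quotient \<open>A / B\<close>, for subspaces \<open>B \<subseteq> A\<close>: the number of elements of a set
  \<open>S \<subseteq> A\<close> whose cosets form a basis of \<open>A / B\<close>, i.e. every coset \<open>x + B\<close> with \<open>x \<in> A\<close> is a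
  linear combination of the cosets \<open>s + B\<close> with unique coefficients.
\<close>

definition basis_modulo ::
  "('k \<Rightarrow> 'a::ab_group_add \<Rightarrow> 'a) \<Rightarrow> 'a set \<Rightarrow> 'a set \<Rightarrow> 'a set \<Rightarrow> bool"
  where "basis_modulo sc A B S \<longleftrightarrow> finite S \<and> S \<subseteq> A \<and>
    (\<forall>x\<in>A. \<exists>!c. c \<in> S \<rightarrow>\<^sub>E UNIV \<and> x - (\<Sum>s\<in>S. sc (c s) s) \<in> B)"

definition quotient_dim ::
  "('k \<Rightarrow> 'a::ab_group_add \<Rightarrow> 'a) \<Rightarrow> 'a set \<Rightarrow> 'a set \<Rightarrow> nat"
  where "quotient_dim sc A B = (THE k. \<exists>S. basis_modulo sc A B S \<and> card S = k)"

lemma (in finite_dimensional_vector_space) quotient_dim_eq: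
  assumes A: "subspace A" and B: "subspace B" and BA: "B \<subseteq> A"
  shows "quotient_dim scale A B = dim A - dim B"
proof -
  obtain C where C: "C \<subseteq> B" "independent C" "B \<subseteq> span C" "card C = dim B"
    using basis_exists by blast
  have finC: "finite C" using C(2) by (rule finiteI_independent)
  have spC: "span C = B" using C(1,3) B by (intro subset_antisym span_minimal)
  have card_eq: "card S = dim A - dim B" if S: "basis_modulo scale A B S" for S
  proof -
    have finS: "finite S" and SA: "S \<subseteq> A"
      and ex1: "\<And>x. x \<in> A \<Longrightarrow> \<exists>!c. c \<in> S \<rightarrow>\<^sub>E UNIV \<and> x - (\<Sum>s\<in>S. scale (c s) s) \<in> B"
      using S by (auto simp: basis_modulo_def)
    have uniq: "c = c'" if "x \<in> A" "c \<in> S \<rightarrow>\<^sub>E UNIV \<and> x - (\<Sum>s\<in>S. scale (c s) s) \<in> B"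
        "c' \<in> S \<rightarrow>\<^sub>E UNIV \<and> x - (\<Sum>s\<in>S. scale (c' s) s) \<in> B" for x c c'
      using ex1[OF that(1)] that(2,3) by blast
    have zero: "\<forall>s\<in>S. u s = 0" if u: "(\<Sum>s\<in>S. scale (u s) s) \<in> B" for u
    proof -
      have "restrict u S = restrict (\<lambda>_. 0) S"
      proof (rule uniq)
        show "0 \<in> A" using A by (rule subspace_0)
        show "restrict u S \<in> S \<rightarrow>\<^sub>E UNIV \<and> 0 - (\<Sum>s\<in>S. scale (restrict u S s) s) \<in> B"
          using subspace_neg[OF B u] by simp
        show "restrict (\<lambda>_. 0) S \<in> S \<rightarrow>\<^sub>E UNIV \<and>
            0 - (\<Sum>s\<in>S. scale (restrict (\<lambda>_. 0) S s) s) \<in> B"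
          using subspace_0[OF B] by simp
      qed
      then have "restrict u S s = restrict (\<lambda>_. 0) S s" for s by simp
      then show ?thesis by (force simp: restrict_def split: if_splits)
    qed
    have disj: "S \<inter> C = {}"
    proof (rule ccontr)
      assume "S \<inter> C \<noteq> {}"
      then obtain s where s: "s \<in> S" "s \<in> C" by blast
      have "(\<Sum>t\<in>S. scale (if t = s then 1 else 0) t) = (\<Sum>t\<in>S. if t = s then t else 0)"
        by (rule sum.cong) auto
      also have "\<dots> = s" using finS s by simp
      finally have "(\<Sum>t\<in>S. scale (if t = s then 1 else 0) t) \<in> B" using s C(1) by auto
      from zero[OF this] s show False by auto
    qed
    have ind: "independent (S \<union> C)"
    proof (rule independent_if_scalars_zero)
      show "finite (S \<union> C)" using finS finC by simp
      fix u x assume sum0: "(\<Sum>v\<in>S \<union> C. scale (u v) v) = 0" and x: "x \<in> S \<union> C"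
      have split: "(\<Sum>v\<in>S. scale (u v) v) + (\<Sum>v\<in>C. scale (u v) v) = 0"
        using sum0 disj finS finC by (simp add: sum.union_disjoint)
      have "(\<Sum>v\<in>C. scale (u v) v) \<in> B"
        unfolding spC[symmetric] by (intro span_sum span_scale span_base)
      then have "(\<Sum>v\<in>S. scale (u v) v) \<in> B"
        using subspace_neg[OF B] split by (simp add: eq_neg_iff_add_eq_0[symmetric])
      then have uS: "\<forall>s\<in>S. u s = 0" by (rule zero)
      then have "(\<Sum>v\<in>C. scale (u v) v) = 0" using split by simp
      then have "\<forall>v\<in>C. u v = 0" using independentD[OF C(2) finC subset_refl] by blast
      then show "u x = 0" using uS x by blast
    qed
    have "span (S \<union> C) = A"
    proof
      show "span (S \<union> C) \<subseteq> A" using SA C(1) BA A by (intro span_minimal) auto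
      show "A \<subseteq> span (S \<union> C)"
      proof
        fix x assume "x \<in> A"
        then obtain c where c: "x - (\<Sum>s\<in>S. scale (c s) s) \<in> B" using ex1 by blast
        then have 1: "x - (\<Sum>s\<in>S. scale (c s) s) \<in> span (S \<union> C)"
          using spC span_mono[of C "S \<union> C"] by auto
        have 2: "(\<Sum>s\<in>S. scale (c s) s) \<in> span (S \<union> C)"
          by (intro span_sum span_scale span_base) auto
        show "x \<in> span (S \<union> C)" using span_add[OF 1 2] by simp
      qed
    qed
    then have "dim A = card (S \<union> C)" using dim_span_eq_card_independent[OF ind] by simp
    also have "\<dots> = card S + dim B" using finS finC disj C(4) by (simp add: card_Un_disjoint)
    finally show ?thesis by simp
  qed
  obtain D where D: "C \<subseteq> D" "D \<subseteq> A" "independent D" "A \<subseteq> span D"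
    using maximal_independent_subset_extend[of C A] C(1,2) BA by blast
  have finD: "finite D" using D(3) by (rule finiteI_independent)
  have "basis_modulo scale A B (D - C)"
    unfolding basis_modulo_def
  proof (intro conjI ballI)
    show "finite (D - C)" "D - C \<subseteq> A" using finD D(2) by auto
    fix x assume x: "x \<in> A"
    obtain u where u: "x = (\<Sum>v\<in>D. scale (u v) v)"
      using x D(4) span_finite[OF finD] by auto
    have splitD: "(\<Sum>v\<in>D. scale (w v) v) = (\<Sum>v\<in>D-C. scale (w v) v) + (\<Sum>v\<in>C. scale (w v) v)"
      for w using sum.subset_diff[OF D(1) finD] by auto
    have inB: "(\<Sum>v\<in>C. scale (w v) v) \<in> B" for w
      unfolding spC[symmetric] by (intro span_sum span_scale span_base)
    show "\<exists>!c. c \<in> (D - C) \<rightarrow>\<^sub>E UNIV \<and> x - (\<Sum>s\<in>D - C. scale (c s) s) \<in> B"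
    proof (rule ex_ex1I)
      show "\<exists>c. c \<in> (D - C) \<rightarrow>\<^sub>E UNIV \<and> x - (\<Sum>s\<in>D - C. scale (c s) s) \<in> B"
        using u splitD[of u] inB[of u] by (intro exI[of _ "restrict u (D - C)"]) simp
      fix c c' assume c: "c \<in> (D - C) \<rightarrow>\<^sub>E UNIV \<and> x - (\<Sum>s\<in>D - C. scale (c s) s) \<in> B"
        and c': "c' \<in> (D - C) \<rightarrow>\<^sub>E UNIV \<and> x - (\<Sum>s\<in>D - C. scale (c' s) s) \<in> B"
      have "(x - (\<Sum>s\<in>D - C. scale (c' s) s)) - (x - (\<Sum>s\<in>D - C. scale (c s) s)) \<in> B"
        using c c' B by (blast intro: subspace_diff)
      then have "(\<Sum>s\<in>D - C. scale (c s - c' s) s) \<in> B"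
        by (simp add: scale_left_diff_distrib sum_subtractf)
      then obtain w where w: "(\<Sum>s\<in>D - C. scale (c s - c' s) s) = (\<Sum>v\<in>C. scale (w v) v)"
        using spC span_finite[OF finC] by auto
      define r where "r v = (if v \<in> C then - w v else c v - c' v)" for v
      have "(\<Sum>v\<in>D - C. scale (r v) v) = (\<Sum>s\<in>D - C. scale (c s - c' s) s)"
        by (rule sum.cong) (auto simp: r_def)
      moreover have "(\<Sum>v\<in>C. scale (r v) v) = - (\<Sum>v\<in>C. scale (w v) v)"
        by (simp add: r_def sum_negf)
      ultimately have "(\<Sum>v\<in>D. scale (r v) v) = 0" using splitD[of r] w by simp
      then have "\<forall>v\<in>D. r v = 0" using independentD[OF D(3) finD subset_refl] by blast
      then have "\<And>v. v \<in> D - C \<Longrightarrow> c v = c' v" by (auto simp: r_def)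
      then show "c = c'" using c c' by (blast intro: PiE_ext)
    qed
  qed
  then show ?thesis
    unfolding quotient_dim_def using card_eq by (intro the_equality) auto
qed

section \<open>Paths of symplectic maps\<close>

text \<open>
  In finite dimension the vector space topology on operators is generated by the
  matrix coefficients \<open>A \<mapsto> f (A x)\<close>, with \<open>x\<close> a vector and \<open>f\<close> a linear functional.
\<close>

definition continuous_operator_path ::
  "(complex \<Rightarrow> 'a::ab_group_add \<Rightarrow> 'a) \<Rightarrow> real set \<Rightarrow> (real \<Rightarrow> 'a \<Rightarrow> 'a) \<Rightarrow> bool"
  where "continuous_operator_path sc T \<gamma> \<longleftrightarrow>
    (\<forall>x f. Vector_Spaces.linear sc (*) f \<longrightarrow> continuous_on T (\<lambda>t. f (\<gamma> t x)))"

definition symplectic_paths ::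
  "(complex \<Rightarrow> 'a::ab_group_add \<Rightarrow> 'a) \<Rightarrow> ('a \<Rightarrow> 'a \<Rightarrow> complex) \<Rightarrow> real \<Rightarrow> (real \<Rightarrow> 'a \<Rightarrow> 'a) set"
  where "symplectic_paths sc \<omega> \<tau> = {\<gamma>. (\<forall>t\<in>{0..\<tau>}. \<gamma> t \<in> symplectic_group sc \<omega>) \<and>
    continuous_operator_path sc {0..\<tau>} \<gamma> \<and> \<gamma> 0 = id}"

definition path_iteration ::
  "real \<Rightarrow> (real \<Rightarrow> 'a \<Rightarrow> 'a) \<Rightarrow> (real \<Rightarrow> 'a \<Rightarrow> 'a) \<Rightarrow> real \<Rightarrow> 'a \<Rightarrow> 'a"
  where "path_iteration \<tau>1 \<gamma>1 \<gamma>2 t = (if t \<le> \<tau>1 then \<gamma>1 t else \<gamma>2 (t - \<tau>1) \<circ> \<gamma>1 \<tau>1)"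

section \<open>Maslov index\<close>

definition inner_product ::
  "(complex \<Rightarrow> 'a::ab_group_add \<Rightarrow> 'a) \<Rightarrow> ('a \<Rightarrow> 'a \<Rightarrow> complex) \<Rightarrow> bool"
  where "inner_product sc g \<longleftrightarrow> sesquilinear sc g \<and> (\<forall>x y. g x y = cnj (g y x)) \<and>
    (\<forall>x. x \<noteq> 0 \<longrightarrow> Re (g x x) > 0)"

definition form_operator ::
  "('a \<Rightarrow> 'a \<Rightarrow> complex) \<Rightarrow> ('a \<Rightarrow> 'a \<Rightarrow> complex) \<Rightarrow> 'a \<Rightarrow> 'a"
  where "form_operator \<Omega> g = (THE J. \<forall>x y. \<Omega> x y = g (J x) y)"

text \<open>\<open>X\<^sup>-\<close> belongs to the positive, \<open>X\<^sup>+\<close> to the negative eigenvalues of \<open>iJ\<close>.\<close>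

definition minus_space ::
  "(complex \<Rightarrow> 'a::ab_group_add \<Rightarrow> 'a) \<Rightarrow> ('a \<Rightarrow> 'a \<Rightarrow> complex) \<Rightarrow> ('a \<Rightarrow> 'a \<Rightarrow> complex) \<Rightarrow> 'a set"
  where "minus_space sc \<Omega> g =
    module.span sc {x. \<exists>r::real. r > 0 \<and> sc \<i> (form_operator \<Omega> g x) = sc (of_real r) x}"

definition plus_space ::
  "(complex \<Rightarrow> 'a::ab_group_add \<Rightarrow> 'a) \<Rightarrow> ('a \<Rightarrow> 'a \<Rightarrow> complex) \<Rightarrow> ('a \<Rightarrow> 'a \<Rightarrow> complex) \<Rightarrow> 'a set"
  where "plus_space sc \<Omega> g =
    module.span sc {x. \<exists>r::real. r < 0 \<and> sc \<i> (form_operator \<Omega> g x) = sc (of_real r) x}"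

text \<open>
  The operator \<open>U : X\<^sup>- \<rightarrow> X\<^sup>+\<close> with \<open>L = {x + U x | x \<in> X\<^sup>-}\<close>; its values outside \<open>X\<^sup>-\<close> play
  no role.
\<close>

definition lagrangian_operator ::
  "(complex \<Rightarrow> 'a::ab_group_add \<Rightarrow> 'a) \<Rightarrow> ('a \<Rightarrow> 'a \<Rightarrow> complex) \<Rightarrow> ('a \<Rightarrow> 'a \<Rightarrow> complex) \<Rightarrow>
    'a set \<Rightarrow> 'a \<Rightarrow> 'a"
  where "lagrangian_operator sc \<Omega> g L x = (THE y. y \<in> plus_space sc \<Omega> g \<and> x + y \<in> L)"

definition relative_operator ::
  "(complex \<Rightarrow> 'a::ab_group_add \<Rightarrow> 'a) \<Rightarrow> ('a \<Rightarrow> 'a \<Rightarrow> complex) \<Rightarrow> ('a \<Rightarrow> 'a \<Rightarrow> complex) \<Rightarrow>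
    'a set \<Rightarrow> 'a set \<Rightarrow> 'a \<Rightarrow> 'a"
  where "relative_operator sc \<Omega> g L M y = lagrangian_operator sc \<Omega> g L
    (inv_into (minus_space sc \<Omega> g) (lagrangian_operator sc \<Omega> g M) y)"

text \<open>
  \<open>\<theta> 0, \<dots>, \<theta> (N - 1)\<close> are continuous arguments of the eigenvalues of \<open>U\<^sub>\<Lambda> U\<^sub>\<mu>\<^sup>-\<^sup>1\<close> on \<open>X\<^sup>+\<close>, counted
  with multiplicity. Since that operator is unitary, multiplicity is the dimension of
  the eigenspace.
\<close>

definition eigenangles ::
  "(complex \<Rightarrow> 'a::ab_group_add \<Rightarrow> 'a) \<Rightarrow> ('a \<Rightarrow> 'a \<Rightarrow> complex) \<Rightarrow> ('a \<Rightarrow> 'a \<Rightarrow> complex) \<Rightarrow>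
    nat \<Rightarrow> real \<Rightarrow> real \<Rightarrow> (real \<Rightarrow> 'a set) \<Rightarrow> (real \<Rightarrow> 'a set) \<Rightarrow> (nat \<Rightarrow> real \<Rightarrow> real) \<Rightarrow> bool"
  where "eigenangles sc \<Omega> g N a b \<Lambda> \<mu> \<theta> \<longleftrightarrow>
    (\<forall>j<N. continuous_on {a..b} (\<theta> j)) \<and>
    (\<forall>s\<in>{a..b}. \<forall>z. vector_space.dim sc
        {y \<in> plus_space sc \<Omega> g. relative_operator sc \<Omega> g (\<Lambda> s) (\<mu> s) y = sc z y}
      = card {j. j < N \<and> cis (\<theta> j s) = z})"

text \<open>
  The inner product \<open>g\<close> is an explicit parameter, the family of angles is an arbitrary choice.
  The value depends on neither.
\<close>

definition maslov_index ::
  "(complex \<Rightarrow> 'a::ab_group_add \<Rightarrow> 'a) \<Rightarrow> ('a \<Rightarrow> 'a \<Rightarrow> complex) \<Rightarrow> ('a \<Rightarrow> 'a \<Rightarrow> complex) \<Rightarrow>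
    real \<Rightarrow> real \<Rightarrow> (real \<Rightarrow> 'a set) \<Rightarrow> (real \<Rightarrow> 'a set) \<Rightarrow> int"
  where "maslov_index sc \<Omega> g a b \<Lambda> \<mu> =
    (let N = vector_space.dim sc (UNIV :: 'a set) div 2;
         \<theta> = (SOME \<theta>. eigenangles sc \<Omega> g N a b \<Lambda> \<mu> \<theta>)
     in \<Sum>j<N. \<lceil>\<theta> j b / (2 * pi)\<rceil> - \<lceil>\<theta> j a / (2 * pi)\<rceil>)"

abbreviation prod_scale ::
  "(complex \<Rightarrow> 'a::ab_group_add \<Rightarrow> 'a) \<Rightarrow> complex \<Rightarrow> 'a \<times> 'a \<Rightarrow> 'a \<times> 'a"
  where "prod_scale sc \<equiv> module_prod.scale sc sc"

text \<open>\<open>i\<^sub>W(\<gamma>)\<close> for \<open>\<gamma>\<close> defined on \<open>[0, \<tau>]\<close>; here \<open>g\<close> is an inner product on \<open>V \<times> V\<close>.\<close>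

definition maslov_type_index ::
  "(complex \<Rightarrow> 'a::ab_group_add \<Rightarrow> 'a) \<Rightarrow> ('a \<Rightarrow> 'a \<Rightarrow> complex) \<Rightarrow>
    ('a \<times> 'a \<Rightarrow> 'a \<times> 'a \<Rightarrow> complex) \<Rightarrow> ('a \<times> 'a) set \<Rightarrow> real \<Rightarrow> (real \<Rightarrow> 'a \<Rightarrow> 'a) \<Rightarrow> int"
  where "maslov_type_index sc \<omega> g W \<tau> \<gamma> =
    maslov_index (prod_scale sc) (neg_plus_form \<omega>) g 0 \<tau> (\<lambda>t. graph_of (\<gamma> t)) (\<lambda>_. W)"

end

theory Submission
  imports Defs "HOL-Computational_Algebra.Fundamental_Theorem_Algebra" "Jordan_Normal_Form.Determinant"
begin

text \<open>
  For a unitary operator \<open>A\<close> with eigenvalues \<open>exp (-2\<pi>i x)\<close>, \<open>0 \<le> x < 1\<close>, let the defect \<open>m(A)\<close> be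
  the sum of the \<open>x\<close>. Since \<open>\<lceil>\<theta>/2\<pi>\<rceil> = \<theta>/2\<pi> + x\<close>, the Maslov index of a path of unitary operators is
  the variation of an argument of the determinant, divided by \<open>2\<pi>\<close>, plus the variation of \<open>m\<close>;
  it vanishes when the multiplicity of the eigenvalue \<open>1\<close> is constant. Applied to the four edges of
  the rectangle of graphs of \<open>\<gamma>2(t) \<circ> \<gamma>1(s)\<close>, this cancels all arguments: the left hand side of the
  theorem is \<open>D(Gr M2) - D(Gr I)\<close> with
  \<open>D(L) = m(U\<^sub>L U\<^sub>K\<^sup>-\<^sup>1) - m(U\<^sub>L U\<^sub>W\<^sup>-\<^sup>1) - m(U\<^sub>W U\<^sub>K\<^sup>-\<^sup>1)\<close>, where \<open>W = \<alpha>1 \<times> \<alpha>1\<close> and \<open>K = M1 \<alpha> \<times> \<alpha>1\<close>.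

  For unitary operators \<open>A\<close>, \<open>C\<close> the number \<open>m(AC) - m(A) - m(C)\<close> is at most \<open>0\<close> and at least
  \<open>dim (ker (A - 1) + ker (C - 1)) - N\<close>. For a rotation \<open>C\<close> in one direction it is an integer, because
  \<open>det A\<close> is \<open>exp (-2\<pi>i m(A))\<close>, and it is \<open>0\<close> or \<open>-1\<close> by interlacing of eigenvalues; the general
  case follows by factoring \<open>C\<close> into such rotations.
\<close>

section \<open>Hermitian forms definite on a subspace\<close>

text \<open>On the edges where \<open>s\<close> varies, the graph of \<gamma>2(t) \<circ>
  \<gamma>1(s) is compared with a moving Lagrangian, \<open>R s\<close>, the product of the preimage
  of M1 \<alpha> under \<gamma>1(s) with \<alpha>1. Applying \<gamma>1(s) to the first coordinate
  shows that the dimension of the intersection does not depend on \<open>s\<close>, so the change of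
  argument is a difference of defects. \<open>R\<close> runs from K to \<alpha> \<times> \<alpha>1;
  this is how K replaces \<alpha> \<times> \<alpha>1 in the final formula. The bounds on D are used
  from above at Gr I and from below at Gr M2, where the common term for W and K cancels. In V
  \<times> V the number N is 2n, while the intersection of W and K has dimension n more than that of
  M1 \<alpha> and \<alpha>1; the constant -n is what remains. The index is defined by an arbitrary
  choice of continuous eigenangles, so these must be shown to exist. Eigenvalues may collide and
  cannot be followed one at a time; a continuous argument of the determinant selects the whole
  sorted family at once.\<close>

lemma (in finite_dimensional_vector_space) family_dependent:
  fixes u :: "nat \<Rightarrow> 'b"
  assumes S: "subspace S" and u: "\<And>k. k < m \<Longrightarrow> u k \<in> S" and m: "dim S < m"
  obtains c where "\<exists>k<m. c k \<noteq> 0" "(\<Sum>k<m. scale (c k) (u k)) = 0"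
proof (cases "inj_on u {..<m}")
  case True
  have sub: "u ` {..<m} \<subseteq> S" using u by auto
  have card: "card (u ` {..<m}) = m" using True by (simp add: card_image)
  have "dependent (u ` {..<m})"
  proof (rule ccontr)
    assume "independent (u ` {..<m})"
    from dim_eq_card_independent[OF this] card dim_subset[OF sub] m show False by simp
  qed
  then obtain c where c: "\<exists>v\<in>u ` {..<m}. c v \<noteq> 0" "(\<Sum>v\<in>u ` {..<m}. scale (c v) v) = 0"
    unfolding dependent_finite[OF finite_imageI[OF finite_lessThan]] by blast
  show ?thesis
    by (rule that[of "c \<circ> u"]) (use c True in \<open>auto simp: sum.reindex\<close>)
next
  case False
  then obtain i j where ij: "i < m" "j < m" "i \<noteq> j" "u i = u j" by (auto simp: inj_on_def)
  \<comment> \<open>A repetition is itself a relation. It has to be allowed, since the family used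
    later consists of the powers of an operator applied to one vector.\<close>
  define c where "c k = (if k = i then 1 else if k = j then - 1 else 0 :: 'a)" for k
  have "(\<Sum>k<m. scale (c k) (u k)) = (\<Sum>k<m. (if k = i then u i else 0) + (if k = j then - u j else 0))"
    by (rule sum.cong) (use ij in \<open>auto simp: c_def\<close>)
  also have "\<dots> = 0" using ij by (simp add: sum.distrib)
  finally have "(\<Sum>k<m. scale (c k) (u k)) = 0" .
  then show ?thesis by (rule that[rotated]) (use ij in \<open>auto simp: c_def intro!: exI[of _ i]\<close>)
qed

lemma (in finite_dimensional_vector_space) dim_Int_hyperplane:
  assumes S: "subspace S" and f: "Vector_Spaces.linear scale (*) f"
  shows "dim S \<le> dim (S \<inter> {x. f x = 0}) + 1"
proof (cases "\<exists>v\<in>S. f v \<noteq> 0")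
  case True
  then obtain v where v: "v \<in> S" "f v \<noteq> 0" by blast
  interpret f: Vector_Spaces.linear scale "(*)" f by (rule f)
  have "S \<subseteq> span (insert v (S \<inter> {x. f x = 0}))"
  proof
    fix x assume x: "x \<in> S"
    have "x - scale (f x / f v) v \<in> S \<inter> {x. f x = 0}"
      using x v S by (auto simp: f.diff f.scale intro!: subspace_diff subspace_scale)
    then show "x \<in> span (insert v (S \<inter> {x. f x = 0}))"
      by (subst span_breakdown_eq) (blast intro: span_base)
  qed
  then have "dim S \<le> dim (insert v (S \<inter> {x. f x = 0}))"
    using dim_subset dim_span by metis
  also have "\<dots> \<le> dim (S \<inter> {x. f x = 0}) + 1" by (simp add: dim_insert)
  finally show ?thesis .
next
  case False
  then have "S \<inter> {x. f x = 0} = S" by auto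
  then show ?thesis by simp
qed

text \<open>
  The form \<open>h\<close> lives on the whole space but is only required to be positive on \<open>P\<close>: it will be
  \<open>-i\<Omega>\<close>, with \<open>P = X\<^sup>+\<close>.
\<close>

locale definite_subspace = finite_dimensional_vector_space sc Basis
  for sc :: "complex \<Rightarrow> 'a::ab_group_add \<Rightarrow> 'a" and Basis :: "'a set" +
  fixes h :: "'a \<Rightarrow> 'a \<Rightarrow> complex" and P :: "'a set"
  assumes sesquilinear_h: "sesquilinear sc h"
    and hermitian: "h x y = cnj (h y x)"
    and subspace_P: "subspace P"
    and positive: "x \<in> P \<Longrightarrow> x \<noteq> 0 \<Longrightarrow> Re (h x x) > 0"
begin

lemma h_add_left: "h (x + y) z = h x z + h y z"
  and h_add_right: "h x (y + z) = h x y + h x z"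
  and h_scale_left: "h (sc c x) y = c * h x y"
  and h_scale_right: "h x (sc c y) = cnj c * h x y"
  using sesquilinear_h by (auto simp: sesquilinear_def)

lemma linear_h_left: "Vector_Spaces.linear sc (*) (\<lambda>x. h x y)"
  using vector_space_axioms vector_space_over_itself.vector_space_axioms
  by (simp add: Vector_Spaces.linear_iff h_add_left h_scale_left)

lemma h_zero_left [simp]: "h 0 y = 0" and h_zero_right [simp]: "h x 0 = 0"
  using h_scale_left[of 0 0 y] h_scale_right[of x 0 0] by simp_all

lemma h_sum_left: "h (\<Sum>i\<in>I. f i) y = (\<Sum>i\<in>I. h (f i) y)"
  by (induction I rule: infinite_finite_induct) (auto simp: h_add_left)

lemma h_sum_right: "h x (\<Sum>i\<in>I. f i) = (\<Sum>i\<in>I. h x (f i))"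
  by (induction I rule: infinite_finite_induct) (auto simp: h_add_right)

lemma h_diff_left: "h (x - y) z = h x z - h y z"
  using h_add_left[of "x - y" y z] by simp

lemma h_self_real: "h x x = of_real (Re (h x x))"
  using hermitian[of x x] by (simp add: complex_eq_iff)

lemma h_self_eq_0_iff: "x \<in> P \<Longrightarrow> h x x = 0 \<longleftrightarrow> x = 0"
  using positive[of x] by (cases "x = 0") auto

lemma eq_if_h_eq:
  assumes "x \<in> P" "y \<in> P" "\<And>z. z \<in> P \<Longrightarrow> h x z = h y z"
  shows "x = y"
proof -
  have "x - y \<in> P" using assms subspace_P by (auto intro: subspace_diff)
  then have "h (x - y) (x - y) = 0" using assms by (simp add: h_diff_left)
  then show ?thesis using h_self_eq_0_iff \<open>x - y \<in> P\<close> by simp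
qed

section \<open>Orthonormal families in the definite subspace\<close>

definition orthonormal :: "nat \<Rightarrow> (nat \<Rightarrow> 'a) \<Rightarrow> bool"
  where "orthonormal m e \<longleftrightarrow> (\<forall>i<m. e i \<in> P) \<and>
    (\<forall>i<m. \<forall>j<m. h (e i) (e j) = (if i = j then 1 else 0))"

lemma orthonormal_in: "orthonormal m e \<Longrightarrow> i < m \<Longrightarrow> e i \<in> P"
  by (simp add: orthonormal_def)

lemma orthonormal_h: "orthonormal m e \<Longrightarrow> i < m \<Longrightarrow> j < m \<Longrightarrow> h (e i) (e j) = (if i = j then 1 else 0)"
  by (simp add: orthonormal_def)

lemma h_sum_orthonormal:
  assumes "orthonormal m e" "I \<subseteq> {..<m}" "j < m"
  shows "h (\<Sum>i\<in>I. sc (c i) (e i)) (e j) = (if j \<in> I then c j else 0)"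
proof -
  have "finite I" using assms(2) finite_subset by blast
  have "h (\<Sum>i\<in>I. sc (c i) (e i)) (e j) = (\<Sum>i\<in>I. if i = j then c j else 0)"
    unfolding h_sum_left
    by (rule sum.cong) (use assms in \<open>auto simp: h_scale_left orthonormal_h subset_iff\<close>)
  then show ?thesis using \<open>finite I\<close> by simp
qed

lemma sum_in_subspace: "subspace S \<Longrightarrow> (\<And>i. i \<in> I \<Longrightarrow> e i \<in> S) \<Longrightarrow> (\<Sum>i\<in>I. sc (c i) (e i)) \<in> S"
  by (intro subspace_sum subspace_scale) auto

lemma orthonormal_inj: "orthonormal m e \<Longrightarrow> inj_on e {..<m}"
proof (rule inj_onI)
  fix x y
  assume a: "orthonormal m e" "x \<in> {..<m}" "y \<in> {..<m}" "e x = e y"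
  then have "h (e x) (e x) = h (e x) (e y)" by simp
  then show "x = y" using a(2,3) orthonormal_h[OF a(1), of x x] orthonormal_h[OF a(1), of x y]
    by (auto split: if_splits)
qed

lemma orthonormal_independent:
  assumes e: "orthonormal m e" and I: "I \<subseteq> {..<m}"
  shows "independent (e ` I)" "dim (e ` I) = card I" "dim (span (e ` I)) = card I"
proof -
  have inj: "inj_on e I" using orthonormal_inj[OF e] I inj_on_subset by blast
  have fin: "finite I" using I finite_subset by blast
  show "independent (e ` I)"
  proof (rule independent_if_scalars_zero)
    show "finite (e ` I)" using fin by simp
    fix f x assume f: "(\<Sum>x\<in>e ` I. sc (f x) x) = 0" and x: "x \<in> e ` I"
    then obtain j where j: "j \<in> I" "x = e j" by auto
    have "h (\<Sum>i\<in>I. sc (f (e i)) (e i)) (e j) = f x"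
      using h_sum_orthonormal[OF e I, of j "\<lambda>i. f (e i)"] j I by auto
    then show "f x = 0" using f inj by (simp add: sum.reindex)
  qed
  then show "dim (e ` I) = card I" using inj by (simp add: dim_eq_card_independent card_image)
  then show "dim (span (e ` I)) = card I" by simp
qed

lemma span_orthonormal:
  assumes "orthonormal m e" "I \<subseteq> {..<m}" "x \<in> span (e ` I)"
  shows "x = (\<Sum>i\<in>I. sc (h x (e i)) (e i))"
proof -
  have fin: "finite I" using assms(2) finite_subset by blast
  have inj: "inj_on e I" using orthonormal_inj[OF assms(1)] assms(2) inj_on_subset by blast
  obtain f where "x = (\<Sum>v\<in>e ` I. sc (f v) v)" using assms(3) span_finite fin by auto
  then have x: "x = (\<Sum>i\<in>I. sc (f (e i)) (e i))" using inj by (simp add: sum.reindex)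
  have "h x (e i) = f (e i)" if "i \<in> I" for i
    using h_sum_orthonormal[OF assms(1,2), of i "\<lambda>i. f (e i)"] that assms(2) x by auto
  then show ?thesis using x by simp
qed

lemma orthonormal_spans:
  assumes e: "orthonormal (dim S) e" and S: "subspace S" and sub: "\<And>i. i < dim S \<Longrightarrow> e i \<in> S"
  shows "span (e ` {..<dim S}) = S"
proof -
  have "span (e ` {..<dim S}) \<subseteq> S" using sub S by (intro span_minimal) auto
  then show ?thesis
    using subspace_dim_equal[of "span (e ` {..<dim S})" S] orthonormal_independent[OF e subset_refl] S
    by simp
qed

lemma orthonormal_expansion:
  assumes "orthonormal (dim P) e" "x \<in> P"
  shows "x = (\<Sum>i<dim P. sc (h x (e i)) (e i))"
  using orthonormal_spans[OF assms(1) subspace_P] orthonormal_in[OF assms(1)]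
    span_orthonormal[OF assms(1) subset_refl, of x] assms(2) by simp

lemma parseval:
  assumes "orthonormal (dim P) e" "x \<in> P"
  shows "h x y = (\<Sum>i<dim P. h x (e i) * h (e i) y)"
  using arg_cong[OF orthonormal_expansion[OF assms], of "\<lambda>x. h x y"]
  by (simp add: h_sum_left h_scale_left)

section \<open>Operators on a subspace and their diagonalization\<close>

definition operator_on :: "'a set \<Rightarrow> ('a \<Rightarrow> 'a) \<Rightarrow> bool"
  where "operator_on S T \<longleftrightarrow> (\<forall>x\<in>S. T x \<in> S) \<and> (\<forall>x\<in>S. \<forall>y\<in>S. T (x + y) = T x + T y) \<and>
    (\<forall>c. \<forall>x\<in>S. T (sc c x) = sc c (T x))"

lemma operator_onD:
  assumes "operator_on S T" "x \<in> S"
  shows "T x \<in> S" "y \<in> S \<Longrightarrow> T (x + y) = T x + T y" "T (sc c x) = sc c (T x)"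
  using assms by (auto simp: operator_on_def)

lemma operator_on_sum:
  assumes T: "operator_on S T" and S: "subspace S" and e: "\<And>i. i \<in> I \<Longrightarrow> e i \<in> S"
  shows "T (\<Sum>i\<in>I. sc (c i) (e i)) = (\<Sum>i\<in>I. sc (c i) (T (e i)))"
  using e
proof (induction I rule: infinite_finite_induct)
  case empty
  have "T (sc 0 0) = sc 0 (T 0)" using operator_onD(3)[OF T] subspace_0[OF S] by blast
  then show ?case by simp
next
  case (infinite A)
  have "T (sc 0 0) = sc 0 (T 0)" using operator_onD(3)[OF T] subspace_0[OF S] by blast
  then show ?case using infinite by simp
next
  case (insert i I)
  have "(\<Sum>i\<in>I. sc (c i) (e i)) \<in> S" using insert.prems S by (intro sum_in_subspace) auto
  then have "T (sc (c i) (e i) + (\<Sum>i\<in>I. sc (c i) (e i)))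
      = T (sc (c i) (e i)) + T (\<Sum>i\<in>I. sc (c i) (e i))"
    using insert.prems S by (intro operator_onD(2)[OF T]) (auto intro: subspace_scale)
  then show ?case using insert by (simp add: operator_onD(3)[OF T])
qed

text \<open>A nonzero polynomial of least degree annihilating \<open>v\<close> is not constant, so
  it has a root \<open>z\<close>. By minimality its cofactor does not annihilate \<open>v\<close>,
  and the cofactor applied to \<open>v\<close> is an eigenvector for \<open>z\<close>.\<close>

lemma eigenvector_exists:
  assumes T: "operator_on S T" and S: "subspace S" and v: "v \<in> S" "v \<noteq> 0"
  obtains w c where "w \<in> S" "w \<noteq> 0" "T w = sc c w"
proof -
  define u where "u k = (T ^^ k) v" for k
  have uS: "u k \<in> S" for k
    by (induction k) (use v operator_onD[OF T] in \<open>auto simp: u_def\<close>)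
  \<comment> \<open>\<open>ev m p\<close> is \<open>p(T) v\<close>. The length \<open>m\<close> of
    the sum is left free so that multiplying \<open>p\<close> by the variable becomes a shift of the
    sum; above the degree the length does not change the value.\<close>
  define ev where "ev m p = (\<Sum>k<m. sc (poly.coeff p k) (u k))" for m p
  have ev_eq: "ev m p = ev m' p" if "degree p < m" "degree p < m'" for m m' p
  proof -
    have "ev m p = ev (Suc (degree p)) p" if "degree p < m" for m
      unfolding ev_def using that by (intro sum.mono_neutral_right) (auto simp: coeff_eq_0)
    then show ?thesis using that by metis
  qed
  have evS: "ev m p \<in> S" for m p
    unfolding ev_def using uS S by (intro sum_in_subspace) auto
  have T_ev: "T (ev m p) = ev (Suc m) (pCons 0 p)" for m p
    unfolding ev_def sum.lessThan_Suc_shift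
    by (subst operator_on_sum[OF T S uS]) (simp add: u_def)
  define annihilates where "annihilates p \<longleftrightarrow> p \<noteq> 0 \<and> ev (Suc (degree p)) p = 0" for p
  obtain c where c: "\<exists>k<Suc (dim S). c k \<noteq> 0" "(\<Sum>k<Suc (dim S). sc (c k) (u k)) = 0"
    using family_dependent[OF S, of "Suc (dim S)" u] uS by auto
  have "\<exists>p. annihilates p"
  proof -
    define p where "p = Poly (map c [0..<Suc (dim S)])"
    have coeff: "poly.coeff p k = (if k < Suc (dim S) then c k else 0)" for k
      by (simp add: p_def nth_default_def del: upt_Suc)
    then have "p \<noteq> 0" using c(1) by (metis coeff_0)
    have "degree p \<le> dim S" by (rule degree_le) (simp add: coeff)
    then have "ev (Suc (degree p)) p = ev (Suc (dim S)) p" by (intro ev_eq) auto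
    also have "\<dots> = 0" unfolding ev_def using c(2) by (simp add: coeff del: sum.lessThan_Suc)
    finally show ?thesis using \<open>p \<noteq> 0\<close> annihilates_def by blast
  qed
  then obtain p where p: "annihilates p" and min: "\<And>q. annihilates q \<Longrightarrow> degree p \<le> degree q"
    by (metis arg_min_natI arg_min_nat_le)
  have "degree p \<noteq> 0"
  proof
    assume "degree p = 0"
    then obtain a where "p = [:a:]" by (meson degree_eq_zeroE)
    then show False using p v by (auto simp: annihilates_def ev_def u_def)
  qed
  then have "\<not> constant (poly p)" by (simp add: constant_degree)
  then obtain z where "poly p z = 0" using fundamental_theorem_of_algebra by blast
  then obtain q where pq: "p = [:- z, 1:] * q" by (metis dvdE poly_eq_0_iff_dvd)
  have q0: "q \<noteq> 0" using p pq by (auto simp: annihilates_def)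
  have deg: "degree p = Suc (degree q)" unfolding pq using q0 by (subst degree_mult_eq) auto
  define w where "w = ev (Suc (degree q)) q"
  have "w \<noteq> 0" using min[of q] deg q0 by (auto simp: annihilates_def w_def)
  moreover have "T w = sc z w"
  proof -
    have pq': "p = pCons 0 q - Polynomial.smult z q" by (simp add: pq)
    have "ev (Suc (degree p)) p = ev (Suc (degree p)) (pCons 0 q) - sc z (ev (Suc (degree p)) q)"
      unfolding ev_def pq' by (simp add: scale_left_diff_distrib sum_subtractf scale_sum_right del: sum.lessThan_Suc)
    also have "ev (Suc (degree p)) q = w" unfolding w_def by (rule ev_eq) (auto simp: deg)
    also have "ev (Suc (degree p)) (pCons 0 q) = T w" unfolding T_ev w_def deg ..
    finally show ?thesis using p by (simp add: annihilates_def)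
  qed
  ultimately show ?thesis using that[of w z] evS w_def by blast
qed

lemma normalize:
  assumes "x \<in> P" "x \<noteq> 0"
  obtains r where "r \<noteq> 0" "h (sc r x) (sc r x) = 1"
proof -
  define s where "s = sqrt (Re (h x x))"
  have s: "s > 0" "s * s = Re (h x x)" using positive[OF assms] by (auto simp: s_def)
  have "h (sc (of_real (1/s)) x) (sc (of_real (1/s)) x) = of_real ((1/s) * (1/s)) * h x x"
    by (simp add: h_scale_left h_scale_right)
  also have "h x x = of_real (s * s)" using s h_self_real by simp
  also have "complex_of_real ((1/s) * (1/s)) * complex_of_real (s * s) = 1"
    using s(1) by simp
  finally show ?thesis using s(1) by (intro that[of "of_real (1/s)"]) auto
qed

text \<open>
  The orthogonality hypothesis is shared by self-adjoint and unitary operators and is inherited by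
  invariant subspaces, which makes the induction go through.
\<close>

lemma orthonormal_eigenbasis:
  assumes "subspace S" "S \<subseteq> P" "operator_on S T"
    and "\<And>v c y. v \<in> S \<Longrightarrow> y \<in> S \<Longrightarrow> v \<noteq> 0 \<Longrightarrow> T v = sc c v \<Longrightarrow> h y v = 0 \<Longrightarrow> h (T y) v = 0"
  obtains e z where "orthonormal (dim S) e" "\<And>i. i < dim S \<Longrightarrow> e i \<in> S"
    "\<And>i. i < dim S \<Longrightarrow> T (e i) = sc (z i) (e i)"
proof -
  have "\<exists>e z. orthonormal (dim S) e \<and> (\<forall>i<dim S. e i \<in> S \<and> T (e i) = sc (z i) (e i))"
    using assms
  proof (induction "dim S" arbitrary: S)
    case 0
    have "orthonormal 0 (\<lambda>_. 0)" by (simp add: orthonormal_def)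
    then show ?case using 0 by (metis less_nat_zero_code)
  next
    case (Suc d)
    have "\<not> S \<subseteq> {0}" using Suc(2) by (metis Zero_not_Suc dim_eq_0)
    then obtain v0 where "v0 \<in> S" "v0 \<noteq> 0" by blast
    then obtain w c where w: "w \<in> S" "w \<noteq> 0" "T w = sc c w"
      using eigenvector_exists[OF Suc(5,3)] by metis
    obtain r where r: "r \<noteq> 0" "h (sc r w) (sc r w) = 1" using normalize w(1,2) Suc(4) by blast
    define v where "v = sc r w"
    have v: "v \<in> S" "h v v = 1" "T v = sc c v" "v \<noteq> 0"
      using r w Suc(3) operator_onD[OF Suc(5)]
      by (auto simp: v_def mult.commute intro!: subspace_scale)
    \<comment> \<open>The hypothesis on orthogonal vectors makes this complement invariant. It has
      exactly one dimension less: it misses \<open>v\<close> and is cut out by a single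
      functional.\<close>
    define S' where "S' = S \<inter> {x. h x v = 0}"
    have sub': "subspace S'"
      using Suc(3) by (auto simp: S'_def subspace_def h_add_left h_scale_left)
    have "S' \<subseteq> S" "v \<notin> S'" using v by (auto simp: S'_def)
    then have "S' \<noteq> S" using v(1) by blast
    with \<open>S' \<subseteq> S\<close> have "dim S' < dim S"
      using subspace_dim_equal[OF sub' Suc(3)] dim_subset[of S' S] by fastforce
    moreover have "dim S \<le> dim S' + 1"
      using dim_Int_hyperplane[OF Suc(3) linear_h_left] by (simp add: S'_def)
    ultimately have d: "d = dim S'" using Suc(2) by simp
    have op': "operator_on S' T"
      using Suc(5) Suc(6)[OF v(1) _ v(4) v(3)] by (auto simp: operator_on_def S'_def)
    obtain e z where ez: "orthonormal d e" "\<And>i. i < d \<Longrightarrow> e i \<in> S'"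
        "\<And>i. i < d \<Longrightarrow> T (e i) = sc (z i) (e i)"
      using Suc(1)[OF d sub' _ op'] Suc(4,6) \<open>S' \<subseteq> S\<close> d by (metis subset_iff)
    define e' where "e' i = (if i < d then e i else v)" for i
    define z' where "z' i = (if i < d then z i else c)" for i
    have ev: "h (e i) v = 0" "h v (e i) = 0" if "i < d" for i
      using ez(2)[OF that] hermitian[of v "e i"] by (auto simp: S'_def)
    have "orthonormal (dim S) e'"
      using ez(1) v Suc(2,4) ev by (auto simp: orthonormal_def e'_def less_Suc_eq)
    moreover have "e' i \<in> S \<and> T (e' i) = sc (z' i) (e' i)" if "i < dim S" for i
      using that ez(2,3) v Suc(2) by (auto simp: e'_def z'_def S'_def)
    ultimately show ?case by blast
  qed
  then show ?thesis using that by blast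
qed

end

section \<open>Spectrum, determinant and defect of unitary operators\<close>

definition turn :: "complex \<Rightarrow> real"
  where "turn z = frac (- Arg z / (2 * pi))"

lemma turn_nonneg: "0 \<le> turn z" and turn_less_1: "turn z < 1"
  by (simp_all add: turn_def frac_lt_1)

lemma cis_eq_iff_int: "cis x = cis y \<longleftrightarrow> (\<exists>k::int. x = y + 2 * pi * of_int k)"
proof -
  have "cis x = cis y \<longleftrightarrow> (\<exists>k::int. \<i> * complex_of_real x = \<i> * complex_of_real y + (of_int (2 * k) * of_real pi) * \<i>)"
    unfolding cis_conv_exp exp_eq by simp
  also have "\<dots> \<longleftrightarrow> (\<exists>k::int. x = y + 2 * pi * of_int k)"
  proof (rule arg_cong[of _ _ Ex], rule ext)
    fix k :: int
    have "\<i> * complex_of_real x = \<i> * complex_of_real y + (of_int (2 * k) * of_real pi) * \<i>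
      \<longleftrightarrow> complex_of_real x = complex_of_real (y + 2 * pi * of_int k)"
      by (auto simp: complex_eq_iff)
    then show "(\<i> * complex_of_real x = \<i> * complex_of_real y + (of_int (2 * k) * of_real pi) * \<i>)
      = (x = y + 2 * pi * of_int k)"
      using of_real_eq_iff by metis
  qed
  finally show ?thesis .
qed

lemma cis_frac: "cis (2 * pi * frac x) = cis (2 * pi * x)"
  unfolding cis_eq_iff_int by (intro exI[of _ "- \<lfloor>x\<rfloor>"]) (simp add: frac_def algebra_simps)

lemma cis_turn: "cmod z = 1 \<Longrightarrow> cis (- (2 * pi * turn z)) = z"
proof -
  assume "cmod z = 1"
  then have "z \<noteq> 0" "sgn z = z" by (auto simp: sgn_eq)
  then have "cis (Arg z) = z" using cis_Arg by metis
  moreover have "cis (- (2 * pi * turn z)) = cnj (cis (2 * pi * turn z))" by (simp add: cis_cnj)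
  moreover have "cis (2 * pi * turn z) = cnj (cis (Arg z))"
    unfolding turn_def cis_frac by (simp add: cis_cnj)
  ultimately show ?thesis by simp
qed

lemma turn_unique:
  assumes "0 \<le> x" "x < 1" "z = cis (- (2 * pi * x))"
  shows "turn z = x"
proof -
  have "cis (- (2 * pi * turn z)) = cis (- (2 * pi * x))" using assms by (simp add: cis_turn)
  then obtain k :: int where "- (2 * pi * turn z) = - (2 * pi * x) + 2 * pi * of_int k"
    unfolding cis_eq_iff_int by blast
  then have "2 * pi * (turn z - x) = 2 * pi * (- of_int k)" by (simp add: algebra_simps)
  then have k: "turn z - x = - of_int k" by (subst (asm) mult_cancel_left) simp
  have "\<bar>turn z - x\<bar> < 1" using assms turn_nonneg[of z] turn_less_1[of z] by linarith
  then have "k = 0" using k by simp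
  then show ?thesis using k by simp
qed

lemma turn_cis: "turn (cis x) = frac (- x / (2 * pi))"
proof (rule turn_unique)
  have "cis (- (2 * pi * frac (- x / (2 * pi)))) = cnj (cis (2 * pi * frac (- x / (2 * pi))))"
    by (simp add: cis_cnj)
  also have "\<dots> = cis x" unfolding cis_frac by (simp add: cis_cnj)
  finally show "cis x = cis (- (2 * pi * frac (- x / (2 * pi))))" ..
qed (auto simp: frac_lt_1)

text \<open>This identity dictates the sign in \<open>turn\<close>: the difference \<lceil>y\<rceil>
  - y is the fractional part of -y. It splits an index into a part seen by the determinant and a
  part depending on endpoints only.\<close>

lemma ceiling_eq_turn: "of_int \<lceil>x / (2 * pi)\<rceil> = x / (2 * pi) + turn (cis x)"
  unfolding turn_cis frac_def ceiling_def by simp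

lemma turn_eq_0_iff: "cmod z = 1 \<Longrightarrow> turn z = 0 \<longleftrightarrow> z = 1"
  using cis_turn[of z] turn_cis[of 0] by auto

section \<open>Unitary operators on the definite subspace and their spectra\<close>

context definite_subspace
begin

text \<open>All conditions are restricted to \<open>P\<close>, because the operators built from
  Lagrangian subspaces come from definite descriptions and are uncontrolled elsewhere.\<close>

definition unitary_on :: "('a \<Rightarrow> 'a) \<Rightarrow> bool"
  where "unitary_on T \<longleftrightarrow> operator_on P T \<and> (\<forall>x\<in>P. \<forall>y\<in>P. h (T x) (T y) = h x y)"

definition eigenbasis :: "('a \<Rightarrow> 'a) \<Rightarrow> (nat \<Rightarrow> 'a) \<Rightarrow> (nat \<Rightarrow> complex) \<Rightarrow> bool"
  where "eigenbasis T e z \<longleftrightarrow> orthonormal (dim P) e \<and> (\<forall>i<dim P. T (e i) = sc (z i) (e i))"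

definition eigenspace :: "('a \<Rightarrow> 'a) \<Rightarrow> complex \<Rightarrow> 'a set"
  where "eigenspace T c = {y \<in> P. T y = sc c y}"

text \<open>The counting clause is the one of \<open>eigenangles\<close>. It determines
  \<open>w\<close> up to order, so symmetric functions of \<open>w\<close> depend on
  \<open>T\<close> alone.\<close>

definition has_spectrum :: "('a \<Rightarrow> 'a) \<Rightarrow> (nat \<Rightarrow> complex) \<Rightarrow> bool"
  where "has_spectrum T w \<longleftrightarrow> (\<forall>c. dim (eigenspace T c) = card {i. i < dim P \<and> w i = c})"

lemma unitary_onD:
  assumes "unitary_on T"
  shows "operator_on P T" "x \<in> P \<Longrightarrow> T x \<in> P" "x \<in> P \<Longrightarrow> y \<in> P \<Longrightarrow> h (T x) (T y) = h x y"
  using assms by (auto simp: unitary_on_def operator_on_def)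

lemma subspace_eigenspace: "operator_on P T \<Longrightarrow> subspace (eigenspace T c)"
  using subspace_P
  by (auto simp: eigenspace_def operator_on_def subspace_def scale_right_distrib mult.commute)
    (metis scale_zero_left scale_zero_right)

lemma unitary_eigenvalue:
  assumes "unitary_on T" "x \<in> P" "x \<noteq> 0" "T x = sc c x"
  shows "cmod c = 1"
proof -
  have "c * cnj c * h x x = h x x"
    using unitary_onD(3)[OF assms(1,2,2)] assms(4) by (simp add: h_scale_left h_scale_right mult_ac)
  then have "(c * cnj c - 1) * h x x = 0" by (simp only: left_diff_distrib mult_1_left diff_self)
  then have "c * cnj c = 1"
    using h_self_eq_0_iff[OF assms(2)] assms(3) by (simp only: mult_eq_0_iff) simp
  then have "complex_of_real ((cmod c)\<^sup>2) = of_real 1" by (simp only: complex_norm_square of_real_1)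
  then have "(cmod c)\<^sup>2 = 1" by (simp only: of_real_eq_iff)
  then show ?thesis using norm_ge_zero[of c] by (simp add: power2_eq_1_iff)
qed

lemma unitary_eigenbasis:
  assumes T: "unitary_on T"
  obtains e z where "eigenbasis T e z" "\<And>i. i < dim P \<Longrightarrow> cmod (z i) = 1"
proof -
  have "h (T y) v = 0" if "v \<in> P" "y \<in> P" "v \<noteq> 0" "T v = sc c v" "h y v = 0" for v c y
  proof -
    have "cnj c * h (T y) v = 0"
      using unitary_onD(3)[OF T that(2,1)] that by (simp add: h_scale_right)
    moreover have "c \<noteq> 0" using unitary_eigenvalue[OF T that(1,3,4)] by auto
    ultimately show ?thesis by simp
  qed
  then obtain e z where ez: "orthonormal (dim P) e" "\<And>i. i < dim P \<Longrightarrow> T (e i) = sc (z i) (e i)"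
    using orthonormal_eigenbasis[OF subspace_P subset_refl unitary_onD(1)[OF T]] by metis
  moreover have "cmod (z i) = 1" if "i < dim P" for i
    using orthonormal_h[OF ez(1) that that]
    by (intro unitary_eigenvalue[OF T orthonormal_in[OF ez(1) that] _ ez(2)[OF that]]) auto
  ultimately show ?thesis using that by (auto simp: eigenbasis_def)
qed

lemma eigenbasis_apply:
  assumes "operator_on P T" "eigenbasis T e z" "x \<in> P"
  shows "T x = (\<Sum>i<dim P. sc (h x (e i) * z i) (e i))"
proof -
  have e: "orthonormal (dim P) e" using assms by (simp add: eigenbasis_def)
  have "T x = T (\<Sum>i<dim P. sc (h x (e i)) (e i))"
    using orthonormal_expansion[OF e assms(3)] by simp
  also have "\<dots> = (\<Sum>i<dim P. sc (h x (e i)) (T (e i)))"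
    by (rule operator_on_sum[OF assms(1) subspace_P]) (use orthonormal_in[OF e] in auto)
  finally show ?thesis using assms(2) by (simp add: eigenbasis_def)
qed

lemma eigenspace_eq_span:
  assumes T: "operator_on P T" and ez: "eigenbasis T e z"
  shows "eigenspace T c = span (e ` {i. i < dim P \<and> z i = c})" (is "_ = span (e ` ?I)")
proof
  have e: "orthonormal (dim P) e" using ez by (simp add: eigenbasis_def)
  show "eigenspace T c \<subseteq> span (e ` ?I)"
  proof
    fix x assume "x \<in> eigenspace T c"
    then have x: "x \<in> P" "T x = sc c x" by (auto simp: eigenspace_def)
    have **: "h x (e i) = 0" if i: "i < dim P" "z i \<noteq> c" for i
    proof -
      have "h (T x) (e i) = h x (e i) * z i"
        unfolding eigenbasis_apply[OF T ez x(1)]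
        using h_sum_orthonormal[OF e subset_refl i(1)] i(1) by simp
      then show ?thesis using x i by (simp add: h_scale_left)
    qed
    then have "x = (\<Sum>i\<in>?I. sc (h x (e i)) (e i))"
      by (subst orthonormal_expansion[OF e x(1)], intro sum.mono_neutral_right) (auto simp: **)
    also have "\<dots> \<in> span (e ` ?I)" by (intro span_sum span_scale span_base) auto
    finally show "x \<in> span (e ` ?I)" .
  qed
  show "span (e ` ?I) \<subseteq> eigenspace T c"
    using ez orthonormal_in[OF e]
    by (intro span_minimal subspace_eigenspace[OF T]) (auto simp: eigenspace_def eigenbasis_def)
qed

lemma eigenbasis_has_spectrum:
  assumes "operator_on P T" "eigenbasis T e z"
  shows "has_spectrum T z"
proof -
  have "{i. i < dim P \<and> z i = c} \<subseteq> {..<dim P}" for c by auto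
  then show ?thesis
    using orthonormal_independent(2)[of "dim P" e] assms(2)
    unfolding has_spectrum_def eigenspace_eq_span[OF assms]
    by (auto simp: eigenbasis_def)
qed

lemma unitary_has_spectrum: "unitary_on T \<Longrightarrow> \<exists>w. has_spectrum T w"
  by (metis unitary_eigenbasis eigenbasis_has_spectrum unitary_onD(1))

lemma has_spectrum_unique:
  assumes "has_spectrum T w" "has_spectrum T w'"
  shows "image_mset w (mset_set {..<dim P}) = image_mset w' (mset_set {..<dim P})"
proof (rule multiset_eqI)
  fix c
  have *: "count (image_mset w (mset_set {..<dim P})) c = card {i. i < dim P \<and> w i = c}" for w :: "nat \<Rightarrow> complex"
    by (auto simp: count_image_mset_eq_card_vimage conj_commute vimage_def intro!: arg_cong[of _ _ card])
  show "count (image_mset w (mset_set {..<dim P})) c = count (image_mset w' (mset_set {..<dim P})) c"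
    using assms unfolding * has_spectrum_def by metis
qed

lemma has_spectrum_sum:
  assumes "has_spectrum T w" "has_spectrum T w'"
  shows "(\<Sum>i<dim P. f (w i)) = (\<Sum>i<dim P. f (w' i))"
  using arg_cong[OF has_spectrum_unique[OF assms], of "\<lambda>M. \<Sum>x\<in>#M. f x"]
  by (simp add: sum_unfold_sum_mset multiset.map_comp o_def)

definition defect :: "('a \<Rightarrow> 'a) \<Rightarrow> real"
  where "defect T = (\<Sum>i<dim P. turn ((SOME w. has_spectrum T w) i))"

lemma defect_eq: "has_spectrum T w \<Longrightarrow> defect T = (\<Sum>i<dim P. turn (w i))"
  unfolding defect_def by (rule has_spectrum_sum[OF someI[of "has_spectrum T" w]])

lemma defect_cong:
  assumes "\<And>x. x \<in> P \<Longrightarrow> A x = B x"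
  shows "defect A = defect B"
proof -
  have "eigenspace A c = eigenspace B c" for c using assms by (auto simp: eigenspace_def)
  then show ?thesis by (simp add: defect_def has_spectrum_def)
qed

lemma dim_eigenspace_1:
  assumes "has_spectrum T w"
  shows "dim (eigenspace T 1) + card {i. i < dim P \<and> w i \<noteq> 1} = dim P"
proof -
  have "card {i. i < dim P \<and> w i = 1} + card {i. i < dim P \<and> w i \<noteq> 1}
    = card ({i. i < dim P \<and> w i = 1} \<union> {i. i < dim P \<and> w i \<noteq> 1})"
    by (rule card_Un_disjoint[symmetric]) auto
  also have "{i. i < dim P \<and> w i = 1} \<union> {i. i < dim P \<and> w i \<noteq> 1} = {..<dim P}" by auto
  finally show ?thesis using assms by (simp add: has_spectrum_def)
qed

section \<open>Determinants on the definite subspace\<close>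

definition basis_P :: "nat \<Rightarrow> 'a"
  where "basis_P = (SOME e. orthonormal (dim P) e)"

lemma orthonormal_basis_P: "orthonormal (dim P) basis_P"
proof -
  have "unitary_on (\<lambda>x. x)" by (simp add: unitary_on_def operator_on_def)
  then have "\<exists>e. orthonormal (dim P) e" using unitary_eigenbasis[of "\<lambda>x. x"] eigenbasis_def by metis
  then show ?thesis unfolding basis_P_def by (rule someI_ex)
qed

definition det_on :: "('a \<Rightarrow> 'a) \<Rightarrow> complex"
  where "det_on T = Determinant.det (mat (dim P) (dim P) (\<lambda>(i, j). h (T (basis_P j)) (basis_P i)))"

lemma det_on_cong: "(\<And>x. x \<in> P \<Longrightarrow> A x = B x) \<Longrightarrow> det_on A = det_on B"
  unfolding det_on_def using orthonormal_in[OF orthonormal_basis_P]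
  by (intro arg_cong[of _ _ Determinant.det] cong_mat) auto

lemma det_on_compose:
  assumes A: "operator_on P A" and B: "operator_on P B"
  shows "det_on (A \<circ> B) = det_on A * det_on B"
proof -
  note e = orthonormal_basis_P
  have AB: "h (A (B (basis_P j))) (basis_P i)
    = (\<Sum>k<dim P. h (A (basis_P k)) (basis_P i) * h (B (basis_P j)) (basis_P k))"
    if "i < dim P" "j < dim P" for i j
  proof -
    have Bj: "B (basis_P j) \<in> P" using operator_onD[OF B] orthonormal_in[OF e] that by blast
    have "A (B (basis_P j)) = A (\<Sum>k<dim P. sc (h (B (basis_P j)) (basis_P k)) (basis_P k))"
      using orthonormal_expansion[OF e Bj] by simp
    also have "\<dots> = (\<Sum>k<dim P. sc (h (B (basis_P j)) (basis_P k)) (A (basis_P k)))"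
      by (rule operator_on_sum[OF A subspace_P]) (use orthonormal_in[OF e] in auto)
    finally show ?thesis by (simp add: h_sum_left h_scale_left mult.commute)
  qed
  have "mat (dim P) (dim P) (\<lambda>(i, j). h ((A \<circ> B) (basis_P j)) (basis_P i))
    = mat (dim P) (dim P) (\<lambda>(i, j). h (A (basis_P j)) (basis_P i))
      * mat (dim P) (dim P) (\<lambda>(i, j). h (B (basis_P j)) (basis_P i))"
    by (rule eq_matI) (auto simp: scalar_prod_def AB atLeast0LessThan)
  then show ?thesis unfolding det_on_def by (simp add: det_mult[of _ "dim P"])
qed

lemma det_on_basis_P_diagonal:
  assumes "\<And>i. i < dim P \<Longrightarrow> T (basis_P i) = sc (z i) (basis_P i)"
  shows "det_on T = (\<Prod>i<dim P. z i)"
proof -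
  let ?M = "mat (dim P) (dim P) (\<lambda>(i, j). h (T (basis_P j)) (basis_P i))"
  have *: "?M $$ (i, j) = (if i = j then z i else 0)" if "i < dim P" "j < dim P" for i j
    using that assms orthonormal_h[OF orthonormal_basis_P] by (auto simp: h_scale_left)
  have "Determinant.det ?M = prod_list (diag_mat ?M)"
    by (rule det_upper_triangular[of _ "dim P"]) (use * in \<open>auto simp: upper_triangular_def simp del: index_mat\<close>)
  also have "diag_mat ?M = map z [0..<dim P]" unfolding diag_mat_def using * by simp
  also have "prod_list \<dots> = (\<Prod>i<dim P. z i)"
    by (subst prod.distinct_set_conv_list[symmetric]) (auto simp: atLeast0LessThan)
  finally show ?thesis by (simp add: det_on_def)
qed

text \<open>The determinant is taken in the fixed basis \<open>basis_P\<close>. Conjugation by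
  \<open>V\<close>, which carries that basis to the eigenbasis, makes \<open>T\<close> diagonal in
  it, and the two determinants of the change of basis multiply to 1.\<close>

lemma det_on_eigenbasis:
  assumes T: "operator_on P T" and vz: "eigenbasis T v z"
  shows "det_on T = (\<Prod>i<dim P. z i)"
proof -
  note e = orthonormal_basis_P
  have v: "orthonormal (dim P) v" using vz by (simp add: eigenbasis_def)
  define V where "V x = (\<Sum>i<dim P. sc (h x (basis_P i)) (v i))" for x
  define V' where "V' x = (\<Sum>i<dim P. sc (h x (v i)) (basis_P i))" for x
  have V: "operator_on P V"
    using orthonormal_in[OF v] subspace_P unfolding operator_on_def V_def
    by (auto simp: h_add_left h_scale_left sum.distrib scale_sum_right scale_left_distrib
        intro!: sum_in_subspace)
  have V': "operator_on P V'"
    using orthonormal_in[OF e] subspace_P unfolding operator_on_def V'_def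
    by (auto simp: h_add_left h_scale_left sum.distrib scale_sum_right scale_left_distrib
        intro!: sum_in_subspace)
  have Ve: "V (basis_P i) = v i" if "i < dim P" for i
  proof -
    have "V (basis_P i) = (\<Sum>j<dim P. if j = i then v j else 0)"
      unfolding V_def by (rule sum.cong) (use that orthonormal_h[OF e] in auto)
    then show ?thesis using that by simp
  qed
  have V'v: "V' (v i) = basis_P i" if "i < dim P" for i
  proof -
    have "V' (v i) = (\<Sum>j<dim P. if j = i then basis_P j else 0)"
      unfolding V'_def by (rule sum.cong) (use that orthonormal_h[OF v] in auto)
    then show ?thesis using that by simp
  qed
  have "det_on (V' \<circ> (T \<circ> V)) = (\<Prod>i<dim P. z i)"
    by (rule det_on_basis_P_diagonal)
      (use vz V'v orthonormal_in[OF v] operator_onD[OF V'] in \<open>auto simp: Ve eigenbasis_def\<close>)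
  moreover have TV: "operator_on P (T \<circ> V)" using T V by (auto simp: operator_on_def)
  moreover have "det_on V' * det_on V = 1"
    using det_on_basis_P_diagonal[of "V' \<circ> V" "\<lambda>_. 1"] det_on_compose[OF V' V] by (simp add: Ve V'v)
  ultimately show ?thesis
    using det_on_compose[OF V' TV] det_on_compose[OF T V] by (simp add: algebra_simps)
qed

text \<open>The left side depends continuously on the matrix coefficients of \<open>T\<close>, and
  its values for all \<open>c\<close> determine the multiset of eigenvalues. This is how spectra
  pass to limits.\<close>

lemma det_on_char_poly:
  assumes T: "unitary_on T" and w: "has_spectrum T w"
  shows "det_on (\<lambda>x. sc c x - T x) = (\<Prod>i<dim P. c - w i)"
proof -
  obtain e z where ez: "eigenbasis T e z" using unitary_eigenbasis[OF T] by blast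
  have op: "operator_on P (\<lambda>x. sc c x - T x)"
    using unitary_onD(1)[OF T] subspace_P
    by (auto simp: operator_on_def scale_right_distrib scale_right_diff_distrib mult.commute
        intro!: subspace_diff subspace_scale)
  have "eigenbasis (\<lambda>x. sc c x - T x) e (\<lambda>i. c - z i)"
    using ez by (auto simp: eigenbasis_def scale_left_diff_distrib)
  then have "det_on (\<lambda>x. sc c x - T x) = (\<Prod>i<dim P. c - z i)" by (rule det_on_eigenbasis[OF op])
  also have "\<dots> = (\<Prod>i<dim P. c - w i)"
    using arg_cong[OF has_spectrum_unique[OF eigenbasis_has_spectrum[OF unitary_onD(1)[OF T] ez] w],
        of "\<lambda>M. \<Prod>x\<in>#M. c - x"]
    by (simp add: prod_unfold_prod_mset multiset.map_comp o_def)
  finally show ?thesis .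
qed

text \<open>The determinant thus fixes the defect modulo 1, so multiplicativity of determinants
  makes defects additive up to an integer.\<close>

lemma det_on_unitary:
  assumes T: "unitary_on T"
  shows "det_on T = cis (- (2 * pi * defect T))"
proof -
  obtain e z where ez: "eigenbasis T e z" "\<And>i. i < dim P \<Longrightarrow> cmod (z i) = 1"
    using unitary_eigenbasis[OF T] by blast
  note T' = unitary_onD(1)[OF T]
  have "det_on T = (\<Prod>i<dim P. cis (- (2 * pi * turn (z i))))"
    unfolding det_on_eigenbasis[OF T' ez(1)] by (rule prod.cong) (auto simp: cis_turn ez)
  also have "\<dots> = cis (\<Sum>i<dim P. - (2 * pi * turn (z i)))"
    by (simp add: cis_conv_exp exp_sum[symmetric] sum_distrib_left)
  finally show ?thesis
    by (simp add: defect_eq[OF eigenbasis_has_spectrum[OF T' ez(1)]] sum_negf sum_distrib_left)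
qed

lemma continuous_on_det_on:
  assumes "\<And>x y. x \<in> P \<Longrightarrow> y \<in> P \<Longrightarrow> continuous_on K (\<lambda>p. h (T p x) y)"
  shows "continuous_on K (\<lambda>p. det_on (T p))"
proof -
  have "continuous_on K (\<lambda>p. \<Sum>\<pi> | \<pi> permutes {0..<dim P}. signof \<pi> *
    (\<Prod>i = 0..<dim P. h (T p (basis_P (\<pi> i))) (basis_P i)))"
    using orthonormal_in[OF orthonormal_basis_P]
    by (intro continuous_intros assms) (auto dest: permutes_in_image)
  also have "(\<lambda>p. \<Sum>\<pi> | \<pi> permutes {0..<dim P}. signof \<pi> *
    (\<Prod>i = 0..<dim P. h (T p (basis_P (\<pi> i))) (basis_P i))) = (\<lambda>p. det_on (T p))"
    unfolding det_on_def
    by (subst det_def'[of _ "dim P"])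
      (auto intro!: ext sum.cong prod.cong arg_cong2[of _ _ _ _ "(*)"] dest: permutes_in_image)
  finally show ?thesis .
qed

end

section \<open>The defect of a composition\<close>

text \<open>The zero line passes through 1 and \<open>cis (- (2 * pi * s))\<close>, and is the
  tangent at 1 when \<open>s = 0\<close>. For 0 \<le> s < 1 its nonnegative side cuts out of the
  circle the arc of points of turn at most \<open>s\<close>.\<close>

definition halfplane :: "real \<Rightarrow> complex \<Rightarrow> real"
  where "halfplane s z = Re (cis (pi * s) * z) - cos (pi * s)"

lemma halfplane_1 [simp]: "halfplane s 1 = 0"
  by (simp add: halfplane_def)

lemma halfplane_eq:
  assumes "cmod z = 1"
  shows "halfplane s z = 2 * sin (pi * (s - turn z)) * sin (pi * turn z)"
proof -
  have "Re (cis (pi * s) * z) = cos (pi * s - 2 * pi * turn z)"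
    using cis_turn[OF assms] by (metis cis.sel(1) cis_mult diff_conv_add_uminus)
  also have "\<dots> - cos (pi * s) = 2 * sin (pi * (s - turn z)) * sin (pi * turn z)"
  proof -
    have "(pi * s - 2 * pi * turn z + pi * s) / 2 = pi * (s - turn z)"
      "(pi * s - (pi * s - 2 * pi * turn z)) / 2 = pi * turn z"
      by (simp_all add: field_simps)
    then show ?thesis unfolding cos_diff_cos by simp
  qed
  finally show ?thesis by (simp add: halfplane_def)
qed

lemma halfplane_nonneg:
  assumes "cmod z = 1" "turn z \<le> s" "s < 1"
  shows "halfplane s z \<ge> 0"
proof -
  have "s - turn z \<le> 1" using assms(3) turn_nonneg[of z] by linarith
  then show ?thesis
    unfolding halfplane_eq[OF assms(1)] using assms turn_nonneg[of z] turn_less_1[of z]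
    by (intro mult_nonneg_nonneg sin_ge_zero) (auto intro!: mult_left_le)
qed

lemma halfplane_neg:
  assumes "cmod z = 1" "s < turn z" "0 \<le> s"
  shows "halfplane s z < 0"
proof -
  have "0 < sin (pi * turn z)"
    using assms turn_less_1[of z] by (intro sin_gt_zero) auto
  moreover have "0 < sin (pi * (turn z - s))"
    using assms turn_less_1[of z] by (intro sin_gt_zero) auto
  moreover have "sin (pi * (s - turn z)) = - sin (pi * (turn z - s))"
    by (simp flip: sin_minus add: algebra_simps)
  ultimately show ?thesis unfolding halfplane_eq[OF assms(1)] by simp
qed

text \<open>For \<open>u\<close> in the unit interval, \<open>1 - u\<close> is the integral over 0
  \<le> s \<le> 1 of the indicator of u \<le> s. Integrating a bound between counting functions
  therefore gives a bound between sums, in the opposite direction.\<close>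

lemma sum_le_if_counts_le:
  fixes x y :: "nat \<Rightarrow> real" and d :: nat
  assumes x: "\<And>i. i < m \<Longrightarrow> 0 \<le> x i \<and> x i < 1" and y: "\<And>i. i < m \<Longrightarrow> 0 \<le> y i \<and> y i < 1"
    and le: "\<And>s. 0 \<le> s \<Longrightarrow> s < 1 \<Longrightarrow> card {i. i < m \<and> y i \<le> s} \<le> card {i. i < m \<and> x i \<le> s} + d"
  shows "(\<Sum>i<m. x i) \<le> (\<Sum>i<m. y i) + d"
proof -
  have count: "(\<Sum>i<m. if u i \<le> s then 1 else 0) = real (card {i. i < m \<and> u i \<le> s})"
    for u :: "nat \<Rightarrow> real" and s
  proof -
    have "{i. i < m \<and> u i \<le> s} = {i \<in> {..<m}. u i \<le> s}" by auto
    then show ?thesis by (simp add: sum.If_cases Int_def)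
  qed
  have *: "((\<lambda>s. \<Sum>i<m. if u i \<le> s then 1 else 0) has_integral (\<Sum>i<m. 1 - u i)) {0..1::real}"
    if u: "\<And>i. i < m \<Longrightarrow> 0 \<le> u i \<and> u i < 1" for u :: "nat \<Rightarrow> real"
  proof (rule has_integral_sum)
    fix i assume "i \<in> {..<m}"
    then have i: "0 \<le> u i" "u i < 1" using u by auto
    have "((\<lambda>_. 1) has_integral (1 - u i)) {u i..1}"
      using has_integral_const_real[of "1::real" "u i" 1] i by simp
    then have "((\<lambda>s. if s \<in> {u i..1} then 1 else 0) has_integral (1 - u i)) {0..1}"
      by (subst has_integral_restrict) (use i in auto)
    then show "((\<lambda>s. if u i \<le> s then 1 else 0) has_integral (1 - u i)) {0..1::real}"
      by (rule has_integral_eq[rotated]) auto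
  qed simp
  have "((\<lambda>s::real. real d) has_integral real d) {0..1}"
    using has_integral_const_real[of "real d" 0 1] by simp
  from has_integral_add[OF *[OF x] this]
  have "((\<lambda>s. (\<Sum>i<m. if x i \<le> s then 1 else 0) + real d) has_integral (\<Sum>i<m. 1 - x i) + d) {0..1}"
    by simp
  moreover have "((\<lambda>s. \<Sum>i<m. if y i \<le> s then 1 else 0) has_integral (\<Sum>i<m. 1 - y i)) {0..1::real}"
    by (rule *) (rule y)
  moreover have "(\<Sum>i<m. if y i \<le> s then 1 else 0) \<le> (\<Sum>i<m. if x i \<le> s then 1 else 0) + real d"
    if s: "s \<in> {0..1}" for s :: real
  proof (cases "s < 1")
    case True
    then show ?thesis unfolding count using le[of s] s by simp
  next
    case False
    \<comment> \<open>Only the endpoint \<open>s = 1\<close> is left, which the hypothesis on counts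
      does not cover; there every indicator equals 1.\<close>
    then have "(\<Sum>i<m. if y i \<le> s then 1 else 0) \<le> (\<Sum>i<m. if x i \<le> s then 1 else (0::real))"
      using x y by (intro sum_mono) (smt (verit) lessThan_iff)
    then show ?thesis by simp
  qed
  ultimately have "(\<Sum>i<m. 1 - y i) \<le> (\<Sum>i<m. 1 - x i) + d"
    using has_integral_le by blast
  then show ?thesis by (simp add: sum_subtractf)
qed

context definite_subspace
begin

text \<open>
  The numerical range of a unitary operator restricted to the eigenvalues of turn at most \<open>s\<close> lies
  in the half plane \<open>Re (cis (pi * s) * z) \<ge> cos (pi * s)\<close>, the other eigenvalues lie strictly
  outside.
\<close>

definition halfplane_form :: "real \<Rightarrow> ('a \<Rightarrow> 'a) \<Rightarrow> 'a \<Rightarrow> real"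
  where "halfplane_form s T x = Re (cis (pi * s) * h (T x) x) - cos (pi * s) * Re (h x x)"

lemma halfplane_form_eigenbasis:
  assumes "operator_on P T" "eigenbasis T e z" "x \<in> P"
  shows "halfplane_form s T x
    = (\<Sum>i<dim P. (cmod (h x (e i)))\<^sup>2 * halfplane s (z i))"
proof -
  have e: "orthonormal (dim P) e" using assms by (simp add: eigenbasis_def)
  have sq: "h x (e i) * h (e i) x = of_real ((cmod (h x (e i)))\<^sup>2)" for i
    using hermitian[of "e i" x] by (metis complex_norm_square)
  have "h (T x) x = (\<Sum>i<dim P. (h x (e i) * h (e i) x) * z i)"
    unfolding eigenbasis_apply[OF assms] by (simp add: h_sum_left h_scale_left mult_ac)
  then have "cis (pi * s) * h (T x) x
    = (\<Sum>i<dim P. of_real ((cmod (h x (e i)))\<^sup>2) * (cis (pi * s) * z i))"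
    unfolding sq by (simp add: sum_distrib_left mult_ac)
  then have 1: "Re (cis (pi * s) * h (T x) x)
      = (\<Sum>i<dim P. (cmod (h x (e i)))\<^sup>2 * Re (cis (pi * s) * z i))"
    by (simp only: scaleR_conv_of_real[symmetric] Re_sum scaleR_complex.sel)
  have 2: "Re (h x x) = (\<Sum>i<dim P. (cmod (h x (e i)))\<^sup>2)"
    unfolding parseval[OF e assms(3), of x] sq by simp
  show ?thesis
    unfolding halfplane_form_def halfplane_def 1 2 by (simp add: sum_distrib_left sum_subtractf right_diff_distrib mult.commute)
qed

text \<open>A single functional is injective on the intersection of \<open>S\<close> and
  \<open>T\<close>, so the intersection is at most a line; the rest is the dimension formula for
  sums.\<close>

lemma dim_le_if_trivial_Int_hyperplane:
  assumes S: "subspace S" "S \<subseteq> P" and T: "subspace T" "T \<subseteq> P"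
    and "\<And>x. x \<in> S \<Longrightarrow> x \<in> T \<Longrightarrow> h x v = 0 \<Longrightarrow> x = 0"
  shows "dim S + dim T \<le> dim P + 1"
proof -
  have "dim {x + y |x y. x \<in> S \<and> y \<in> T} \<le> dim P"
    using S T subspace_P by (intro dim_subset) (auto intro: subspace_add)
  moreover have "dim (S \<inter> T) \<le> dim (S \<inter> T \<inter> {x. h x v = 0}) + 1"
    by (rule dim_Int_hyperplane[OF subspace_inter[OF S(1) T(1)] linear_h_left])
  moreover have "S \<inter> T \<inter> {x. h x v = 0} \<subseteq> {0}" using assms(5) by auto
  then have "dim (S \<inter> T \<inter> {x. h x v = 0}) = 0" by (simp add: dim_eq_0)
  ultimately show ?thesis using dim_sums_Int[OF S(1) T(1)] by linarith
qed

section \<open>Interlacing for two unitary operators that agree on a hyperplane\<close>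

context
  fixes A B :: "'a \<Rightarrow> 'a" and e f :: "nat \<Rightarrow> 'a" and a b :: "nat \<Rightarrow> complex" and v :: 'a and s :: real
  assumes A: "unitary_on A" "eigenbasis A e a" and B: "unitary_on B" "eigenbasis B f b"
    and AB: "\<And>x. x \<in> P \<Longrightarrow> h x v = 0 \<Longrightarrow> A x = B x"
    and s: "0 \<le> s" "s < 1"
    and unimodular: "\<And>i. i < dim P \<Longrightarrow> cmod (a i) = 1" "\<And>i. i < dim P \<Longrightarrow> cmod (b i) = 1"
begin

text \<open>On the span of the eigenvectors of \<open>B\<close> of turn at most \<open>s\<close> the
  form of \<open>B\<close> is nonnegative, on \<open>T\<close> the form of \<open>A\<close> is
  nonpositive, and on the hyperplane the two forms coincide. A vector in all three spaces is a null
  vector, hence zero. The hyperplane accounts for the 1.\<close>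

lemma count_plus_dim_le:
  assumes T: "subspace T" "T \<subseteq> P"
    and nonpos: "\<And>x. x \<in> T \<Longrightarrow> halfplane_form s A x \<le> 0"
    and zero: "\<And>x. x \<in> T \<Longrightarrow> halfplane_form s A x = 0 \<Longrightarrow> h x v = 0 \<Longrightarrow> x = 0"
  shows "card {i. i < dim P \<and> turn (b i) \<le> s} + dim T \<le> dim P + 1"
proof -
  define I where "I = {i. i < dim P \<and> turn (b i) \<le> s}"
  have f: "orthonormal (dim P) f" using B(2) by (simp add: eigenbasis_def)
  have I: "I \<subseteq> {..<dim P}" by (auto simp: I_def)
  have SP: "span (f ` I) \<subseteq> P"
    using orthonormal_in[OF f] subspace_P I by (intro span_minimal) auto
  have "dim (span (f ` I)) + dim T \<le> dim P + 1"
  proof (rule dim_le_if_trivial_Int_hyperplane[OF subspace_span SP T])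
    fix x assume x: "x \<in> span (f ` I)" "x \<in> T" "h x v = 0"
    have off: "h x (f i) = 0" if "i < dim P" "i \<notin> I" for i
      by (subst span_orthonormal[OF f I x(1)], subst h_sum_orthonormal[OF f I that(1)]) (use that in auto)
    have "(cmod (h x (f i)))\<^sup>2 * halfplane s (b i) \<ge> 0" if "i < dim P" for i
      using off[OF that] halfplane_nonneg[of "b i" s] unimodular(2) s that
      by (cases "i \<in> I") (auto simp: I_def)
    then have "halfplane_form s B x \<ge> 0"
      using x(1) SP
      by (subst halfplane_form_eigenbasis[OF unitary_onD(1)[OF B(1)] B(2)]) (auto intro!: sum_nonneg)
    moreover have "halfplane_form s B x = halfplane_form s A x"
      using AB[OF _ x(3)] x SP by (auto simp: halfplane_form_def)
    ultimately show "x = 0" using zero[OF x(2) _ x(3)] nonpos[OF x(2)] by simp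
  qed
  then show ?thesis using orthonormal_independent(3)[OF f I] by (simp add: I_def)
qed

lemma orthonormal_e: "orthonormal (dim P) e"
  using A(2) by (simp add: eigenbasis_def)

definition above where "above = {i. i < dim P \<and> s < turn (a i)}"

lemma above: "above \<subseteq> {..<dim P}" by (auto simp: above_def)

lemma card_above: "card above + card {i. i < dim P \<and> turn (a i) \<le> s} = dim P"
proof -
  have "card above + card {i. i < dim P \<and> turn (a i) \<le> s}
    = card (above \<union> {i. i < dim P \<and> turn (a i) \<le> s})"
    by (rule card_Un_disjoint[symmetric]) (auto simp: above_def)
  also have "above \<union> {i. i < dim P \<and> turn (a i) \<le> s} = {..<dim P}" by (auto simp: above_def)
  finally show ?thesis by simp
qed

text \<open>The eigenvalue 1 lies on the boundary of every half plane, so components in its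
  eigenspace do not enter the form. Admitting them leaves room for a fixed vector of
  \<open>A\<close> in the test space.\<close>

lemma halfplane_form_above:
  assumes x: "x \<in> P" and off: "\<And>i. i < dim P \<Longrightarrow> i \<notin> above \<Longrightarrow> h x (e i) = 0 \<or> a i = 1"
  shows "halfplane_form s A x \<le> 0"
    and "halfplane_form s A x = 0 \<Longrightarrow> i \<in> above \<Longrightarrow> h x (e i) = 0"
proof -
  let ?t = "\<lambda>i. (cmod (h x (e i)))\<^sup>2 * halfplane s (a i)"
  have eq: "halfplane_form s A x = (\<Sum>i\<in>above. ?t i)"
    unfolding halfplane_form_eigenbasis[OF unitary_onD(1)[OF A(1)] A(2) x]
    using off above by (intro sum.mono_neutral_right) (auto, metis halfplane_1)
  have neg: "halfplane s (a i) < 0" if "i \<in> above" for i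
    using that s unimodular(1) by (intro halfplane_neg) (auto simp: above_def)
  have le: "?t i \<le> 0" if "i \<in> above" for i
    using neg[OF that] by (intro mult_nonneg_nonpos) auto
  show "halfplane_form s A x \<le> 0" unfolding eq using le by (rule sum_nonpos)
  assume "halfplane_form s A x = 0" and i: "i \<in> above"
  then have "(\<Sum>i\<in>above. - ?t i) = 0" unfolding eq by (simp add: sum_negf)
  moreover have "finite above" using above finite_subset by blast
  moreover have "\<And>i. i \<in> above \<Longrightarrow> - ?t i \<ge> 0" using le by fastforce
  ultimately have "- ?t i = 0" using sum_nonneg_eq_0_iff[of above "\<lambda>i. - ?t i"] i by blast
  then show "h x (e i) = 0" using neg[OF i] by simp
qed

text \<open>The test space is the span of the eigenvectors of \<open>A\<close> of turn greater than
  \<open>s\<close>, on which the form is negative definite and whose dimension is complementary to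
  the count for \<open>A\<close>.\<close>

lemma count_le_count_plus_1:
  "card {i. i < dim P \<and> turn (b i) \<le> s} \<le> card {i. i < dim P \<and> turn (a i) \<le> s} + 1"
proof -
  have sub: "span (e ` above) \<subseteq> P"
    using orthonormal_in[OF orthonormal_e] subspace_P above by (intro span_minimal) auto
  have off: "h x (e i) = 0" if "x \<in> span (e ` above)" "i < dim P" "i \<notin> above" for x i
    by (subst span_orthonormal[OF orthonormal_e above that(1)],
        subst h_sum_orthonormal[OF orthonormal_e above that(2)]) (use that in auto)
  have "card {i. i < dim P \<and> turn (b i) \<le> s} + dim (span (e ` above)) \<le> dim P + 1"
  proof (rule count_plus_dim_le[OF subspace_span sub])
    fix x assume x: "x \<in> span (e ` above)"
    then have xP: "x \<in> P" using sub by auto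
    show "halfplane_form s A x \<le> 0" by (rule halfplane_form_above[OF xP]) (use off[OF x] in auto)
    assume "halfplane_form s A x = 0"
    then have "h x (e i) = 0" if "i \<in> above" for i
      by (intro halfplane_form_above(2)[OF xP]) (use off[OF x] that in auto)
    then show "x = 0" by (subst span_orthonormal[OF orthonormal_e above x]) simp
  qed
  then show ?thesis
    using card_above orthonormal_independent(3)[OF orthonormal_e above] by linarith
qed

text \<open>The fixed vector enlarges the test space by one dimension and contributes nothing to the
  form. Since it lies off the hyperplane, no nonzero null vector of the larger space lies in the
  hyperplane. The extra dimension removes the 1 of \<open>count_le_count_plus_1\<close>.\<close>

lemma count_le_count_if_fixed:
  assumes x0: "x0 \<in> P" "A x0 = x0" "h x0 v \<noteq> 0"
  shows "card {i. i < dim P \<and> turn (b i) \<le> s} \<le> card {i. i < dim P \<and> turn (a i) \<le> s}"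
proof -
  define T where "T = span (insert x0 (e ` above))"
  \<comment> \<open>Eigenvectors of a unitary operator for different eigenvalues are orthogonal,
    here for 1 and \<open>a i\<close>.\<close>
  have off0: "h x0 (e i) = 0" if "i < dim P" "a i \<noteq> 1" for i
  proof -
    have ei: "e i \<in> P" "A (e i) = sc (a i) (e i)"
      using orthonormal_in[OF orthonormal_e] A(2) that by (auto simp: eigenbasis_def)
    have "(cnj (a i) - 1) * h x0 (e i) = 0"
      using unitary_onD(3)[OF A(1) x0(1) ei(1)] x0(2) ei(2)
      by (simp add: h_scale_right algebra_simps)
    moreover have "cnj (a i) \<noteq> 1" using that(2) by (metis complex_cnj_cnj complex_cnj_one)
    ultimately show ?thesis by simp
  qed
  have a1: "a i \<noteq> 1" if "i \<in> above" for i
    using that s turn_eq_0_iff[of "a i"] by (auto simp: above_def)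
  have sub: "T \<subseteq> P"
    using orthonormal_in[OF orthonormal_e] subspace_P above x0(1)
    unfolding T_def by (intro span_minimal) auto
  have decomp: "\<exists>c y. y \<in> span (e ` above) \<and> x = y + sc c x0" if "x \<in> T" for x
    using that unfolding T_def span_breakdown_eq by (metis diff_add_cancel)
  have off: "h x (e i) = 0 \<or> a i = 1" if x: "x \<in> T" and i: "i < dim P" "i \<notin> above" for x i
  proof -
    obtain c y where y: "y \<in> span (e ` above)" "x = y + sc c x0" using decomp x by blast
    have "h y (e i) = 0"
      by (subst span_orthonormal[OF orthonormal_e above y(1)],
          subst h_sum_orthonormal[OF orthonormal_e above i(1)]) (use i in auto)
    then show ?thesis using off0[OF i(1)] y(2) by (auto simp: h_add_left h_scale_left)
  qed
  have "card {i. i < dim P \<and> turn (b i) \<le> s} + dim T \<le> dim P + 1"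
  proof (rule count_plus_dim_le)
    show "subspace T" by (simp add: T_def)
    show "T \<subseteq> P" by (rule sub)
    fix x assume x: "x \<in> T"
    then have xP: "x \<in> P" using sub by auto
    show "halfplane_form s A x \<le> 0" by (rule halfplane_form_above[OF xP]) (use off[OF x] in auto)
    assume zero: "halfplane_form s A x = 0" and xv: "h x v = 0"
    obtain c y where y: "y \<in> span (e ` above)" "x = y + sc c x0" using decomp x by blast
    have "h y (e i) = 0" if "i \<in> above" for i
    proof -
      have "h x (e i) = 0"
        by (rule halfplane_form_above(2)[OF xP _ zero that]) (use off[OF x] in auto)
      moreover have "h x0 (e i) = 0" using off0 a1[OF that] above that by auto
      ultimately show ?thesis by (simp add: y(2) h_add_left h_scale_left)
    qed
    \<comment> \<open>What is left of \<open>x\<close> is a multiple of \<open>x0\<close>, and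
      orthogonality to \<open>v\<close> excludes all but the zero multiple.\<close>
    then have "y = 0" by (subst span_orthonormal[OF orthonormal_e above y(1)]) simp
    then show "x = 0" using y(2) xv x0(3) by (auto simp: h_scale_left)
  qed
  moreover have "x0 \<notin> span (e ` above)"
  proof
    assume x: "x0 \<in> span (e ` above)"
    have "x0 = 0"
      by (subst span_orthonormal[OF orthonormal_e above x]) (use off0 a1 above in \<open>auto intro!: sum.neutral\<close>)
    then show False using x0(3) by simp
  qed
  then have "dim T = card above + 1"
    using orthonormal_independent(2)[OF orthonormal_e above] by (simp add: T_def dim_insert)
  ultimately show ?thesis using card_above by linarith
qed

end

lemma defect_le_if_agree_on_hyperplane:
  assumes A: "unitary_on A" and B: "unitary_on B"
    and AB: "\<And>x. x \<in> P \<Longrightarrow> h x v = 0 \<Longrightarrow> A x = B x"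
  shows "defect A \<le> defect B + 1"
    and "x0 \<in> P \<Longrightarrow> A x0 = x0 \<Longrightarrow> h x0 v \<noteq> 0 \<Longrightarrow> defect A \<le> defect B"
proof -
  obtain e a where ea: "eigenbasis A e a" "\<And>i. i < dim P \<Longrightarrow> cmod (a i) = 1"
    using unitary_eigenbasis[OF A] by blast
  obtain f b where fb: "eigenbasis B f b" "\<And>i. i < dim P \<Longrightarrow> cmod (b i) = 1"
    using unitary_eigenbasis[OF B] by blast
  have defect: "defect A = (\<Sum>i<dim P. turn (a i))" "defect B = (\<Sum>i<dim P. turn (b i))"
    using defect_eq eigenbasis_has_spectrum unitary_onD(1) A B ea(1) fb(1) by metis+
  note 1 = count_le_count_plus_1[OF A ea(1) B fb(1) AB _ _ ea(2) fb(2)]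
  note 2 = count_le_count_if_fixed[OF A ea(1) B fb(1) AB _ _ ea(2) fb(2)]
  show "defect A \<le> defect B + 1"
    using sum_le_if_counts_le[where m = "dim P" and d = 1 and x = "\<lambda>i. turn (a i)" and y = "\<lambda>i. turn (b i)"] 1
    unfolding defect by (simp add: turn_nonneg turn_less_1)
  assume "x0 \<in> P" "A x0 = x0" "h x0 v \<noteq> 0"
  then show "defect A \<le> defect B"
    using sum_le_if_counts_le[where m = "dim P" and d = 0 and x = "\<lambda>i. turn (a i)" and y = "\<lambda>i. turn (b i)"] 2
    unfolding defect by (simp add: turn_nonneg turn_less_1)
qed

section \<open>Complex reflections and the factorization of a unitary operator\<close>

definition rotation :: "'a \<Rightarrow> complex \<Rightarrow> 'a \<Rightarrow> 'a"
  where "rotation v c x = x + sc ((c - 1) * h x v) v"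

lemma unitary_on_compose: "unitary_on A \<Longrightarrow> unitary_on B \<Longrightarrow> unitary_on (A \<circ> B)"
  by (auto simp: unitary_on_def operator_on_def)

lemma rotation_eigenbasis:
  assumes "orthonormal (dim P) e" "j < dim P"
  shows "eigenbasis (rotation (e j) c) e (\<lambda>i. if i = j then c else 1)"
  using assms orthonormal_h[OF assms(1)]
  by (auto simp: eigenbasis_def rotation_def scale_left_diff_distrib)

lemma unitary_on_rotation:
  assumes "v \<in> P" "h v v = 1" "cmod c = 1"
  shows "unitary_on (rotation v c)"
proof -
  have "operator_on P (rotation v c)"
    using assms(1) subspace_P unfolding operator_on_def rotation_def
    by (auto simp: h_add_left h_scale_left scale_right_distrib scale_left_distrib distrib_left
        mult_ac add_ac intro!: subspace_add subspace_scale)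
  moreover have "h (rotation v c x) (rotation v c y) = h x y" for x y
  proof -
    have c: "c * cnj c = 1" using assms(3) complex_norm_square[of c] by simp
    have "h (rotation v c x) (rotation v c y) = h x y + cnj ((c - 1) * h y v) * h x v
      + (c - 1) * h x v * h v y + (c - 1) * h x v * cnj ((c - 1) * h y v)"
      unfolding rotation_def h_add_left h_add_right h_scale_left h_scale_right assms(2) by (simp add: algebra_simps)
    also have "\<dots> = h x y + (cnj (c - 1) + (c - 1) + (c - 1) * cnj (c - 1)) * (h x v * h v y)"
      unfolding hermitian[of v y] complex_cnj_mult by (simp add: algebra_simps)
    also have "cnj (c - 1) + (c - 1) + (c - 1) * cnj (c - 1) = 0"
      using c by (simp add: algebra_simps)
    finally show ?thesis by simp
  qed
  ultimately show ?thesis by (simp add: unitary_on_def)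
qed

lemma defect_compose_rotation:
  assumes A: "unitary_on A" and e: "orthonormal (dim P) e" "j < dim P" and c: "cmod c = 1"
  shows "defect (A \<circ> rotation (e j) c) \<le> defect A + turn c"
    and "defect (A \<circ> rotation (e j) c) \<ge> defect A + turn c - (if c = 1 then 0 else 1)"
    and "x0 \<in> P \<Longrightarrow> A x0 = x0 \<Longrightarrow> h x0 (e j) \<noteq> 0 \<Longrightarrow>
      defect (A \<circ> rotation (e j) c) \<ge> defect A + turn c"
proof -
  define R where "R = rotation (e j) c"
  have ej: "e j \<in> P" "h (e j) (e j) = 1"
    using e orthonormal_in orthonormal_h by auto
  have R: "unitary_on R" unfolding R_def by (rule unitary_on_rotation[OF ej c])
  have AR: "unitary_on (A \<circ> R)" by (rule unitary_on_compose[OF A R])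
  have agree: "A x = (A \<circ> R) x" if "h x (e j) = 0" for x
    using that by (simp add: R_def rotation_def)
  note 1 = defect_le_if_agree_on_hyperplane(1)[OF A AR, of "e j"]
    defect_le_if_agree_on_hyperplane(1)[OF AR A, of "e j"]
  have "det_on R = c"
    using det_on_eigenbasis[OF unitary_onD(1)[OF R[unfolded R_def]] rotation_eigenbasis[OF e]] e(2)
    by (simp add: R_def)
  then have "cis (- (2 * pi * defect (A \<circ> R))) = cis (- (2 * pi * defect A)) * cis (- (2 * pi * turn c))"
    using det_on_compose[OF unitary_onD(1)[OF A] unitary_onD(1)[OF R]]
    unfolding det_on_unitary[OF A] det_on_unitary[OF AR] cis_turn[OF c] by simp
  then have "cis (- (2 * pi * defect (A \<circ> R))) = cis (- (2 * pi * (defect A + turn c)))"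
    by (simp add: cis_mult algebra_simps)
  then obtain k :: int where "- (2 * pi * defect (A \<circ> R)) = - (2 * pi * (defect A + turn c)) + 2 * pi * of_int k"
    unfolding cis_eq_iff_int by blast
  then have "2 * pi * defect (A \<circ> R) = 2 * pi * (defect A + turn c - of_int k)"
    by (simp add: algebra_simps)
  then have k: "defect (A \<circ> R) = defect A + turn c - of_int k" by simp
  show "defect (A \<circ> rotation (e j) c) \<le> defect A + turn c"
    and "defect (A \<circ> rotation (e j) c) \<ge> defect A + turn c - (if c = 1 then 0 else 1)"
  proof -
    \<comment> \<open>For \<open>c\<close> different from 1 the number \<open>k\<close> is
      \<open>turn c\<close> plus a difference of defects. The turn lies strictly between 0 and 1 and
      the difference is at most 1 in absolute value, so -1 < k < 2.\<close>
    have "k = 0 \<or> k = 1 \<and> c \<noteq> 1"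
    proof (cases "c = 1")
      case True
      then have "defect (A \<circ> R) = defect A" by (simp add: R_def rotation_def fun_eq_iff o_def)
      then show ?thesis using k True turn_eq_0_iff[of 1] by simp
    next
      case False
      then have "0 < turn c" using turn_eq_0_iff[OF c] turn_nonneg[of c] by linarith
      then have "of_int k < (2::real)" "of_int k > (-1::real)"
        using k 1 agree turn_less_1[of c] by fastforce+
      then show ?thesis using False by linarith
    qed
    then show "defect (A \<circ> rotation (e j) c) \<le> defect A + turn c"
      and "defect (A \<circ> rotation (e j) c) \<ge> defect A + turn c - (if c = 1 then 0 else 1)"
      using k unfolding R_def by auto
  qed
  assume "x0 \<in> P" "A x0 = x0" "h x0 (e j) \<noteq> 0"
  then have "defect A \<le> defect (A \<circ> R)"
    using defect_le_if_agree_on_hyperplane(2)[OF A AR, of "e j" x0] agree by blast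
  \<comment> \<open>Now the difference of defects is at most 0, so \<open>k\<close> is at most
    \<open>turn c\<close>; this excludes \<open>k = 1\<close>.\<close>
  then have "of_int k < (1::real)" using k turn_less_1[of c] by linarith
  then show "defect (A \<circ> rotation (e j) c) \<ge> defect A + turn c" using k unfolding R_def by simp
qed

text \<open>Among the reflections composing \<open>C\<close>, only those with eigenvalue different
  from 1 can lower the balance of defects, each by at most 1, and by nothing if the product so far
  fixes a vector not orthogonal to the new axis. Such fixed vectors are supplied by the kernel of
  \<open>A - 1\<close>. Each use costs at most one dimension of the supply, and what remains at the
  end is fixed by \<open>C\<close> too.\<close>

lemma defect_compose:
  assumes A: "unitary_on A" and C: "unitary_on C"
  shows "defect (A \<circ> C) \<le> defect A + defect C"
    and "defect A + defect C + real (dim (eigenspace A 1)) + real (dim (eigenspace C 1))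
      \<le> defect (A \<circ> C) + real (dim P) + real (dim (eigenspace A 1 \<inter> eigenspace C 1))"
proof -
  obtain e z where ez: "eigenbasis C e z" and z: "\<And>i. i < dim P \<Longrightarrow> cmod (z i) = 1"
    using unitary_eigenbasis[OF C] by blast
  have e: "orthonormal (dim P) e" using ez by (simp add: eigenbasis_def)
  note spec = eigenbasis_has_spectrum[OF unitary_onD(1)[OF C] ez]
  define B where "B k = rec_nat A (\<lambda>j D. D \<circ> rotation (e j) (z j)) k" for k
  have B_simps: "B 0 = A" "B (Suc k) = B k \<circ> rotation (e k) (z k)" for k
    by (simp_all add: B_def)
  \<comment> \<open>The axes are orthogonal, so a reflection in a later axis does not change the
    coefficients along the earlier ones.\<close>
  have B_apply: "B k x = A (x + (\<Sum>i<k. sc ((z i - 1) * h x (e i)) (e i)))" if "k \<le> dim P" for k x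
    using that
  proof (induction k arbitrary: x)
    case (Suc k)
    have "h (rotation (e k) (z k) x) (e i) = h x (e i)" if "i < k" for i
      using that Suc.prems orthonormal_h[OF e] by (simp add: rotation_def h_add_left h_scale_left)
    then have "(\<Sum>i<k. sc ((z i - 1) * h (rotation (e k) (z k) x) (e i)) (e i))
      = (\<Sum>i<k. sc ((z i - 1) * h x (e i)) (e i))" by (intro sum.cong) auto
    then show ?case using Suc by (simp add: B_simps rotation_def add_ac)
  qed (simp add: B_simps)
  have B_unitary: "unitary_on (B k)" if "k \<le> dim P" for k
    using that
  proof (induction k)
    case (Suc k)
    then show ?case
      using orthonormal_in[OF e] orthonormal_h[OF e] z
      unfolding B_simps by (intro unitary_on_compose unitary_on_rotation) auto
  qed (simp add: B_simps A)
  \<comment> \<open>The supply of fixed vectors: those fixed by \<open>A\<close> and untouched by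
    the first \<open>k\<close> reflections, hence fixed by \<open>B k\<close>. Its dimension serves
    as a potential in \<open>main\<close>.\<close>
  define E where "E k = {x \<in> eigenspace A 1. \<forall>i<k. z i \<noteq> 1 \<longrightarrow> h x (e i) = 0}" for k
  have subE: "subspace (E k)" for k
    using subspace_eigenspace[OF unitary_onD(1)[OF A], of 1]
    by (auto simp: E_def subspace_def h_add_left h_scale_left)
  have E_fixed: "B k x = x" "x \<in> P" if "x \<in> E k" "k \<le> dim P" for k x
  proof -
    have "(\<Sum>i<k. sc ((z i - 1) * h x (e i)) (e i)) = 0"
      using that by (intro sum.neutral) (auto simp: E_def)
    then show "B k x = x" "x \<in> P" using that B_apply[OF that(2)] by (auto simp: E_def eigenspace_def)
  qed
  have E_Suc: "E (Suc k) = (if z k = 1 then E k else E k \<inter> {x. h x (e k) = 0})" for k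
    by (auto simp: E_def less_Suc_eq)
  have main: "defect (B k) \<le> defect A + (\<Sum>i<k. turn (z i)) \<and>
      defect A + (\<Sum>i<k. turn (z i)) + real (dim (E 0))
        \<le> defect (B k) + real (card {i. i < k \<and> z i \<noteq> 1}) + real (dim (E k))" if "k \<le> dim P" for k
    using that
  proof (induction k)
    case 0
    then show ?case by (simp add: B_simps)
  next
    case (Suc k)
    then have k: "k < dim P" and IH: "defect (B k) \<le> defect A + (\<Sum>i<k. turn (z i))"
      "defect A + (\<Sum>i<k. turn (z i)) + real (dim (E 0))
        \<le> defect (B k) + real (card {i. i < k \<and> z i \<noteq> 1}) + real (dim (E k))" by auto
    note R = defect_compose_rotation[OF B_unitary[OF less_imp_le[OF k]] e k z[OF k]]
    have card: "card {i. i < Suc k \<and> z i \<noteq> 1} = card {i. i < k \<and> z i \<noteq> 1} + (if z k = 1 then 0 else 1)"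
    proof -
      have "{i. i < Suc k \<and> z i \<noteq> 1} = (if z k = 1 then {} else {k}) \<union> {i. i < k \<and> z i \<noteq> 1}"
        by (auto simp: less_Suc_eq)
      then show ?thesis by simp
    qed
    have "defect (B k) + turn (z k) + real (dim (E k))
        \<le> defect (B (Suc k)) + (if z k = 1 then 0 else 1) + real (dim (E (Suc k)))"
    \<comment> \<open>Either the reflection is trivial, or the supply does not shrink and the cost 1
      is paid, or the supply contains a vector not orthogonal to the axis: then the step is free and
      the supply loses at most one dimension.\<close>
    proof (cases "z k = 1 \<or> E (Suc k) = E k")
      case True
      then show ?thesis using R(2) by (auto simp: E_Suc B_simps)
    next
      case False
      then obtain x0 where x0: "x0 \<in> E k" "h x0 (e k) \<noteq> 0" by (auto simp: E_Suc split: if_splits)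
      have "defect (B k) + turn (z k) \<le> defect (B (Suc k))"
        unfolding B_simps using E_fixed[OF x0(1) less_imp_le[OF k]] x0(2) by (intro R(3))
      moreover have "dim (E k) \<le> dim (E (Suc k)) + 1"
        using False dim_Int_hyperplane[OF subE linear_h_left] by (simp add: E_Suc)
      ultimately show ?thesis using False by simp
    qed
    then show ?case using IH R(1)[folded B_simps(2)] card by auto
  qed
  have "B (dim P) x = (A \<circ> C) x" if "x \<in> P" for x
  proof -
    have "x + (\<Sum>i<dim P. sc ((z i - 1) * h x (e i)) (e i))
      = (\<Sum>i<dim P. sc (h x (e i)) (e i)) + (\<Sum>i<dim P. sc ((z i - 1) * h x (e i)) (e i))"
      using orthonormal_expansion[OF e that] by simp
    also have "\<dots> = C x"
      unfolding eigenbasis_apply[OF unitary_onD(1)[OF C] ez that]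
      unfolding sum.distrib[symmetric]
      by (intro sum.cong) (auto simp: left_diff_distrib scale_left_diff_distrib mult.commute)
    finally show ?thesis using B_apply[of "dim P" x] by simp
  qed
  then have AC: "defect (B (dim P)) = defect (A \<circ> C)" by (rule defect_cong)
  \<comment> \<open>A vector with no component along the eigenvectors of \<open>C\<close> for
    eigenvalues other than 1 is fixed by \<open>C\<close>.\<close>
  have "E (dim P) \<subseteq> eigenspace A 1 \<inter> eigenspace C 1"
  proof
    fix x assume x: "x \<in> E (dim P)"
    then have xP: "x \<in> P" by (simp add: E_def eigenspace_def)
    have "C x = (\<Sum>i<dim P. sc (h x (e i)) (e i))"
      unfolding eigenbasis_apply[OF unitary_onD(1)[OF C] ez xP]
      by (rule sum.cong) (use x in \<open>auto simp: E_def\<close>)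
    also have "\<dots> = x" by (rule orthonormal_expansion[OF e xP, symmetric])
    finally show "x \<in> eigenspace A 1 \<inter> eigenspace C 1" using x xP by (simp add: E_def eigenspace_def)
  qed
  then have "dim (E (dim P)) \<le> dim (eigenspace A 1 \<inter> eigenspace C 1)" by (rule dim_subset)
  moreover have "E 0 = eigenspace A 1" by (simp add: E_def)
  moreover have "real (dim (eigenspace C 1)) + real (card {i. i < dim P \<and> z i \<noteq> 1}) = real (dim P)"
    using dim_eigenspace_1[OF spec] by linarith
  ultimately show "defect (A \<circ> C) \<le> defect A + defect C"
    "defect A + defect C + real (dim (eigenspace A 1)) + real (dim (eigenspace C 1))
      \<le> defect (A \<circ> C) + real (dim P) + real (dim (eigenspace A 1 \<inter> eigenspace C 1))"
    using main[of "dim P"] AC defect_eq[OF spec] by simp_all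
qed

end

section \<open>Continuous eigenangles\<close>

lemma bounded_family_convergent_subsequence:
  fixes F :: "nat \<Rightarrow> nat \<Rightarrow> 'b::heine_borel"
  assumes "\<And>j. j < m \<Longrightarrow> bounded (range (F j))"
  shows "\<exists>r l. strict_mono (r :: nat \<Rightarrow> nat) \<and> (\<forall>j<m. (F j \<circ> r) \<longlonglongrightarrow> l j)"
  using assms
proof (induction m)
  case 0
  then show ?case using strict_mono_id by blast
next
  case (Suc m)
  from Suc.IH[OF Suc.prems] obtain r :: "nat \<Rightarrow> nat" and l
    where r: "strict_mono r" "\<forall>j<m. (F j \<circ> r) \<longlonglongrightarrow> l j" by fastforce
  have "bounded (range (F m \<circ> r))"
    by (rule bounded_subset[OF Suc.prems[of m]]) auto
  then obtain l' r' where r': "strict_mono r'" "(F m \<circ> r \<circ> r') \<longlonglongrightarrow> l'"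
    using bounded_imp_convergent_subsequence by blast
  have "(F j \<circ> (r \<circ> r')) \<longlonglongrightarrow> (l(m := l')) j" if "j < Suc m" for j
    using that r r' LIMSEQ_subseq_LIMSEQ[of "F j \<circ> r" "l j" r'] by (auto simp: less_Suc_eq o_assoc)
  then show ?case using strict_mono_o[OF r(1) r'(1)] by blast
qed

text \<open>A bounded closed graph gives continuity, by passing to a subsequence of values that stay
  away from the supposed limit. The family is treated jointly because in the applications only the
  limit of all members together can be identified.\<close>

lemma continuous_on_if_closed_graph:
  fixes F :: "nat \<Rightarrow> 'p::metric_space \<Rightarrow> 'b::heine_borel"
  assumes bdd: "\<And>j. j < m \<Longrightarrow> bounded (F j ` K)"
    and closed: "\<And>s x l. (\<And>k. s k \<in> K) \<Longrightarrow> s \<longlonglongrightarrow> x \<Longrightarrow> x \<in> K \<Longrightarrow>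
      (\<And>j. j < m \<Longrightarrow> (\<lambda>k. F j (s k)) \<longlonglongrightarrow> l j) \<Longrightarrow> (\<And>j. j < m \<Longrightarrow> l j = F j x)"
    and i: "i < m"
  shows "continuous_on K (F i)"
proof (rule continuous_on_sequentiallyI)
  fix s x assume s: "\<forall>k. s k \<in> K" and x: "x \<in> K" and lim: "s \<longlonglongrightarrow> x"
  show "(\<lambda>k. F i (s k)) \<longlonglongrightarrow> F i x"
  proof (rule ccontr)
    assume "\<not> (\<lambda>k. F i (s k)) \<longlonglongrightarrow> F i x"
    then obtain \<epsilon> where \<epsilon>: "\<epsilon> > 0" "\<not> (\<forall>\<^sub>F k in sequentially. dist (F i (s k)) (F i x) < \<epsilon>)"
      unfolding tendsto_iff by blast
    then have "infinite {k. \<not> dist (F i (s k)) (F i x) < \<epsilon>}"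
      by (simp add: cofinite_eq_sequentially[symmetric] eventually_cofinite)
    then obtain r :: "nat \<Rightarrow> nat" where r: "strict_mono r" "\<And>k. \<not> dist (F i (s (r k))) (F i x) < \<epsilon>"
      using infinite_enumerate by blast
    have "bounded (range (\<lambda>k. F j (s (r k))))" if "j < m" for j
      by (rule bounded_subset[OF bdd[OF that]]) (use s in auto)
    then obtain r' l where r': "strict_mono r'" "\<And>j. j < m \<Longrightarrow> ((\<lambda>k. F j (s (r k))) \<circ> r') \<longlonglongrightarrow> l j"
      using bounded_family_convergent_subsequence[of m "\<lambda>j k. F j (s (r k))"] by blast
    have "(\<lambda>k. s (r (r' k))) \<longlonglongrightarrow> x"
      using LIMSEQ_subseq_LIMSEQ[OF lim strict_mono_o[OF r(1) r'(1)]] by (simp add: o_def)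
    then have "l i = F i x"
      by (rule closed[rotated, OF _ x _ i]) (use s r'(2) in \<open>auto simp: o_def\<close>)
    then have "(\<lambda>k. F i (s (r (r' k)))) \<longlonglongrightarrow> F i x" using r'(2)[OF i] by (simp add: o_def)
    then have "\<forall>\<^sub>F k in sequentially. dist (F i (s (r (r' k)))) (F i x) < \<epsilon>"
      using \<epsilon>(1) by (rule tendstoD)
    then show False using r(2) by (auto dest: eventually_happens)
  qed
qed

text \<open>Convex domains cover both intervals and the rectangle of parameters; on the rectangle a
  single argument serves all four edges.\<close>

lemma continuous_argument:
  fixes f :: "'p::real_normed_vector \<Rightarrow> complex"
  assumes "continuous_on K f" "convex K" "\<And>x. x \<in> K \<Longrightarrow> cmod (f x) = 1"
  obtains \<delta> where "continuous_on K \<delta>" "\<And>x. x \<in> K \<Longrightarrow> f x = cis (\<delta> x)"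
proof -
  have "\<And>x. x \<in> K \<Longrightarrow> f x \<noteq> 0" using assms(3) by force
  then obtain g where g: "continuous_on K g" "\<And>x. x \<in> K \<Longrightarrow> f x = exp (g x)"
    using continuous_logarithm_on_contractible[OF assms(1) convex_imp_contractible[OF assms(2)]] by metis
  have "f x = cis (Im (g x))" if "x \<in> K" for x
    using assms(3)[OF that] g(2)[OF that] by (simp add: exp_eq_polar[of "g x"] norm_mult)
  moreover have "continuous_on K (\<lambda>x. Im (g x))" by (intro continuous_intros g)
  ultimately show ?thesis using that by blast
qed

section \<open>Points of the circle and windows of their arguments\<close>

lemma mset_eq_if_prod_linear_eq:
  fixes M M' :: "complex multiset"
  assumes "\<And>c. (\<Prod>x\<in>#M. c - x) = (\<Prod>x\<in>#M'. c - x)"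
  shows "M = M'"
proof -
  define p where "p M = (\<Prod>x\<in>#M. [:- x, 1:])" for M :: "complex multiset"
  have p0: "p M \<noteq> 0" for M by (auto simp: p_def prod_mset_zero_iff)
  have "proots (p M) = M" for M
  proof (induction M)
    case (add x M)
    have *: "p (add_mset x M) = [:- x, 1:] * p M" by (simp add: p_def)
    show ?case using add p0[of M] by (subst *, subst proots_mult) auto
  qed (simp add: p_def)
  moreover have "p M = p M'"
  proof (rule poly_eq_poly_eq_iff[THEN iffD1], rule ext)
    fix c
    have "poly (p M) c = (\<Prod>x\<in>#M. c - x)" for M
      by (simp add: p_def poly_prod_mset multiset.map_comp o_def)
    then show "poly (p M) c = poly (p M') c" using assms by simp
  qed
  ultimately show ?thesis by metis
qed

text \<open>
  A window consists of \<open>m\<close> consecutive members of the sorted, \<open>2\<pi>\<close>-periodic family of all arguments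
  of \<open>m\<close> points of the circle. The windows of given points are told apart by their sums.
\<close>

definition window :: "nat \<Rightarrow> (nat \<Rightarrow> real) \<Rightarrow> bool"
  where "window m \<theta> \<longleftrightarrow> (\<forall>i j. i \<le> j \<longrightarrow> j < m \<longrightarrow> \<theta> i \<le> \<theta> j) \<and>
    (\<forall>i<m. \<forall>j<m. \<theta> j \<le> \<theta> i + 2 * pi)"

abbreviation family_mset :: "nat \<Rightarrow> (nat \<Rightarrow> 'b) \<Rightarrow> 'b multiset"
  where "family_mset m w \<equiv> image_mset w (mset_set {..<m})"

text \<open>If \<theta> j \<le> x, the first \<open>j + 1\<close> summands are at least 0 and the
  others at least -1, because a window spans at most one period. Otherwise the summands from
  \<open>j\<close> on are at most -1 and the earlier ones at most 0. The threshold separates the two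
  cases.\<close>

lemma window_le_iff:
  assumes w: "window m \<theta>" and j: "j < m"
  shows "\<theta> j \<le> x \<longleftrightarrow> int j + 1 - int m \<le> (\<Sum>i<m. \<lfloor>(x - \<theta> i) / (2 * pi)\<rfloor>)"
proof
  have split: "{..<m} = {..<j} \<union> {j..<m}" "{..<m} = {..<Suc j} \<union> {Suc j..<m}" using j by auto
  {
    assume x: "\<theta> j \<le> x"
    have "0 \<le> \<lfloor>(x - \<theta> i) / (2 * pi)\<rfloor>" if "i < Suc j" for i
    proof -
      have "\<theta> i \<le> \<theta> j" using w j that by (auto simp: window_def)
      then show ?thesis using x by simp
    qed
    then have 1: "(\<Sum>i<Suc j. 0) \<le> (\<Sum>i<Suc j. \<lfloor>(x - \<theta> i) / (2 * pi)\<rfloor>)" by (intro sum_mono) auto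
    have "-1 \<le> \<lfloor>(x - \<theta> i) / (2 * pi)\<rfloor>" if "i < m" for i
    proof -
      have "\<theta> i \<le> \<theta> j + 2 * pi" using w j that by (auto simp: window_def)
      then show ?thesis using x by (simp add: le_floor_iff pos_le_divide_eq)
    qed
    then have 2: "(\<Sum>i=Suc j..<m. -1) \<le> (\<Sum>i=Suc j..<m. \<lfloor>(x - \<theta> i) / (2 * pi)\<rfloor>)"
      by (intro sum_mono) auto
    have "(\<Sum>i<m. \<lfloor>(x - \<theta> i) / (2 * pi)\<rfloor>)
      = (\<Sum>i<Suc j. \<lfloor>(x - \<theta> i) / (2 * pi)\<rfloor>) + (\<Sum>i=Suc j..<m. \<lfloor>(x - \<theta> i) / (2 * pi)\<rfloor>)"
      by (subst split(2), rule sum.union_disjoint) auto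
    then show "int j + 1 - int m \<le> (\<Sum>i<m. \<lfloor>(x - \<theta> i) / (2 * pi)\<rfloor>)"
      using 1 2 j by simp
  }
  {
    assume le: "int j + 1 - int m \<le> (\<Sum>i<m. \<lfloor>(x - \<theta> i) / (2 * pi)\<rfloor>)"
    show "\<theta> j \<le> x"
    proof (rule ccontr)
      assume x: "\<not> \<theta> j \<le> x"
      have "\<lfloor>(x - \<theta> i) / (2 * pi)\<rfloor> \<le> -1" if "j \<le> i" "i < m" for i
      proof -
        have "\<theta> j \<le> \<theta> i" using w j that by (auto simp: window_def)
        then have "(x - \<theta> i) / (2 * pi) < 0" using x by (simp add: divide_less_0_iff)
        then show ?thesis by linarith
      qed
      then have 1: "(\<Sum>i=j..<m. \<lfloor>(x - \<theta> i) / (2 * pi)\<rfloor>) \<le> (\<Sum>i=j..<m. -1)" by (intro sum_mono) auto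
      have "\<lfloor>(x - \<theta> i) / (2 * pi)\<rfloor> \<le> 0" if "i < m" for i
      proof -
        have "\<theta> j \<le> \<theta> i + 2 * pi" using w j that by (auto simp: window_def)
        then have "(x - \<theta> i) / (2 * pi) < 1" using x by (simp add: pos_divide_less_eq)
        then show ?thesis by linarith
      qed
      then have 2: "(\<Sum>i<j. \<lfloor>(x - \<theta> i) / (2 * pi)\<rfloor>) \<le> (\<Sum>i<j. 0)" using j by (intro sum_mono) auto
      have "(\<Sum>i<m. \<lfloor>(x - \<theta> i) / (2 * pi)\<rfloor>)
        = (\<Sum>i<j. \<lfloor>(x - \<theta> i) / (2 * pi)\<rfloor>) + (\<Sum>i=j..<m. \<lfloor>(x - \<theta> i) / (2 * pi)\<rfloor>)"
        by (subst split(1), rule sum.union_disjoint) auto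
      then show False using le 1 2 j by simp
    qed
  }
qed

text \<open>A floor is a number minus its fractional part, and the fractional part of (x - \<theta>
  i) / 2\<pi> is the turn of the rotated point. The floor sum in \<open>window_le_iff\<close> thus
  depends only on the points and on the sum of the window, and it decides all comparisons \<theta> j
  \<le> x.\<close>

lemma window_unique:
  assumes w: "window m \<theta>" "window m \<phi>"
    and cis: "family_mset m (\<lambda>i. cis (\<theta> i)) = family_mset m (\<lambda>i. cis (\<phi> i))"
    and sum: "(\<Sum>i<m. \<theta> i) = (\<Sum>i<m. \<phi> i)" and j: "j < m"
  shows "\<theta> j = \<phi> j"
proof -
  have floor: "real_of_int (\<Sum>i<m. \<lfloor>(x - \<theta> i) / (2 * pi)\<rfloor>)
    = (real m * x - (\<Sum>i<m. \<theta> i)) / (2 * pi) - (\<Sum>z\<in>#family_mset m (\<lambda>i. cis (\<theta> i)). turn (z * cis (- x)))"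
    for \<theta> x
  proof -
    have "real_of_int \<lfloor>(x - \<theta> i) / (2 * pi)\<rfloor> = (x - \<theta> i) / (2 * pi) - turn (cis (\<theta> i) * cis (- x))" for i
      by (simp add: cis_mult turn_cis frac_def)
    then show ?thesis
      by (simp add: sum_subtractf sum_divide_distrib[symmetric] multiset.map_comp o_def
          sum_unfold_sum_mset[symmetric])
  qed
  have "real_of_int (\<Sum>i<m. \<lfloor>(x - \<theta> i) / (2 * pi)\<rfloor>) = real_of_int (\<Sum>i<m. \<lfloor>(x - \<phi> i) / (2 * pi)\<rfloor>)" for x
    unfolding floor cis sum ..
  then have "\<theta> j \<le> x \<longleftrightarrow> \<phi> j \<le> x" for x
    unfolding window_le_iff[OF w(1) j] window_le_iff[OF w(2) j] by (simp only: of_int_eq_iff)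
  then show ?thesis by (meson order_antisym order_refl)
qed

text \<open>Moving the window by one place replaces its smallest member by that member plus 2\<pi>,
  or its largest by that member minus 2\<pi>.\<close>

lemma window_shift:
  assumes w: "window m \<theta>" and m: "m > 0"
  shows "\<exists>\<phi>. window m \<phi> \<and> family_mset m (\<lambda>i. cis (\<phi> i)) = family_mset m (\<lambda>i. cis (\<theta> i)) \<and>
    (\<Sum>i<m. \<phi> i) = (\<Sum>i<m. \<theta> i) + 2 * pi"
    and "\<exists>\<phi>. window m \<phi> \<and> family_mset m (\<lambda>i. cis (\<phi> i)) = family_mset m (\<lambda>i. cis (\<theta> i)) \<and>
    (\<Sum>i<m. \<phi> i) = (\<Sum>i<m. \<theta> i) - 2 * pi"
proof -
  obtain k where k: "m = Suc k" using m by (cases m) auto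
  have le: "\<theta> i \<le> \<theta> j" if "i \<le> j" "j < m" for i j using w that by (auto simp: window_def)
  have le2: "\<theta> j \<le> \<theta> i + 2 * pi" if "i < m" "j < m" for i j using w that by (auto simp: window_def)
  have cis2: "cis (x + 2 * pi) = cis x" "cis (x - 2 * pi) = cis x" for x
    by (auto simp: complex_eq_iff sin_diff cos_diff)
  have fm: "family_mset (Suc k) f = add_mset (f 0) (family_mset k (\<lambda>i. f (Suc i)))"
    "family_mset (Suc k) f = add_mset (f k) (family_mset k f)" for f :: "nat \<Rightarrow> complex"
  proof -
    show "family_mset (Suc k) f = add_mset (f k) (family_mset k f)" by (simp add: lessThan_Suc)
    have "mset_set {..<Suc k} = add_mset 0 (image_mset Suc (mset_set {..<k}))"
      by (simp add: lessThan_Suc_eq_insert_0 image_mset_mset_set)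
    then show "family_mset (Suc k) f = add_mset (f 0) (family_mset k (\<lambda>i. f (Suc i)))"
      by (simp add: multiset.map_comp o_def)
  qed
  define \<phi> where "\<phi> i = (if i = k then \<theta> 0 + 2 * pi else \<theta> (Suc i))" for i
  have "window m \<phi>"
    unfolding window_def
  proof (intro conjI allI impI)
    fix i j assume "i \<le> j" "j < m"
    then show "\<phi> i \<le> \<phi> j"
      using le[of "Suc i" "Suc j"] le2[of 0 "Suc i"] k by (cases "j = k"; cases "i = k") (auto simp: \<phi>_def)
  next
    fix i j assume "i < m" "j < m"
    then show "\<phi> j \<le> \<phi> i + 2 * pi"
      using le[of 0 "Suc i"] le2[of 0 "Suc j"] le2[of "Suc i" "Suc j"] k pi_gt_zero
      unfolding \<phi>_def by (cases "j = k"; cases "i = k"; simp; linarith?)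
  qed
  moreover have "family_mset m (\<lambda>i. cis (\<phi> i)) = family_mset m (\<lambda>i. cis (\<theta> i))"
    unfolding k fm(2)[of "\<lambda>i. cis (\<phi> i)"] fm(1)[of "\<lambda>i. cis (\<theta> i)"]
    by (auto simp: \<phi>_def cis2 intro!: image_mset_cong)
  moreover have "(\<Sum>i<m. \<phi> i) = (\<Sum>i<m. \<theta> i) + 2 * pi"
    unfolding k sum.lessThan_Suc[of \<phi>] sum.lessThan_Suc_shift[of \<theta>] by (simp add: \<phi>_def)
  ultimately show "\<exists>\<phi>. window m \<phi> \<and> family_mset m (\<lambda>i. cis (\<phi> i)) = family_mset m (\<lambda>i. cis (\<theta> i)) \<and>
    (\<Sum>i<m. \<phi> i) = (\<Sum>i<m. \<theta> i) + 2 * pi" by blast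
  define \<psi> where "\<psi> i = (if i = 0 then \<theta> k - 2 * pi else \<theta> (i - 1))" for i
  have "window m \<psi>"
    unfolding window_def
  proof (intro conjI allI impI)
    fix i j assume "i \<le> j" "j < m"
    then show "\<psi> i \<le> \<psi> j"
      using le[of "i - 1" "j - 1"] le2[of "j - 1" k] k by (cases j; cases i) (auto simp: \<psi>_def)
  next
    fix i j assume "i < m" "j < m"
    then show "\<psi> j \<le> \<psi> i + 2 * pi"
      using le[of "j - 1" k] le2[of "i - 1" k] le2[of "i - 1" "j - 1"] k pi_gt_zero
      by (cases j; cases i; simp add: \<psi>_def; linarith?)
  qed
  moreover have "family_mset m (\<lambda>i. cis (\<psi> i)) = family_mset m (\<lambda>i. cis (\<theta> i))"
    unfolding k fm(1)[of "\<lambda>i. cis (\<psi> i)"] fm(2)[of "\<lambda>i. cis (\<theta> i)"] by (simp add: \<psi>_def cis2)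
  moreover have "(\<Sum>i<m. \<psi> i) = (\<Sum>i<m. \<theta> i) - 2 * pi"
    unfolding k sum.lessThan_Suc_shift[of \<psi>] sum.lessThan_Suc[of \<theta>] by (simp add: \<psi>_def)
  ultimately show "\<exists>\<phi>. window m \<phi> \<and> family_mset m (\<lambda>i. cis (\<phi> i)) = family_mset m (\<lambda>i. cis (\<theta> i)) \<and>
    (\<Sum>i<m. \<phi> i) = (\<Sum>i<m. \<theta> i) - 2 * pi" by blast
qed

lemma cis_sum: "cis (\<Sum>i\<in>I. f i) = (\<Prod>i\<in>I. cis (f i))"
  by (induction I rule: infinite_finite_induct) (auto simp: cis_mult[symmetric])

text \<open>The sorted arguments in the half-open interval from -2\<pi> to 0 form a window. Its sum
  and \<delta> are arguments of the same product, hence differ by a multiple of 2\<pi>, which is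
  made up by shifts.\<close>

lemma window_exists:
  assumes m: "m > 0" and w: "\<And>i. i < m \<Longrightarrow> cmod (w i) = 1" and \<delta>: "cis \<delta> = (\<Prod>i<m. w i)"
  shows "\<exists>\<theta>. window m \<theta> \<and> family_mset m (\<lambda>i. cis (\<theta> i)) = family_mset m w \<and> (\<Sum>i<m. \<theta> i) = \<delta>"
proof -
  define xs where "xs = sort (map (\<lambda>i. - (2 * pi * turn (w i))) [0..<m])"
  have len: "length xs = m" by (simp add: xs_def)
  have range: "- (2 * pi) < x \<and> x \<le> 0" if "x \<in> set xs" for x
    using that turn_nonneg turn_less_1 by (auto simp: xs_def mult_less_cancel_left1)
  have "window m (\<lambda>i. xs ! i)"
    unfolding window_def
  proof (intro conjI allI impI)
    fix i j assume "i \<le> j" "j < m"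
    then show "xs ! i \<le> xs ! j" using len by (auto simp: xs_def intro: sorted_nth_mono)
  next
    fix i j assume "i < m" "j < m"
    then show "xs ! j \<le> xs ! i + 2 * pi"
      using range[of "xs ! i"] range[of "xs ! j"] len by simp
  qed
  moreover have fm: "family_mset m (\<lambda>i. cis (xs ! i)) = family_mset m w"
  proof -
    have "family_mset m (\<lambda>i. cis (xs ! i)) = image_mset cis (mset xs)"
      unfolding len[symmetric] by (metis map_nth mset_map mset_upt multiset.map_comp o_def
          atLeast0LessThan mset_set_upto_eq_mset_upto image_mset_cong)
    also have "\<dots> = image_mset (\<lambda>i. cis (- (2 * pi * turn (w i)))) (mset_set {..<m})"
      by (simp add: xs_def multiset.map_comp o_def atLeast0LessThan)
    also have "\<dots> = family_mset m w" using w by (intro image_mset_cong) (auto intro: cis_turn)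
    finally show ?thesis .
  qed
  moreover have "cis (\<Sum>i<m. xs ! i) = cis \<delta>"
    unfolding \<delta> cis_sum using arg_cong[OF fm, of prod_mset] by (simp add: prod_unfold_prod_mset)
  then obtain k :: int where "\<delta> = (\<Sum>i<m. xs ! i) + 2 * pi * of_int k"
    using cis_eq_iff_int[of \<delta> "\<Sum>i<m. xs ! i"] by metis
  moreover have "\<exists>\<phi>. window m \<phi> \<and> family_mset m (\<lambda>i. cis (\<phi> i)) = family_mset m w \<and>
      (\<Sum>i<m. \<phi> i) = (\<Sum>i<m. \<theta> i) + 2 * pi * of_int k"
    if "window m \<theta>" "family_mset m (\<lambda>i. cis (\<theta> i)) = family_mset m w" for \<theta> and k :: int
  proof (induction k rule: int_induct[where k = 0])
    case base
    then show ?case using that by auto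
  next
    case (step1 k)
    then obtain \<phi> where \<phi>: "window m \<phi>" "family_mset m (\<lambda>i. cis (\<phi> i)) = family_mset m w"
      "(\<Sum>i<m. \<phi> i) = (\<Sum>i<m. \<theta> i) + 2 * pi * of_int k" by blast
    then show ?case using window_shift(1)[OF \<phi>(1) m] by (auto simp: algebra_simps)
  next
    case (step2 k)
    then obtain \<phi> where \<phi>: "window m \<phi>" "family_mset m (\<lambda>i. cis (\<phi> i)) = family_mset m w"
      "(\<Sum>i<m. \<phi> i) = (\<Sum>i<m. \<theta> i) + 2 * pi * of_int k" by blast
    then show ?case using window_shift(2)[OF \<phi>(1) m] by (auto simp: algebra_simps)
  qed
  ultimately show ?thesis by metis
qed

text \<open>Every member of a window is within 2\<pi> of the mean, so a bound on the sums bounds the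
  windows; the closed graph argument needs this.\<close>

lemma window_bound:
  assumes w: "window m \<theta>" and j: "j < m"
  shows "\<bar>\<theta> j\<bar> \<le> \<bar>\<Sum>i<m. \<theta> i\<bar> + 2 * pi"
proof -
  have "\<bar>\<theta> j - \<theta> i\<bar> \<le> 2 * pi" if "i < m" for i
    using w j that by (auto simp: window_def abs_le_iff algebra_simps)
  then have "\<bar>\<Sum>i<m. \<theta> j - \<theta> i\<bar> \<le> (\<Sum>i<m. 2 * pi)"
    by (intro order_trans[OF sum_abs] sum_mono) auto
  then have "\<bar>real m * \<theta> j\<bar> \<le> \<bar>\<Sum>i<m. \<theta> i\<bar> + real m * (2 * pi)"
    by (simp add: sum_subtractf)
  also have "\<bar>\<Sum>i<m. \<theta> i\<bar> \<le> real m * \<bar>\<Sum>i<m. \<theta> i\<bar>"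
    using j by (intro mult_right_mono[of 1 "real m", simplified]) auto
  finally have "real m * \<bar>\<theta> j\<bar> \<le> real m * (\<bar>\<Sum>i<m. \<theta> i\<bar> + 2 * pi)"
    by (simp add: abs_mult algebra_simps)
  then show ?thesis using j by (simp add: mult_le_cancel_left_pos)
qed

section \<open>Eigenangles of a path of unitary operators\<close>

context definite_subspace
begin

definition operator_path :: "'p::metric_space set \<Rightarrow> ('p \<Rightarrow> 'a \<Rightarrow> 'a) \<Rightarrow> bool"
  where "operator_path K T \<longleftrightarrow> (\<forall>p\<in>K. unitary_on (T p)) \<and>
    (\<forall>x\<in>P. \<forall>y\<in>P. continuous_on K (\<lambda>p. h (T p x) y))"

lemma has_spectrum_if_family_mset:
  assumes "has_spectrum T w" "family_mset (dim P) w' = family_mset (dim P) w"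
  shows "has_spectrum T w'"
proof -
  have *: "count (image_mset w (mset_set {..<dim P})) c = card {i. i < dim P \<and> w i = c}"
    for w :: "nat \<Rightarrow> complex" and c
    by (auto simp: count_image_mset_eq_card_vimage conj_commute vimage_def intro!: arg_cong[of _ _ card])
  show ?thesis using assms unfolding has_spectrum_def *[symmetric] by metis
qed

lemma has_spectrum_unimodular:
  assumes T: "unitary_on T" and w: "has_spectrum T w" and i: "i < dim P"
  shows "cmod (w i) = 1"
proof -
  have "i \<in> {j. j < dim P \<and> w j = w i}" using i by simp
  then have "card {j. j < dim P \<and> w j = w i} \<noteq> 0" by (metis (no_types, lifting) card_eq_0_iff
        empty_iff finite_nat_set_iff_bounded mem_Collect_eq)
  then have "dim (eigenspace T (w i)) \<noteq> 0" using w by (simp add: has_spectrum_def)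
  then have "\<not> eigenspace T (w i) \<subseteq> {0}" by (simp add: dim_eq_0)
  then show ?thesis using unitary_eigenvalue[OF T] by (auto simp: eigenspace_def)
qed

lemma det_on_has_spectrum:
  assumes T: "unitary_on T" and w: "has_spectrum T w"
  shows "det_on T = (\<Prod>i<dim P. w i)"
proof -
  obtain e z where ez: "eigenbasis T e z" using unitary_eigenbasis[OF T] by blast
  have "det_on T = (\<Prod>i<dim P. z i)" by (rule det_on_eigenbasis[OF unitary_onD(1)[OF T] ez])
  also have "\<dots> = (\<Prod>i<dim P. w i)"
    using arg_cong[OF has_spectrum_unique[OF eigenbasis_has_spectrum[OF unitary_onD(1)[OF T] ez] w],
        of prod_mset]
    by (simp add: prod_unfold_prod_mset)
  finally show ?thesis .
qed

text \<open>Prescribing the sum as \<delta> leaves exactly one window of arguments at each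
  parameter. Order, spread, sum and characteristic polynomial all pass to the limit, so a limit of
  windows is the window at the limit, which is continuity. Collisions of eigenvalues need no
  separate treatment.\<close>

lemma continuous_eigenangles_exist:
  assumes T: "operator_path K T" and K: "compact K"
    and \<delta>: "continuous_on K \<delta>" "\<And>p. p \<in> K \<Longrightarrow> det_on (T p) = cis (\<delta> p)"
  shows "\<exists>\<theta>. (\<forall>j<dim P. continuous_on K (\<theta> j)) \<and> (\<forall>p\<in>K. has_spectrum (T p) (\<lambda>j. cis (\<theta> j p)))"
proof (cases "dim P = 0")
  case True
  \<comment> \<open>Without eigenvalues the only window has sum 0, whereas \<delta> may be another
    multiple of 2\<pi>.\<close>
  have "has_spectrum (T p) (\<lambda>j. cis 0)" if p: "p \<in> K" for p
  proof -
    obtain w where "has_spectrum (T p) w"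
      using unitary_has_spectrum[of "T p"] T p unfolding operator_path_def by blast
    then show ?thesis unfolding has_spectrum_def True by simp
  qed
  then show ?thesis using True by (intro exI[of _ "\<lambda>_ _. 0"]) auto
next
  case False
  have unitary: "unitary_on (T p)" if "p \<in> K" for p using T that by (simp add: operator_path_def)
  have "\<exists>\<theta>. window (dim P) \<theta> \<and> has_spectrum (T p) (\<lambda>i. cis (\<theta> i)) \<and> (\<Sum>i<dim P. \<theta> i) = \<delta> p"
    if p: "p \<in> K" for p
  proof -
    obtain w where w: "has_spectrum (T p) w" using unitary_has_spectrum[OF unitary[OF p]] by blast
    have "cis (\<delta> p) = (\<Prod>i<dim P. w i)"
      using \<delta>(2)[OF p] det_on_has_spectrum[OF unitary[OF p] w] by simp
    then obtain \<theta> where "window (dim P) \<theta>" "family_mset (dim P) (\<lambda>i. cis (\<theta> i)) = family_mset (dim P) w"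
      "(\<Sum>i<dim P. \<theta> i) = \<delta> p"
      using window_exists[of "dim P" w] False has_spectrum_unimodular[OF unitary[OF p] w] by blast
    then show ?thesis using has_spectrum_if_family_mset[OF w] by blast
  qed
  then obtain \<theta> where \<theta>: "\<And>p. p \<in> K \<Longrightarrow> window (dim P) (\<theta> p)"
    "\<And>p. p \<in> K \<Longrightarrow> has_spectrum (T p) (\<lambda>i. cis (\<theta> p i))"
    "\<And>p. p \<in> K \<Longrightarrow> (\<Sum>i<dim P. \<theta> p i) = \<delta> p" by metis
  have "continuous_on K (\<lambda>p. \<theta> p j)" if "j < dim P" for j
  proof (rule continuous_on_if_closed_graph[where F = "\<lambda>j p. \<theta> p j" and m = "dim P", OF _ _ that])
    fix j assume j: "j < dim P"
    have "bounded (\<delta> ` K)" using compact_continuous_image[OF \<delta>(1) K] by (rule compact_imp_bounded)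
    then obtain b where b: "\<And>p. p \<in> K \<Longrightarrow> \<bar>\<delta> p\<bar> \<le> b" by (auto simp: bounded_iff)
    have "\<bar>\<theta> p j\<bar> \<le> b + 2 * pi" if "p \<in> K" for p
      using window_bound[OF \<theta>(1)[OF that] j] \<theta>(3)[OF that] b[OF that] by simp
    then show "bounded ((\<lambda>p. \<theta> p j) ` K)" by (auto simp: bounded_iff)
  next
    fix s x l j
    assume s: "\<And>k. s k \<in> K" and lim: "s \<longlonglongrightarrow> x" and x: "x \<in> K" and j: "j < dim P"
      and l: "\<And>j. j < dim P \<Longrightarrow> (\<lambda>k. \<theta> (s k) j) \<longlonglongrightarrow> l j"
    have seq: "(\<lambda>k. f (s k)) \<longlonglongrightarrow> f x" if "continuous_on K f" for f :: "_ \<Rightarrow> 'c::topological_space"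
      by (rule continuous_on_tendsto_compose[OF that lim x]) (use s in auto)
    show "l j = \<theta> x j"
    proof (rule window_unique[OF _ \<theta>(1)[OF x] _ _ j])
      show "window (dim P) l"
        unfolding window_def
      proof (intro conjI allI impI)
        fix i j assume ij: "i \<le> j" "j < dim P"
        show "l i \<le> l j"
          by (rule LIMSEQ_le[OF l l]) (use ij \<theta>(1)[OF s] in \<open>auto simp: window_def\<close>)
      next
        fix i j assume ij: "i < dim P" "j < dim P"
        show "l j \<le> l i + 2 * pi"
          by (rule LIMSEQ_le[OF l tendsto_add[OF l tendsto_const]])
            (use ij \<theta>(1)[OF s] in \<open>auto simp: window_def\<close>)
      qed
      have "(\<lambda>k. \<Sum>i<dim P. \<theta> (s k) i) \<longlonglongrightarrow> (\<Sum>i<dim P. l i)" by (intro tendsto_sum l) auto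
      then show "(\<Sum>i<dim P. l i) = (\<Sum>i<dim P. \<theta> x i)"
        using seq[OF \<delta>(1)] \<theta>(3) s x by (simp add: LIMSEQ_unique)
      show "family_mset (dim P) (\<lambda>i. cis (l i)) = family_mset (dim P) (\<lambda>i. cis (\<theta> x i))"
      proof (rule mset_eq_if_prod_linear_eq)
        fix c
        have det: "det_on (\<lambda>y. sc c y - T p y) = (\<Prod>i<dim P. c - cis (\<theta> p i))" if "p \<in> K" for p
          by (rule det_on_char_poly[OF unitary[OF that] \<theta>(2)[OF that]])
        have "continuous_on K (\<lambda>p. det_on (\<lambda>y. sc c y - T p y))"
          using T unfolding operator_path_def
          by (intro continuous_on_det_on) (auto simp: h_diff_left intro!: continuous_intros)
        from seq[OF this] have "(\<lambda>k. \<Prod>i<dim P. c - cis (\<theta> (s k) i)) \<longlonglongrightarrow> (\<Prod>i<dim P. c - cis (\<theta> x i))"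
          by (simp add: det s x)
        moreover have "(\<lambda>k. \<Prod>i<dim P. c - cis (\<theta> (s k) i)) \<longlonglongrightarrow> (\<Prod>i<dim P. c - cis (l i))"
          using l by (intro tendsto_prod tendsto_intros tendsto_cis) auto
        ultimately show "(\<Prod>x\<in>#family_mset (dim P) (\<lambda>i. cis (l i)). c - x)
            = (\<Prod>x\<in>#family_mset (dim P) (\<lambda>i. cis (\<theta> x i)). c - x)"
          using LIMSEQ_unique by (simp add: prod_unfold_prod_mset multiset.map_comp o_def) blast
      qed
    qed
  qed
  then show ?thesis using \<theta>(2) by (intro exI[of _ "\<lambda>j p. \<theta> p j"]) auto
qed

text \<open>The sum of the angles and \<delta> are both continuous arguments of the determinant, so
  they differ by a constant. The right side does not mention the angles, so any admissible choice of
  them gives the same value.\<close>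

lemma sum_ceiling_eigenangles:
  fixes a b :: real
  assumes T: "operator_path {a..b} T" and ab: "a \<le> b"
    and \<delta>: "continuous_on {a..b} \<delta>" "\<And>p. p \<in> {a..b} \<Longrightarrow> det_on (T p) = cis (\<delta> p)"
    and \<theta>: "\<And>j. j < dim P \<Longrightarrow> continuous_on {a..b} (\<theta> j)"
      "\<And>p. p \<in> {a..b} \<Longrightarrow> has_spectrum (T p) (\<lambda>j. cis (\<theta> j p))"
  shows "real_of_int (\<Sum>j<dim P. \<lceil>\<theta> j b / (2 * pi)\<rceil> - \<lceil>\<theta> j a / (2 * pi)\<rceil>)
    = (\<delta> b - \<delta> a) / (2 * pi) + defect (T b) - defect (T a)"
proof -
  define D where "D p = ((\<Sum>j<dim P. \<theta> j p) - \<delta> p) / (2 * pi)" for p :: real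
  have cont: "continuous_on {a..b} D" unfolding D_def using \<theta>(1) \<delta>(1) by (intro continuous_intros) auto
  have int: "\<exists>k::int. D p = of_int k" if "p \<in> {a..b}" for p
  proof -
    have "cis (\<Sum>j<dim P. \<theta> j p) = cis (\<delta> p)"
      using \<delta>(2)[OF that] det_on_has_spectrum[OF _ \<theta>(2)[OF that]] T that
      by (simp add: cis_sum operator_path_def)
    then obtain k :: int where "(\<Sum>j<dim P. \<theta> j p) = \<delta> p + 2 * pi * of_int k"
      unfolding cis_eq_iff_int by blast
    then show ?thesis by (auto simp: D_def)
  qed
  have "D a = D b"
  proof (rule connected_local_const[of "{a..b}" a b D])
    show "\<forall>p\<in>{a..b}. \<forall>\<^sub>F q in at p within {a..b}. D p = D q"
    proof
      fix p assume p: "p \<in> {a..b}"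
      have "(D \<longlongrightarrow> D p) (at p within {a..b})" using cont p by (simp add: continuous_on_def)
      then have "\<forall>\<^sub>F q in at p within {a..b}. dist (D q) (D p) < 1" by (rule tendstoD) simp
      moreover have "\<forall>\<^sub>F q in at p within {a..b}. q \<in> {a..b}"
        by (simp add: eventually_at_filter)
      ultimately show "\<forall>\<^sub>F q in at p within {a..b}. D p = D q"
      proof eventually_elim
        case (elim q)
        obtain k l :: int where "D p = of_int k" "D q = of_int l" using int p elim(2) by metis
        then show ?case using elim(1) by (simp add: dist_real_def)
      qed
    qed
  qed (use ab in auto)
  then have "((\<Sum>j<dim P. \<theta> j b) - (\<Sum>j<dim P. \<theta> j a)) / (2 * pi) = (\<delta> b - \<delta> a) / (2 * pi)"
    by (simp add: D_def diff_divide_distrib)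
  moreover have "defect (T p) = (\<Sum>j<dim P. turn (cis (\<theta> j p)))" if "p \<in> {a..b}" for p
    by (rule defect_eq[OF \<theta>(2)[OF that]])
  moreover have "real_of_int (\<Sum>j<dim P. \<lceil>\<theta> j b / (2 * pi)\<rceil> - \<lceil>\<theta> j a / (2 * pi)\<rceil>)
    = ((\<Sum>j<dim P. \<theta> j b) - (\<Sum>j<dim P. \<theta> j a)) / (2 * pi)
      + (\<Sum>j<dim P. turn (cis (\<theta> j b))) - (\<Sum>j<dim P. turn (cis (\<theta> j a)))"
    by (simp add: ceiling_eq_turn sum_subtractf sum.distrib sum_divide_distrib diff_divide_distrib)
  ultimately show ?thesis using ab by simp
qed

text \<open>A ceiling can jump only where an angle meets a multiple of 2\<pi>. Angles off these
  multiples stay off nearby; with a constant number of angles on them, none can leave either. So the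
  sum of ceilings is locally constant.\<close>

lemma defect_if_constant_multiplicity:
  fixes a b :: real
  assumes T: "operator_path {a..b} T" and ab: "a \<le> b"
    and \<delta>: "continuous_on {a..b} \<delta>" "\<And>p. p \<in> {a..b} \<Longrightarrow> det_on (T p) = cis (\<delta> p)"
    and const: "\<And>p. p \<in> {a..b} \<Longrightarrow> dim (eigenspace (T p) 1) = d"
  shows "(\<delta> b - \<delta> a) / (2 * pi) = defect (T a) - defect (T b)"
proof -
  obtain \<theta> where \<theta>: "\<And>j. j < dim P \<Longrightarrow> continuous_on {a..b} (\<theta> j)"
      "\<And>p. p \<in> {a..b} \<Longrightarrow> has_spectrum (T p) (\<lambda>j. cis (\<theta> j p))"
    using continuous_eigenangles_exist[OF T compact_Icc \<delta>] by blast
  have card: "card {j. j < dim P \<and> cis (\<theta> j p) = 1} = d" if "p \<in> {a..b}" for p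
    using \<theta>(2)[OF that] const[OF that] by (simp add: has_spectrum_def)
  define F where "F p = (\<Sum>j<dim P. \<lceil>\<theta> j p / (2 * pi)\<rceil>)" for p
  have cis1: "cis x = 1 \<longleftrightarrow> x / (2 * pi) \<in> \<int>" for x
    using cis_eq_iff_int[of x 0] by (auto simp: Ints_def field_simps)
  have "F a = F b"
  proof (rule connected_local_const[of "{a..b}" a b F])
    show "\<forall>p\<in>{a..b}. \<forall>\<^sub>F q in at p within {a..b}. F p = F q"
    proof
      fix p assume p: "p \<in> {a..b}"
      have lim: "((\<lambda>q. \<theta> j q / (2 * pi)) \<longlongrightarrow> \<theta> j p / (2 * pi)) (at p within {a..b})" if "j < dim P" for j
        using \<theta>(1)[OF that] p by (intro tendsto_intros) (auto simp: continuous_on_def)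
      have "\<forall>\<^sub>F q in at p within {a..b}. \<forall>j\<in>{..<dim P}.
          (\<theta> j p / (2 * pi) \<notin> \<int> \<longrightarrow> \<theta> j q / (2 * pi) \<notin> \<int> \<and> \<lceil>\<theta> j q / (2 * pi)\<rceil> = \<lceil>\<theta> j p / (2 * pi)\<rceil>) \<and>
          \<bar>\<theta> j q / (2 * pi) - \<theta> j p / (2 * pi)\<bar> < 1"
      proof (intro eventually_ball_finite ballI eventually_conj)
        fix j assume "j \<in> {..<dim P}"
        then have j: "j < dim P" by simp
        have "\<forall>\<^sub>F q in at p within {a..b}. dist (\<theta> j q / (2 * pi)) (\<theta> j p / (2 * pi)) < 1"
          using lim[OF j] by (rule tendstoD) simp
        then show "\<forall>\<^sub>F q in at p within {a..b}. \<bar>\<theta> j q / (2 * pi) - \<theta> j p / (2 * pi)\<bar> < 1"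
          by (simp add: dist_real_def)
        show "\<forall>\<^sub>F q in at p within {a..b}. \<theta> j p / (2 * pi) \<notin> \<int> \<longrightarrow>
            \<theta> j q / (2 * pi) \<notin> \<int> \<and> \<lceil>\<theta> j q / (2 * pi)\<rceil> = \<lceil>\<theta> j p / (2 * pi)\<rceil>"
        proof (cases "\<theta> j p / (2 * pi) \<in> \<int>")
          case False
          define c where "c = \<lceil>\<theta> j p / (2 * pi)\<rceil>"
          have "\<theta> j p / (2 * pi) \<noteq> of_int c" using False by auto
          then have c: "of_int c - 1 < \<theta> j p / (2 * pi)" "\<theta> j p / (2 * pi) < of_int c"
            unfolding c_def by linarith+
          have "\<forall>\<^sub>F q in at p within {a..b}. of_int c - 1 < \<theta> j q / (2 * pi)"
            using lim[OF j] c(1) by (rule order_tendstoD)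
          moreover have "\<forall>\<^sub>F q in at p within {a..b}. \<theta> j q / (2 * pi) < of_int c"
            using lim[OF j] c(2) by (rule order_tendstoD)
          ultimately show ?thesis
          proof eventually_elim
            case (elim q)
            then have "\<lceil>\<theta> j q / (2 * pi)\<rceil> = c" by linarith
            moreover have "\<theta> j q / (2 * pi) \<notin> \<int>"
              using elim by (metis Ints_cases ceiling_of_int calculation order_less_irrefl)
            ultimately show ?case by (simp add: c_def)
          qed
        qed simp
      qed simp
      moreover have "\<forall>\<^sub>F q in at p within {a..b}. q \<in> {a..b}"
        by (simp add: eventually_at_filter)
      ultimately show "\<forall>\<^sub>F q in at p within {a..b}. F p = F q"
      proof eventually_elim
        case (elim q)
        \<comment> \<open>Near \<open>p\<close> no angle arrives at a multiple of 2\<pi>. Since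
          equally many are there at \<open>q\<close> as at \<open>p\<close>, they are the same ones,
          and by closeness each keeps its multiple.\<close>
        have "{j. j < dim P \<and> cis (\<theta> j q) = 1} \<subseteq> {j. j < dim P \<and> cis (\<theta> j p) = 1}"
          using elim(1) unfolding cis1 by blast
        then have eq: "{j. j < dim P \<and> cis (\<theta> j q) = 1} = {j. j < dim P \<and> cis (\<theta> j p) = 1}"
          using card[OF p] card[OF elim(2)] by (intro card_subset_eq) auto
        have "\<lceil>\<theta> j p / (2 * pi)\<rceil> = \<lceil>\<theta> j q / (2 * pi)\<rceil>" if j: "j < dim P" for j
        proof (cases "\<theta> j p / (2 * pi) \<in> \<int>")
          case True
          then have "\<theta> j q / (2 * pi) \<in> \<int>" using eq j unfolding cis1 by blast
          then obtain k l :: int where kl: "\<theta> j p / (2 * pi) = of_int k" "\<theta> j q / (2 * pi) = of_int l"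
            using True by (metis Ints_cases)
          have "\<bar>\<theta> j q / (2 * pi) - \<theta> j p / (2 * pi)\<bar> < 1" using elim(1) j by blast
          then have "k = l" unfolding kl by linarith
          then show ?thesis unfolding kl by simp
        next
          case False
          then show ?thesis using elim(1) j by simp
        qed
        then show ?case by (simp add: F_def)
      qed
    qed
  qed (use ab in auto)
  then show ?thesis
    using sum_ceiling_eigenangles[OF T ab \<delta> \<theta>] by (simp add: F_def sum_subtractf)
qed

end

section \<open>Polarizations and Lagrangian subspaces\<close>

lemma (in definite_subspace) eq_P_if_trivial_complement:
  assumes S: "subspace S" "S \<subseteq> P" and "\<And>v. v \<in> P \<Longrightarrow> (\<And>s. s \<in> S \<Longrightarrow> h v s = 0) \<Longrightarrow> v = 0"
  shows "S = P"
proof (intro subset_antisym S subsetI)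
  fix x assume x: "x \<in> P"
  obtain e z where e: "orthonormal (dim S) e" "\<And>i. i < dim S \<Longrightarrow> e i \<in> S"
    using orthonormal_eigenbasis[OF S, of "\<lambda>x. x"] unfolding operator_on_def by metis
  define s where "s = (\<Sum>i<dim S. sc (h x (e i)) (e i))"
  have s: "s \<in> S" unfolding s_def using e(2) S by (intro sum_in_subspace) auto
  have "x - s = 0"
  proof (rule assms(3))
    show "x - s \<in> P" using x s S subspace_P by (auto intro: subspace_diff)
    fix t assume "t \<in> S"
    then have "t \<in> span (e ` {..<dim S})" using orthonormal_spans[OF e(1) S(1) e(2)] by simp
    then have t: "t = (\<Sum>i<dim S. sc (h t (e i)) (e i))" by (rule span_orthonormal[OF e(1) subset_refl])
    have "h (x - s) (e i) = 0" if "i < dim S" for i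
      using h_sum_orthonormal[OF e(1) subset_refl that] that by (simp add: h_diff_left s_def)
    then show "h (x - s) t = 0" by (subst t) (simp add: h_sum_right h_scale_right)
  qed
  then show "x \<in> S" using s by simp
qed

section \<open>Lagrangian subspaces as graphs over a polarization\<close>

definition plus_form :: "('a \<Rightarrow> 'a \<Rightarrow> complex) \<Rightarrow> 'a \<Rightarrow> 'a \<Rightarrow> complex"
  where "plus_form \<Omega> x y = - \<i> * \<Omega> x y"

text \<open>The target \<open>P\<close> is a parameter so that the inverse operator can be written
  \<open>graph_map Q L\<close>, with the two halves exchanged.\<close>

definition graph_map :: "'a::ab_group_add set \<Rightarrow> 'a set \<Rightarrow> 'a \<Rightarrow> 'a"
  where "graph_map P L x = (THE y. y \<in> P \<and> x + y \<in> L)"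

definition relative_map :: "'a::ab_group_add set \<Rightarrow> 'a set \<Rightarrow> 'a set \<Rightarrow> 'a set \<Rightarrow> 'a \<Rightarrow> 'a"
  where "relative_map P Q L M y = graph_map P L (inv_into Q (graph_map P M) y)"

text \<open>
  Generators depending continuously on the parameter replace a topology on the set of Lagrangian
  subspaces.
\<close>

definition lagrangian_family ::
  "(complex \<Rightarrow> 'a::ab_group_add \<Rightarrow> 'a) \<Rightarrow> ('a \<Rightarrow> 'a \<Rightarrow> complex) \<Rightarrow> 'p::metric_space set \<Rightarrow> ('p \<Rightarrow> 'a set) \<Rightarrow> bool"
  where "lagrangian_family sc \<Omega> K L \<longleftrightarrow> (\<forall>p\<in>K. lagrangian sc \<Omega> (L p)) \<and>
    (\<exists>\<Phi>. (\<forall>p\<in>K. L p = (\<lambda>f. f p) ` \<Phi>) \<and> (\<forall>f\<in>\<Phi>. \<forall>x. continuous_on K (\<lambda>p. \<Omega> x (f p))))"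

text \<open>The axioms are invariant under exchanging \<open>P\<close> and \<open>Q\<close> together
  with a change of sign of \<Omega>. Through \<open>swap\<close>, every fact about one half yields
  the corresponding fact about the other.\<close>

locale polarized_space = finite_dimensional_vector_space sc Basis
  for sc :: "complex \<Rightarrow> 'a::ab_group_add \<Rightarrow> 'a" and Basis :: "'a set" +
  fixes \<Omega> :: "'a \<Rightarrow> 'a \<Rightarrow> complex" and P Q :: "'a set"
  assumes sesquilinear_\<Omega>: "sesquilinear sc \<Omega>"
    and skew: "\<Omega> x y = - cnj (\<Omega> y x)"
    and subspace_plus: "subspace P" and subspace_minus: "subspace Q"
    and orthogonal: "p \<in> P \<Longrightarrow> q \<in> Q \<Longrightarrow> \<Omega> p q = 0"
    and decomposition: "\<exists>q\<in>Q. \<exists>p\<in>P. x = q + p"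
    and positive_plus: "p \<in> P \<Longrightarrow> p \<noteq> 0 \<Longrightarrow> Im (\<Omega> p p) > 0"
    and negative_minus: "q \<in> Q \<Longrightarrow> q \<noteq> 0 \<Longrightarrow> Im (\<Omega> q q) < 0"
begin

lemma \<Omega>_add_left: "\<Omega> (x + y) z = \<Omega> x z + \<Omega> y z"
  and \<Omega>_add_right: "\<Omega> x (y + z) = \<Omega> x y + \<Omega> x z"
  and \<Omega>_scale_left: "\<Omega> (sc c x) y = c * \<Omega> x y"
  and \<Omega>_scale_right: "\<Omega> x (sc c y) = cnj c * \<Omega> x y"
  using sesquilinear_\<Omega> by (auto simp: sesquilinear_def)

sublocale definite_subspace sc Basis "plus_form \<Omega>" P
proof
  show "plus_form \<Omega> x y = cnj (plus_form \<Omega> y x)" for x y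
    using skew[of x y] by (simp add: plus_form_def)
qed (auto simp: sesquilinear_def plus_form_def \<Omega>_add_left \<Omega>_add_right \<Omega>_scale_left \<Omega>_scale_right
  algebra_simps subspace_plus positive_plus)

lemma \<Omega>_eq: "\<Omega> x y = \<i> * plus_form \<Omega> x y"
  by (simp add: plus_form_def)

lemma orthogonal': "p \<in> P \<Longrightarrow> q \<in> Q \<Longrightarrow> \<Omega> q p = 0"
  using orthogonal[of p q] skew[of q p] by simp

lemma swap: "polarized_space sc Basis (\<lambda>x y. - \<Omega> x y) Q P"
proof
  show "- \<Omega> x y = - cnj (- \<Omega> y x)" for x y using skew[of x y] by simp
  show "\<exists>q\<in>P. \<exists>p\<in>Q. x = q + p" for x using decomposition[of x] by (metis add.commute)
qed (use orthogonal' positive_plus negative_minus subspace_plus subspace_minus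
  in \<open>auto simp: sesquilinear_def \<Omega>_add_left \<Omega>_add_right \<Omega>_scale_left \<Omega>_scale_right\<close>)

lemma lagrangian_swap: "lagrangian sc (\<lambda>x y. - \<Omega> x y) L \<longleftrightarrow> lagrangian sc \<Omega> L"
  by (simp add: lagrangian_def annihilator_def)

lemma lagrangian_family_swap:
  "lagrangian_family sc (\<lambda>x y. - \<Omega> x y) K L \<longleftrightarrow> lagrangian_family sc \<Omega> K L"
proof -
  have "continuous_on K (\<lambda>p. - f p) \<longleftrightarrow> continuous_on K f" for f :: "_ \<Rightarrow> complex"
    using continuous_on_minus[of K f] continuous_on_minus[of K "\<lambda>p. - f p"] by auto
  then show ?thesis unfolding lagrangian_family_def lagrangian_swap by simp
qed

lemma lagrangianD:
  assumes "lagrangian sc \<Omega> L"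
  shows "subspace L" "x \<in> L \<Longrightarrow> y \<in> L \<Longrightarrow> \<Omega> x y = 0" "(\<And>y. y \<in> L \<Longrightarrow> \<Omega> x y = 0) \<Longrightarrow> x \<in> L"
  using assms by (auto simp: lagrangian_def annihilator_def)

lemma lagrangian_Int_plus:
  assumes "lagrangian sc \<Omega> L" "x \<in> L" "x \<in> P"
  shows "x = 0"
  using lagrangianD(2)[OF assms(1,2,2)] positive_plus[OF assms(3)] by auto

lemma graph_unique:
  assumes "lagrangian sc \<Omega> L" "y \<in> P" "y' \<in> P" "x + y \<in> L" "x + y' \<in> L"
  shows "y = y'"
proof -
  have "(x + y) - (x + y') \<in> L" using assms lagrangianD(1) by (blast intro: subspace_diff)
  then have "y - y' \<in> L" by simp
  then have "y - y' = 0"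
    using assms subspace_plus by (intro lagrangian_Int_plus[OF assms(1)]) (auto intro: subspace_diff)
  then show ?thesis by simp
qed

lemma graph_unique':
  assumes "lagrangian sc \<Omega> L" "x \<in> Q" "x' \<in> Q" "x + y \<in> L" "x' + y \<in> L"
  shows "x = x'"
proof -
  interpret swap: polarized_space sc Basis "\<lambda>x y. - \<Omega> x y" Q P by (rule swap)
  show ?thesis
    using swap.graph_unique[of L x x' y] assms by (simp add: lagrangian_swap add.commute)
qed

text \<open>A vector of \<open>P\<close> orthogonal to the projection of \<open>L\<close>
  annihilates \<open>L\<close>, hence lies in \<open>L\<close>; but a definite subspace meets an
  isotropic one only in 0. So the projection has trivial complement in \<open>P\<close>.\<close>

lemma lagrangian_projects_onto_plus:
  assumes L: "lagrangian sc \<Omega> L" and p: "p \<in> P"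
  shows "\<exists>q\<in>Q. q + p \<in> L"
proof -
  note subL = lagrangianD(1)[OF L]
  define S where "S = {p \<in> P. \<exists>q\<in>Q. q + p \<in> L}"
  have "subspace S"
    unfolding subspace_def
  proof (intro conjI ballI allI)
    show "0 \<in> S" using subspace_0[OF subL] subspace_0[OF subspace_plus] subspace_0[OF subspace_minus]
      by (auto simp: S_def intro!: bexI[of _ 0])
    fix x c assume x: "x \<in> S"
    then obtain q where q: "q \<in> Q" "q + x \<in> L" "x \<in> P" by (auto simp: S_def)
    have "sc c q + sc c x \<in> L" using subspace_scale[OF subL q(2), of c] by (simp add: scale_right_distrib)
    then show "sc c x \<in> S" using q subspace_plus subspace_minus by (auto simp: S_def intro: subspace_scale)
    fix y assume "y \<in> S"
    then obtain q' where q': "q' \<in> Q" "q' + y \<in> L" "y \<in> P" by (auto simp: S_def)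
    have "(q + q') + (x + y) \<in> L" using subspace_add[OF subL q(2) q'(2)] by (simp add: algebra_simps)
    moreover have "q + q' \<in> Q" "x + y \<in> P"
      using q q' subspace_plus subspace_minus by (auto intro: subspace_add)
    ultimately show "x + y \<in> S" unfolding S_def by blast
  qed
  moreover have "S \<subseteq> P" by (auto simp: S_def)
  ultimately have "S = P"
  proof (rule eq_P_if_trivial_complement)
    fix v assume v: "v \<in> P" "\<And>s. s \<in> S \<Longrightarrow> plus_form \<Omega> v s = 0"
    have "v \<in> L"
    proof (rule lagrangianD(3)[OF L])
      fix l assume l: "l \<in> L"
      obtain q p where qp: "q \<in> Q" "p \<in> P" "l = q + p" using decomposition by blast
      then have "p \<in> S" using l by (auto simp: S_def)
      then show "\<Omega> v l = 0"
        using v(2)[of p] orthogonal[OF v(1) qp(1)] by (simp add: qp(3) \<Omega>_add_right plus_form_def)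
    qed
    then show "v = 0" using lagrangian_Int_plus[OF L] v(1) by blast
  qed
  then show ?thesis using p by (auto simp: S_def)
qed

lemma lagrangian_projects_onto_minus:
  assumes "lagrangian sc \<Omega> L" and "q \<in> Q"
  shows "\<exists>p\<in>P. q + p \<in> L"
proof -
  interpret swap: polarized_space sc Basis "\<lambda>x y. - \<Omega> x y" Q P by (rule swap)
  show ?thesis
    using swap.lagrangian_projects_onto_plus[of L q] assms by (simp add: lagrangian_swap add.commute)
qed

lemma graph_map:
  assumes L: "lagrangian sc \<Omega> L" and q: "q \<in> Q"
  shows "graph_map P L q \<in> P" "q + graph_map P L q \<in> L"
proof -
  obtain p where p: "p \<in> P" "q + p \<in> L" using lagrangian_projects_onto_minus[OF assms] by blast
  have "graph_map P L q \<in> P \<and> q + graph_map P L q \<in> L"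
    unfolding graph_map_def by (rule theI[of _ p]) (use p graph_unique[OF L] in auto)
  then show "graph_map P L q \<in> P" "q + graph_map P L q \<in> L" by auto
qed

lemma graph_map_eqI:
  assumes L: "lagrangian sc \<Omega> L" and "q \<in> Q" "p \<in> P" "q + p \<in> L"
  shows "graph_map P L q = p"
  using graph_unique[OF L _ assms(3) _ assms(4)] graph_map[OF assms(1,2)] by blast

lemma graph_map_bij:
  assumes L: "lagrangian sc \<Omega> L"
  shows "inj_on (graph_map P L) Q" "graph_map P L ` Q = P"
proof -
  show "inj_on (graph_map P L) Q"
    by (rule inj_onI) (metis graph_map(2)[OF L] graph_unique'[OF L])
  show "graph_map P L ` Q = P"
  proof
    show "graph_map P L ` Q \<subseteq> P" using graph_map(1)[OF L] by auto
    show "P \<subseteq> graph_map P L ` Q"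
      using lagrangian_projects_onto_plus[OF L] graph_map_eqI[OF L] by (metis imageI subsetI)
  qed
qed

lemma inv_graph_map:
  assumes L: "lagrangian sc \<Omega> L" and p: "p \<in> P"
  shows "inv_into Q (graph_map P L) p \<in> Q" "inv_into Q (graph_map P L) p + p \<in> L"
    "inv_into Q (graph_map P L) p = graph_map Q L p"
proof -
  interpret swap: polarized_space sc Basis "\<lambda>x y. - \<Omega> x y" Q P by (rule swap)
  have p': "p \<in> graph_map P L ` Q" using p graph_map_bij(2)[OF L] by simp
  show 1: "inv_into Q (graph_map P L) p \<in> Q" by (rule inv_into_into[OF p'])
  show 2: "inv_into Q (graph_map P L) p + p \<in> L"
    using graph_map(2)[OF L 1] f_inv_into_f[OF p'] by simp
  show "inv_into Q (graph_map P L) p = graph_map Q L p"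
    by (rule swap.graph_map_eqI[symmetric]) (use 1 2 p L in \<open>auto simp: lagrangian_swap add.commute\<close>)
qed

text \<open>Written as a relation, the operator is free of inverses and descriptions: additivity,
  composition and invariance of the form follow by combining the witnesses \<open>q\<close>.\<close>

lemma relative_map_iff:
  assumes L: "lagrangian sc \<Omega> L" and M: "lagrangian sc \<Omega> M" and yz: "y \<in> P" "z \<in> P"
  shows "relative_map P Q L M y = z \<longleftrightarrow> (\<exists>q\<in>Q. q + y \<in> M \<and> q + z \<in> L)"
proof
  note q = inv_graph_map[OF M yz(1)]
  show "\<exists>q\<in>Q. q + y \<in> M \<and> q + z \<in> L" if "relative_map P Q L M y = z"
    using that q graph_map[OF L q(1)] by (auto simp: relative_map_def)
  assume "\<exists>q\<in>Q. q + y \<in> M \<and> q + z \<in> L"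
  then obtain q' where q': "q' \<in> Q" "q' + y \<in> M" "q' + z \<in> L" by blast
  then have "inv_into Q (graph_map P M) y = q'" using graph_unique'[OF M] q by blast
  then show "relative_map P Q L M y = z"
    using graph_map_eqI[OF L q'(1) yz(2) q'(3)] by (simp add: relative_map_def)
qed

lemma relative_map_in:
  assumes L: "lagrangian sc \<Omega> L" and M: "lagrangian sc \<Omega> M" and y: "y \<in> P"
  shows "relative_map P Q L M y \<in> P"
    "\<exists>q\<in>Q. q + y \<in> M \<and> q + relative_map P Q L M y \<in> L"
  using graph_map(1)[OF L inv_graph_map(1)[OF M y]]
    relative_map_iff[OF L M y, of "relative_map P Q L M y"] by (auto simp: relative_map_def)

lemma relative_map_compose:
  assumes L: "lagrangian sc \<Omega> L" and M: "lagrangian sc \<Omega> M" and K: "lagrangian sc \<Omega> K"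
    and y: "y \<in> P"
  shows "relative_map P Q L M (relative_map P Q M K y) = relative_map P Q L K y"
proof -
  obtain q where q: "q \<in> Q" "q + y \<in> K" "q + relative_map P Q M K y \<in> M"
    using relative_map_in[OF M K y] by blast
  obtain p where p: "p \<in> P" "q + p \<in> L" using lagrangian_projects_onto_minus[OF L q(1)] by blast
  have "relative_map P Q L M (relative_map P Q M K y) = p"
    using relative_map_iff[OF L M relative_map_in(1)[OF M K y] p(1)] q p by blast
  moreover have "relative_map P Q L K y = p"
    using relative_map_iff[OF L K y p(1)] q p by blast
  ultimately show ?thesis by simp
qed

text \<open>Since \<open>L\<close> and \<open>M\<close> are both isotropic, \<Omega> takes the same
  value on \<open>x\<close>, \<open>y\<close> as on their images, namely the negative of its value
  on the common witnesses \<open>q\<close> and \<open>q'\<close>.\<close>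

lemma unitary_on_relative_map:
  assumes L: "lagrangian sc \<Omega> L" and M: "lagrangian sc \<Omega> M"
  shows "unitary_on (relative_map P Q L M)"
  unfolding unitary_on_def operator_on_def
proof (intro conjI ballI allI)
  note subL = lagrangianD(1)[OF L] and subM = lagrangianD(1)[OF M]
  let ?T = "relative_map P Q L M"
  fix x assume x: "x \<in> P"
  show Tx: "?T x \<in> P" by (rule relative_map_in(1)[OF L M x])
  obtain q where q: "q \<in> Q" "q + x \<in> M" "q + ?T x \<in> L" using relative_map_in(2)[OF L M x] by blast
  show "?T (sc c x) = sc c (?T x)" for c
  proof (subst relative_map_iff[OF L M])
    show "\<exists>q\<in>Q. q + sc c x \<in> M \<and> q + sc c (?T x) \<in> L"
      using subspace_scale[OF subM q(2), of c] subspace_scale[OF subL q(3), of c]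
        subspace_scale[OF subspace_minus q(1), of c]
      by (auto simp: scale_right_distrib)
  qed (use x Tx subspace_plus in \<open>auto intro: subspace_scale\<close>)
  fix y assume y: "y \<in> P"
  note Ty = relative_map_in(1)[OF L M y]
  obtain q' where q': "q' \<in> Q" "q' + y \<in> M" "q' + ?T y \<in> L" using relative_map_in(2)[OF L M y] by blast
  show "?T (x + y) = ?T x + ?T y"
  proof (subst relative_map_iff[OF L M])
    show "\<exists>q\<in>Q. q + (x + y) \<in> M \<and> q + (?T x + ?T y) \<in> L"
      using subspace_add[OF subM q(2) q'(2)] subspace_add[OF subL q(3) q'(3)]
        subspace_add[OF subspace_minus q(1) q'(1)]
      by (auto simp: algebra_simps intro!: bexI[of _ "q + q'"])
  qed (use x y Tx Ty subspace_plus in \<open>auto intro: subspace_add\<close>)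
  have "\<Omega> (q + ?T x) (q' + ?T y) = 0" "\<Omega> (q + x) (q' + y) = 0"
    using lagrangianD(2)[OF L] lagrangianD(2)[OF M] q q' by auto
  then have "\<Omega> (?T x) (?T y) = \<Omega> x y"
    using x y Tx Ty q(1) q'(1) orthogonal orthogonal'
    by (simp add: \<Omega>_add_left \<Omega>_add_right) (metis add_left_cancel)
  then show "plus_form \<Omega> (?T x) (?T y) = plus_form \<Omega> x y" by (simp add: plus_form_def)
qed

lemma decomposition_unique:
  assumes "q + p = q' + p'" "q \<in> Q" "q' \<in> Q" "p \<in> P" "p' \<in> P"
  shows "q = q'" "p = p'"
proof -
  have "p - p' = (q + p) - q - p'" by simp
  also have "\<dots> = q' - q" unfolding assms(1) by simp
  finally have eq: "p - p' = q' - q" .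
  have "p - p' \<in> P" using assms subspace_plus by (auto intro: subspace_diff)
  moreover have "p - p' \<in> Q" unfolding eq using assms subspace_minus by (auto intro: subspace_diff)
  ultimately have "p - p' = 0" using positive_plus[of "p - p'"] negative_minus[of "p - p'"] by force
  then show "p = p'" "q = q'" using eq by auto
qed

section \<open>Projection to the positive half and intersections of Lagrangian subspaces\<close>

definition proj_plus :: "'a \<Rightarrow> 'a"
  where "proj_plus x = (THE p. p \<in> P \<and> (\<exists>q\<in>Q. x = q + p))"

lemma proj_plus_eq: "q \<in> Q \<Longrightarrow> p \<in> P \<Longrightarrow> proj_plus (q + p) = p"
  unfolding proj_plus_def using decomposition_unique by (intro the_equality) blast+

lemma linear_proj_plus: "Vector_Spaces.linear sc sc proj_plus"
proof -
  have "proj_plus (x + y) = proj_plus x + proj_plus y" for x y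
  proof -
    obtain q p q' p' where *: "q \<in> Q" "p \<in> P" "x = q + p" "q' \<in> Q" "p' \<in> P" "y = q' + p'"
      using decomposition by metis
    have "x + y = (q + q') + (p + p')" by (simp add: * algebra_simps)
    then have "proj_plus (x + y) = p + p'"
      using * subspace_plus subspace_minus by (simp only: proj_plus_eq subspace_add)
    then show ?thesis using * by (simp add: proj_plus_eq)
  qed
  moreover have "proj_plus (sc c x) = sc c (proj_plus x)" for c x
  proof -
    obtain q p where *: "q \<in> Q" "p \<in> P" "x = q + p" using decomposition by metis
    then show ?thesis
      using subspace_plus subspace_minus by (simp add: proj_plus_eq subspace_scale scale_right_distrib)
  qed
  ultimately show ?thesis using vector_space_axioms by (simp add: Vector_Spaces.linear_iff)
qed

lemma dim_proj_plus:
  assumes L: "lagrangian sc \<Omega> L" and S: "subspace S" "S \<subseteq> L"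
  shows "dim (proj_plus ` S) = dim S"
proof -
  interpret pair: finite_dimensional_vector_space_pair_1 sc Basis sc ..
  have "inj_on proj_plus S"
  proof (rule inj_onI)
    fix x y assume xy: "x \<in> S" "y \<in> S" "proj_plus x = proj_plus y"
    obtain q p q' p' where *: "q \<in> Q" "p \<in> P" "x = q + p" "q' \<in> Q" "p' \<in> P" "y = q' + p'"
      using decomposition by metis
    then have "p = p'" using xy by (simp add: proj_plus_eq)
    then have "q = q'" using graph_unique'[OF L *(1,4), of p] xy S * by auto
    then show "x = y" using * \<open>p = p'\<close> by simp
  qed
  then show ?thesis
    by (intro pair.dim_image_eq linear_proj_plus) (simp add: span_eq_iff[THEN iffD2, OF S(1)])
qed

text \<open>By \<open>relative_map_iff\<close>, a fixed vector \<open>y\<close> comes with some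
  \<open>q\<close> such that \<open>q + y\<close> lies in both subspaces. Intersection dimensions
  thereby become multiplicities of the eigenvalue 1.\<close>

lemma eigenspace_relative_map:
  assumes L: "lagrangian sc \<Omega> L" and M: "lagrangian sc \<Omega> M"
  shows "eigenspace (relative_map P Q L M) 1 = proj_plus ` (L \<inter> M)"
proof (intro Set.set_eqI iffI)
  fix y assume "y \<in> eigenspace (relative_map P Q L M) 1"
  then have y: "y \<in> P" "relative_map P Q L M y = y" by (auto simp: eigenspace_def)
  then obtain q where "q \<in> Q" "q + y \<in> M" "q + y \<in> L" using relative_map_iff[OF L M y(1,1)] by blast
  then show "y \<in> proj_plus ` (L \<inter> M)" using proj_plus_eq[OF _ y(1)] by (auto intro!: image_eqI[of _ _ "q + y"])
next
  fix y assume "y \<in> proj_plus ` (L \<inter> M)"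
  then obtain x where x: "x \<in> L" "x \<in> M" "y = proj_plus x" by blast
  obtain q p where qp: "q \<in> Q" "p \<in> P" "x = q + p" using decomposition by blast
  then have "y = p" using x proj_plus_eq by simp
  then show "y \<in> eigenspace (relative_map P Q L M) 1"
    using relative_map_iff[OF L M qp(2,2)] x qp by (auto simp: eigenspace_def)
qed

lemma dim_eigenspace_relative_map:
  assumes L: "lagrangian sc \<Omega> L" and M: "lagrangian sc \<Omega> M"
  shows "dim (eigenspace (relative_map P Q L M) 1) = dim (L \<inter> M)"
  unfolding eigenspace_relative_map[OF L M]
  by (rule dim_proj_plus[OF L]) (use lagrangianD(1)[OF L] lagrangianD(1)[OF M] in \<open>auto intro: subspace_inter\<close>)

text \<open>Both pairwise intersections lie in \<open>M\<close>, on which the projection is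
  injective; hence it commutes with intersecting them.\<close>

lemma dim_eigenspace_Int_relative_map:
  assumes L: "lagrangian sc \<Omega> L" and M: "lagrangian sc \<Omega> M" and K: "lagrangian sc \<Omega> K"
  shows "dim (eigenspace (relative_map P Q L M) 1 \<inter> eigenspace (relative_map P Q M K) 1) = dim (L \<inter> M \<inter> K)"
proof -
  have "proj_plus ` (L \<inter> M) \<inter> proj_plus ` (M \<inter> K) = proj_plus ` (L \<inter> M \<inter> K)"
  proof (intro Set.set_eqI iffI)
    fix y assume "y \<in> proj_plus ` (L \<inter> M) \<inter> proj_plus ` (M \<inter> K)"
    then obtain x x' where x: "x \<in> L" "x \<in> M" "y = proj_plus x" "x' \<in> M" "x' \<in> K" "y = proj_plus x'" by blast
    obtain q p q' p' where *: "q \<in> Q" "p \<in> P" "x = q + p" "q' \<in> Q" "p' \<in> P" "x' = q' + p'"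
      using decomposition by metis
    then have "p = p'" using x by (simp add: proj_plus_eq)
    then have "q = q'" using graph_unique'[OF M *(1,4), of p] x * by auto
    then show "y \<in> proj_plus ` (L \<inter> M \<inter> K)" using * \<open>p = p'\<close> x by blast
  qed blast
  moreover have "subspace (L \<inter> M \<inter> K)" using L M K lagrangianD(1) by (auto intro: subspace_inter)
  then have "dim (proj_plus ` (L \<inter> M \<inter> K)) = dim (L \<inter> M \<inter> K)" by (rule dim_proj_plus[OF L]) auto
  ultimately show ?thesis
    by (simp add: eigenspace_relative_map[OF L M] eigenspace_relative_map[OF M K])
qed

lemma dim_lagrangian:
  assumes L: "lagrangian sc \<Omega> L"
  shows "dim L = dim P"
proof -
  have "proj_plus ` L = P"
  proof (intro Set.set_eqI iffI)
    fix y assume "y \<in> proj_plus ` L"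
    then obtain x where x: "x \<in> L" "y = proj_plus x" by blast
    obtain q p where "q \<in> Q" "p \<in> P" "x = q + p" using decomposition by blast
    then show "y \<in> P" using x by (simp add: proj_plus_eq)
  next
    fix y assume y: "y \<in> P"
    then obtain q where "q \<in> Q" "q + y \<in> L" using lagrangian_projects_onto_plus[OF L] by blast
    then show "y \<in> proj_plus ` L" using proj_plus_eq[OF _ y] by (auto intro!: image_eqI[of _ _ "q + y"])
  qed
  then show ?thesis using dim_proj_plus[OF L lagrangianD(1)[OF L] subset_refl] by simp
qed

lemma dim_UNIV_if_lagrangian:
  assumes L: "lagrangian sc \<Omega> L"
  shows "dim (UNIV :: 'a set) = 2 * dim P"
proof -
  interpret swap: polarized_space sc Basis "\<lambda>x y. - \<Omega> x y" Q P by (rule swap)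
  have "dim Q = dim P" using dim_lagrangian[OF L] swap.dim_lagrangian[of L] L by (simp add: lagrangian_swap)
  moreover have "P \<inter> Q \<subseteq> {0}" using positive_plus negative_minus by force
  then have "dim (P \<inter> Q) = 0" by (simp add: dim_eq_0)
  moreover have "{x + y |x y. x \<in> P \<and> y \<in> Q} = UNIV"
    using decomposition by (auto simp: set_eq_iff) (metis add.commute)
  ultimately show ?thesis using dim_sums_Int[OF subspace_plus subspace_minus] by (simp del: dim_UNIV dim_eq_0)
qed

lemma defect_relative_map_triple:
  assumes L: "lagrangian sc \<Omega> L" and M: "lagrangian sc \<Omega> M" and K: "lagrangian sc \<Omega> K"
  shows "defect (relative_map P Q L K) \<le> defect (relative_map P Q L M) + defect (relative_map P Q M K)"
    and "defect (relative_map P Q L M) + defect (relative_map P Q M K)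
        + real (dim (L \<inter> M)) + real (dim (M \<inter> K))
      \<le> defect (relative_map P Q L K) + real (dim P) + real (dim (L \<inter> M \<inter> K))"
proof -
  have "defect (relative_map P Q L M \<circ> relative_map P Q M K) = defect (relative_map P Q L K)"
    by (rule defect_cong) (simp add: relative_map_compose[OF L M K])
  then show "defect (relative_map P Q L K) \<le> defect (relative_map P Q L M) + defect (relative_map P Q M K)"
    and "defect (relative_map P Q L M) + defect (relative_map P Q M K)
        + real (dim (L \<inter> M)) + real (dim (M \<inter> K))
      \<le> defect (relative_map P Q L K) + real (dim P) + real (dim (L \<inter> M \<inter> K))"
    using defect_compose[OF unitary_on_relative_map[OF L M] unitary_on_relative_map[OF M K]]
    by (simp_all add: dim_eigenspace_relative_map L M K dim_eigenspace_Int_relative_map[OF L M K])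
qed

lemma det_on_relative_map_compose:
  assumes L: "lagrangian sc \<Omega> L" and M: "lagrangian sc \<Omega> M" and K: "lagrangian sc \<Omega> K"
  shows "det_on (relative_map P Q L K) = det_on (relative_map P Q L M) * det_on (relative_map P Q M K)"
proof -
  have "det_on (relative_map P Q L M \<circ> relative_map P Q M K) = det_on (relative_map P Q L K)"
    by (rule det_on_cong) (simp add: relative_map_compose[OF L M K])
  then show ?thesis
    using det_on_compose unitary_onD(1) unitary_on_relative_map L M K by metis
qed

section \<open>Continuity of the operators of Lagrangian families\<close>

lemma graph_map_isometry:
  assumes L: "lagrangian sc \<Omega> L" and q: "q \<in> Q"
  shows "plus_form \<Omega> (graph_map P L q) (graph_map P L q) = - plus_form \<Omega> q q"
proof -
  have "\<Omega> (q + graph_map P L q) (q + graph_map P L q) = 0"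
    using lagrangianD(2)[OF L] graph_map[OF L q] by blast
  then have "\<Omega> (graph_map P L q) (graph_map P L q) = - \<Omega> q q"
    using orthogonal orthogonal' graph_map(1)[OF L q] q
    by (simp add: \<Omega>_add_left \<Omega>_add_right eq_neg_iff_add_eq_0 add.commute)
  then show ?thesis by (simp add: plus_form_def)
qed

text \<open>The coordinates of the image are bounded, because the graph map is an isometry up to
  sign. A limit of images still annihilates every generator of the limit subspace, and for a
  Lagrangian subspace this means membership, so the graph is closed.\<close>

lemma continuous_on_graph_map:
  assumes L: "lagrangian_family sc \<Omega> K L" and q: "q \<in> Q"
  shows "continuous_on K (\<lambda>p. plus_form \<Omega> (graph_map P (L p) q) z)"
proof -
  note e = orthonormal_basis_P
  have lagr: "\<And>p. p \<in> K \<Longrightarrow> lagrangian sc \<Omega> (L p)" using L by (simp add: lagrangian_family_def)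
  obtain \<Phi> where \<Phi>: "\<And>p. p \<in> K \<Longrightarrow> L p = (\<lambda>f. f p) ` \<Phi>"
    "\<And>f x. f \<in> \<Phi> \<Longrightarrow> continuous_on K (\<lambda>p. \<Omega> x (f p))"
    using L by (auto simp: lagrangian_family_def)
  define c where "c i p = plus_form \<Omega> (graph_map P (L p) q) (basis_P i)" for i p
  have expand: "graph_map P (L p) q = (\<Sum>i<dim P. sc (c i p) (basis_P i))" if "p \<in> K" for p
    unfolding c_def by (rule orthonormal_expansion[OF e graph_map(1)[OF lagr[OF that] q]])
  have cont: "continuous_on K (c i)" if "i < dim P" for i
  proof (rule continuous_on_if_closed_graph[OF _ _ that])
    fix j assume j: "j < dim P"
    have "cmod (c j p) \<le> cmod (plus_form \<Omega> q q) + 1" if p: "p \<in> K" for p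
    proof -
      let ?y = "graph_map P (L p) q"
      have sq: "c i p * plus_form \<Omega> (basis_P i) ?y = of_real ((cmod (c i p))\<^sup>2)" for i
        using hermitian[of "basis_P i" ?y] unfolding c_def by (metis complex_norm_square)
      have "- plus_form \<Omega> q q = (\<Sum>i<dim P. of_real ((cmod (c i p))\<^sup>2))"
        using parseval[OF e graph_map(1)[OF lagr[OF p] q], of ?y] graph_map_isometry[OF lagr[OF p] q]
        unfolding c_def[symmetric] sq by simp
      also have "\<dots> = of_real (\<Sum>i<dim P. (cmod (c i p))\<^sup>2)" by simp
      finally have "cmod (plus_form \<Omega> q q) = \<bar>\<Sum>i<dim P. (cmod (c i p))\<^sup>2\<bar>"
        by (metis norm_minus_cancel norm_of_real)
      moreover have "(cmod (c j p))\<^sup>2 \<le> (\<Sum>i<dim P. (cmod (c i p))\<^sup>2)"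
        using j by (intro member_le_sum) auto
      ultimately have "(cmod (c j p))\<^sup>2 \<le> cmod (plus_form \<Omega> q q)" by linarith
      moreover have "cmod (c j p) \<le> (cmod (c j p))\<^sup>2 + 1"
        using sum_squares_bound[of "cmod (c j p)" 1] by (simp add: power2_eq_square) (smt (verit) norm_ge_zero)
      ultimately show ?thesis by linarith
    qed
    then show "bounded (c j ` K)" by (auto simp: bounded_iff)
  next
    fix s x l j
    assume s: "\<And>k. s k \<in> K" and lim: "s \<longlonglongrightarrow> x" and x: "x \<in> K" and j: "j < dim P"
      and l: "\<And>j. j < dim P \<Longrightarrow> (\<lambda>k. c j (s k)) \<longlonglongrightarrow> l j"
    define y where "y = (\<Sum>i<dim P. sc (l i) (basis_P i))"
    have yP: "y \<in> P"
      unfolding y_def by (rule sum_in_subspace[OF subspace_plus]) (use orthonormal_in[OF e] in auto)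
    have "q + y \<in> L x"
    proof (rule lagrangianD(3)[OF lagr[OF x]])
      fix v assume "v \<in> L x"
      then obtain f where f: "f \<in> \<Phi>" "v = f x" using \<Phi>(1)[OF x] by auto
      have seq: "(\<lambda>k. \<Omega> w (f (s k))) \<longlonglongrightarrow> \<Omega> w (f x)" for w
        by (rule continuous_on_tendsto_compose[OF \<Phi>(2)[OF f(1)] lim x]) (use s in auto)
      have split: "\<Omega> (q + (\<Sum>i<dim P. sc (a i) (basis_P i))) v
        = \<Omega> q v + (\<Sum>i<dim P. a i * \<Omega> (basis_P i) v)" for a v
        by (simp add: \<Omega>_eq h_add_left h_sum_left h_scale_left sum_distrib_left algebra_simps)
      have "(\<lambda>k. \<Omega> q (f (s k)) + (\<Sum>i<dim P. c i (s k) * \<Omega> (basis_P i) (f (s k))))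
        \<longlonglongrightarrow> \<Omega> q (f x) + (\<Sum>i<dim P. l i * \<Omega> (basis_P i) (f x))"
        using l seq by (intro tendsto_intros) auto
      moreover have "\<Omega> q (f (s k)) + (\<Sum>i<dim P. c i (s k) * \<Omega> (basis_P i) (f (s k))) = 0" for k
        unfolding split[symmetric] expand[OF s, symmetric]
        by (rule lagrangianD(2)[OF lagr[OF s] graph_map(2)[OF lagr[OF s] q]])
          (use \<Phi>(1)[OF s] f(1) in auto)
      ultimately show "\<Omega> (q + y) v = 0"
        unfolding y_def split f(2) by (simp add: LIMSEQ_const_iff)
    qed
    then have "graph_map P (L x) q = y" by (rule graph_map_eqI[OF lagr[OF x] q yP])
    then show "l j = c j x"
      unfolding c_def y_def using h_sum_orthonormal[OF e subset_refl j] j by simp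
  qed
  have "continuous_on K (\<lambda>p. \<Sum>i<dim P. c i p * plus_form \<Omega> (basis_P i) z)"
    using cont by (intro continuous_intros) auto
  then show ?thesis
    by (rule continuous_on_eq) (simp add: expand h_sum_left h_scale_left)
qed

lemma graph_map_linear_sum:
  assumes L: "lagrangian sc \<Omega> L" and f: "\<And>i. i \<in> I \<Longrightarrow> f i \<in> Q"
  shows "graph_map P L (\<Sum>i\<in>I. sc (c i) (f i)) = (\<Sum>i\<in>I. sc (c i) (graph_map P L (f i)))"
proof (rule graph_map_eqI[OF L])
  show "(\<Sum>i\<in>I. sc (c i) (f i)) \<in> Q" using f by (intro sum_in_subspace subspace_minus) auto
  show "(\<Sum>i\<in>I. sc (c i) (graph_map P L (f i))) \<in> P"
    using f graph_map(1)[OF L] by (intro sum_in_subspace subspace_plus) auto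
  have "(\<Sum>i\<in>I. sc (c i) (f i + graph_map P L (f i))) \<in> L"
    using f graph_map(2)[OF L] by (intro sum_in_subspace lagrangianD(1)[OF L]) auto
  then show "(\<Sum>i\<in>I. sc (c i) (f i)) + (\<Sum>i\<in>I. sc (c i) (graph_map P L (f i))) \<in> L"
    by (simp add: scale_right_distrib sum.distrib)
qed

text \<open>The inverse factor is a graph map for the exchanged polarization, hence continuous as
  well. Expanding its value in a basis of \<open>Q\<close> independent of the parameter turns the
  composition into a finite sum of products of continuous functions.\<close>

lemma operator_path_relative_map:
  assumes L: "lagrangian_family sc \<Omega> K L" and M: "lagrangian_family sc \<Omega> K M"
  shows "operator_path K (\<lambda>p. relative_map P Q (L p) (M p))"
  unfolding operator_path_def
proof (intro conjI ballI)
  have lagr: "lagrangian sc \<Omega> (L p)" "lagrangian sc \<Omega> (M p)" if "p \<in> K" for p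
    using L M that by (auto simp: lagrangian_family_def)
  then show "unitary_on (relative_map P Q (L p) (M p))" if "p \<in> K" for p
    using that by (intro unitary_on_relative_map)
  interpret swap: polarized_space sc Basis "\<lambda>x y. - \<Omega> x y" Q P by (rule swap)
  fix x y assume x: "x \<in> P" and y: "y \<in> P"
  let ?f = "swap.basis_P"
  define d where "d i p = plus_form (\<lambda>x y. - \<Omega> x y) (graph_map Q (M p) x) (?f i)" for i p
  have fQ: "?f i \<in> Q" if "i < dim Q" for i
    using swap.orthonormal_in[OF swap.orthonormal_basis_P that] .
  have d: "continuous_on K (d i)" for i
    unfolding d_def using M x by (intro swap.continuous_on_graph_map) (simp_all add: lagrangian_family_swap)
  have "relative_map P Q (L p) (M p) x = (\<Sum>i<dim Q. sc (d i p) (graph_map P (L p) (?f i)))" if p: "p \<in> K" for p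
  proof -
    have "graph_map Q (M p) x \<in> Q" using inv_graph_map[OF lagr(2)[OF p] x] by simp
    then have "graph_map Q (M p) x = (\<Sum>i<dim Q. sc (d i p) (?f i))"
      unfolding d_def by (rule swap.orthonormal_expansion[OF swap.orthonormal_basis_P])
    then show ?thesis
      unfolding relative_map_def inv_graph_map(3)[OF lagr(2)[OF p] x]
      using graph_map_linear_sum[OF lagr(1)[OF p], of "{..<dim Q}" ?f] fQ by simp
  qed
  then have "(\<Sum>i<dim Q. d i p * plus_form \<Omega> (graph_map P (L p) (?f i)) y)
      = plus_form \<Omega> (relative_map P Q (L p) (M p) x) y" if "p \<in> K" for p
    using that by (simp add: h_sum_left h_scale_left)
  moreover have "continuous_on K (\<lambda>p. \<Sum>i<dim Q. d i p * plus_form \<Omega> (graph_map P (L p) (?f i)) y)"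
    using fQ by (intro continuous_intros d continuous_on_graph_map[OF L]) auto
  ultimately show "continuous_on K (\<lambda>p. plus_form \<Omega> (relative_map P Q (L p) (M p) x) y)"
    by (rule continuous_on_eq[rotated])
qed

end

section \<open>Maslov index and products of symplectic spaces\<close>

context complex_symplectic_space
begin

lemma definite_subspace_UNIV:
  assumes "inner_product sc g"
  shows "definite_subspace sc Basis g UNIV"
  using assms subspace_UNIV unfolding inner_product_def by unfold_locales blast+

lemma form_operator:
  assumes g: "inner_product sc g"
  shows "\<omega> x y = g (form_operator \<omega> g x) y"
proof -
  interpret G: definite_subspace sc Basis g UNIV
    by (rule definite_subspace_UNIV[OF g])
  note e = G.orthonormal_basis_P
  define J where "J x = (\<Sum>i<dim UNIV. sc (\<omega> x (G.basis_P i)) (G.basis_P i))" for x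
  have sum_right: "\<omega> x (\<Sum>i\<in>I. f i) = (\<Sum>i\<in>I. \<omega> x (f i))" for x f and I :: "nat set"
  proof -
    have "\<omega> x 0 = 0" using sesquilinear_form unfolding sesquilinear_def by (metis add_cancel_right_right)
    then show ?thesis
      using sesquilinear_form
      by (induction I rule: infinite_finite_induct) (auto simp: sesquilinear_def)
  qed
  have "\<omega> x y = g (J x) y" for x y
  proof -
    have "\<omega> x (\<Sum>i<dim UNIV. sc (g y (G.basis_P i)) (G.basis_P i))
      = (\<Sum>i<dim UNIV. cnj (g y (G.basis_P i)) * \<omega> x (G.basis_P i))"
      unfolding sum_right using sesquilinear_form by (simp add: sesquilinear_def)
    moreover have "g (J x) y = (\<Sum>i<dim UNIV. \<omega> x (G.basis_P i) * g (G.basis_P i) y)"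
      by (simp only: J_def G.h_sum_left G.h_scale_left)
    moreover have "g (G.basis_P i) y = cnj (g y (G.basis_P i))" for i by (rule G.hermitian)
    ultimately show ?thesis
      using G.orthonormal_expansion[OF e, of y] by (simp add: mult.commute)
  qed
  then have J: "\<forall>x y. \<omega> x y = g (J x) y" by blast
  moreover have "J' = J" if "\<forall>x y. \<omega> x y = g (J' x) y" for J'
    using that J by (intro ext G.eq_if_h_eq) auto
  ultimately have "\<forall>x y. \<omega> x y = g (form_operator \<omega> g x) y"
    unfolding form_operator_def by (rule theI)
  then show ?thesis by blast
qed

text \<open>In an orthonormal eigenbasis of \<open>iJ\<close> the form \<open>i\<close> times
  \<omega> is diagonal with the real eigenvalues as entries, and none vanishes because \<omega> is
  nondegenerate. Positive eigenvalues make the imaginary part of \<omega> negative, which explains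
  the labels of the two halves.\<close>

lemma polarization:
  assumes g: "inner_product sc g"
  shows "polarized_space sc Basis \<omega> (plus_space sc \<omega> g) (minus_space sc \<omega> g)"
proof -
  interpret G: definite_subspace sc Basis g UNIV
    by (rule definite_subspace_UNIV[OF g])
  have \<omega>_scale: "\<omega> (sc c x) y = c * \<omega> x y" "\<omega> x (sc c y) = cnj c * \<omega> x y" for c x y
    using sesquilinear_form by (auto simp: sesquilinear_def)
  have \<omega>_add: "\<omega> (x + z) y = \<omega> x y + \<omega> z y" for x z y
    using sesquilinear_form by (auto simp: sesquilinear_def)
  define T where "T x = sc \<i> (form_operator \<omega> g x)" for x
  have gT: "g (T x) y = \<i> * \<omega> x y" for x y
    by (simp add: T_def G.h_scale_left form_operator[OF g])
  have self_adjoint: "g (T x) y = g x (T y)" for x y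
  proof -
    have "g x (T y) = cnj (\<i> * \<omega> y x)" using G.hermitian[of x "T y"] by (simp add: gT)
    then show ?thesis using skew_hermitian[of x y] by (simp add: gT)
  qed
  have T: "G.operator_on UNIV T"
    unfolding G.operator_on_def
    by (intro conjI ballI allI G.eq_if_h_eq)
      (auto simp: gT \<omega>_add \<omega>_scale G.h_add_left G.h_scale_left algebra_simps)
  have "g (T y) v = 0" if "T v = sc c v" "g y v = 0" for v c y
    using that by (simp add: self_adjoint G.h_scale_right)
  then obtain e z where e: "G.orthonormal (dim UNIV) e"
    and ez: "\<And>i. i < dim UNIV \<Longrightarrow> T (e i) = sc (z i) (e i)"
    using G.orthonormal_eigenbasis[OF subspace_UNIV subset_refl T] by metis
  define r where "r i = Re (z i)" for i
  have e1: "g (e i) (e i) = 1" if "i < dim UNIV" for i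
    using G.orthonormal_h[OF e that that] by simp
  have zr: "z i = of_real (r i)" if "i < dim UNIV" for i
    using self_adjoint[of "e i" "e i"] e1[OF that] ez[OF that]
    by (simp add: G.h_scale_left G.h_scale_right r_def complex_eq_iff)
  have Te: "T (e i) = sc (of_real (r i)) (e i)" if "i < dim UNIV" for i
    using ez[OF that] zr[OF that] by simp
  have r0: "r i \<noteq> 0" if "i < dim UNIV" for i
  proof
    assume "r i = 0"
    then have "T (e i) = 0" using Te[OF that] by simp
    then have "\<omega> (e i) y = 0" for y using gT[of "e i" y] by simp
    then have "e i = 0" by (rule nondegenerate)
    then show False using e1[OF that] by simp
  qed
  have T_coeff: "g (T x) (e i) = of_real (r i) * g x (e i)" if "i < dim UNIV" for x i
    by (simp add: self_adjoint Te[OF that] G.h_scale_right)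
  have expand: "x = (\<Sum>i<dim UNIV. sc (g x (e i)) (e i))" for x
    by (rule G.orthonormal_expansion[OF e]) simp
  have \<omega>_expand: "\<i> * \<omega> x y = (\<Sum>i<dim UNIV. of_real (r i) * g x (e i) * g (e i) y)" for x y
    unfolding gT[symmetric]
    using G.parseval[OF e UNIV_I, of "T x" y] by (simp add: T_coeff del: dim_UNIV)
  \<comment> \<open>A predicate on the eigenvalue covers both halves: a span of eigenvectors is
    turned into the vanishing of coordinates.\<close>
  have space_iff: "span {x. \<exists>t::real. R t \<and> T x = sc (of_real t) x}
      = {x. \<forall>i<dim UNIV. \<not> R (r i) \<longrightarrow> g x (e i) = 0}" for R
  proof
    show "span {x. \<exists>t::real. R t \<and> T x = sc (of_real t) x}
      \<subseteq> {x. \<forall>i<dim UNIV. \<not> R (r i) \<longrightarrow> g x (e i) = 0}"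
    proof (rule span_minimal)
      show "subspace {x. \<forall>i<dim UNIV. \<not> R (r i) \<longrightarrow> g x (e i) = 0}"
        by (auto simp: subspace_def G.h_add_left G.h_scale_left)
      show "{x. \<exists>t::real. R t \<and> T x = sc (of_real t) x}
        \<subseteq> {x. \<forall>i<dim UNIV. \<not> R (r i) \<longrightarrow> g x (e i) = 0}"
      proof clarify
        fix x t i
        assume t: "R t" "T x = sc (of_real t) x" and i: "i < dim UNIV" "\<not> R (r i)"
        then have "of_real (t - r i) * g x (e i) = 0"
          using T_coeff[OF i(1), of x] by (simp add: G.h_scale_left algebra_simps)
        then show "g x (e i) = 0" using t(1) i(2) by auto
      qed
    qed
    show "{x. \<forall>i<dim UNIV. \<not> R (r i) \<longrightarrow> g x (e i) = 0}
      \<subseteq> span {x. \<exists>t::real. R t \<and> T x = sc (of_real t) x}"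
    proof
      fix x assume x: "x \<in> {x. \<forall>i<dim UNIV. \<not> R (r i) \<longrightarrow> g x (e i) = 0}"
      have "sc (g x (e i)) (e i) \<in> span {x. \<exists>t::real. R t \<and> T x = sc (of_real t) x}"
        if "i < dim UNIV" for i
      proof (cases "R (r i)")
        case True
        then show ?thesis using Te[OF that] by (intro span_scale span_base) auto
      next
        case False
        then show ?thesis using x that by (simp add: span_zero)
      qed
      then show "x \<in> span {x. \<exists>t::real. R t \<and> T x = sc (of_real t) x}"
        by (subst expand) (intro span_sum, auto)
    qed
  qed
  have P: "plus_space sc \<omega> g = {x. \<forall>i<dim UNIV. \<not> r i < 0 \<longrightarrow> g x (e i) = 0}"
    unfolding plus_space_def space_iff[of "\<lambda>t. t < 0", unfolded T_def, symmetric] ..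
  have Q: "minus_space sc \<omega> g = {x. \<forall>i<dim UNIV. \<not> r i > 0 \<longrightarrow> g x (e i) = 0}"
    unfolding minus_space_def space_iff[of "\<lambda>t. t > 0", unfolded T_def, symmetric] ..
  have sq: "g x (e i) * g (e i) x = of_real ((cmod (g x (e i)))\<^sup>2)" for x i
    using G.hermitian[of "e i" x] by (metis complex_norm_square)
  have Im: "Im (\<omega> x x) = - (\<Sum>i<dim UNIV. r i * (cmod (g x (e i)))\<^sup>2)" for x
  proof -
    have "\<i> * \<omega> x x = of_real (\<Sum>i<dim UNIV. r i * (cmod (g x (e i)))\<^sup>2)"
      unfolding \<omega>_expand by (simp add: mult.assoc sq del: dim_UNIV)
    then have "Re (\<i> * \<omega> x x) = (\<Sum>i<dim UNIV. r i * (cmod (g x (e i)))\<^sup>2)" by (metis Re_complex_of_real)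
    then show ?thesis by simp
  qed
  have nonzero: "\<exists>i<dim UNIV. g x (e i) \<noteq> 0" if "x \<noteq> 0" for x
  proof (rule ccontr)
    assume "\<not> ?thesis"
    then have "(\<Sum>i<dim UNIV. sc (g x (e i)) (e i)) = 0" by (intro sum.neutral) auto
    then show False using that expand[of x] by simp
  qed
  show ?thesis
  proof
    show "sesquilinear sc \<omega>" by (rule sesquilinear_form)
    show "\<omega> x y = - cnj (\<omega> y x)" for x y by (rule skew_hermitian)
    show "subspace (plus_space sc \<omega> g)" "subspace (minus_space sc \<omega> g)"
      by (simp_all add: plus_space_def minus_space_def)
    show "\<omega> p q = 0" if "p \<in> plus_space sc \<omega> g" "q \<in> minus_space sc \<omega> g" for p q
    proof -
      have "of_real (r i) * g p (e i) * g (e i) q = 0" if "i < dim UNIV" for i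
        using \<open>p \<in> _\<close> \<open>q \<in> _\<close> that G.hermitian[of "e i" q] unfolding P Q by (cases "r i < 0") auto
      then have "\<i> * \<omega> p q = 0" unfolding \<omega>_expand by (intro sum.neutral) auto
      then show ?thesis by simp
    qed
    show "\<exists>q\<in>minus_space sc \<omega> g. \<exists>p\<in>plus_space sc \<omega> g. x = q + p" for x
    proof (intro bexI)
      let ?I = "{i. i < dim UNIV \<and> r i > 0}" and ?J = "{i. i < dim UNIV \<and> r i < 0}"
      have I: "?I \<subseteq> {..<dim UNIV}" and J: "?J \<subseteq> {..<dim UNIV}" by auto
      have IJ: "{..<dim UNIV} = ?I \<union> ?J" using r0 by (auto simp del: dim_UNIV simp: neq_iff)
      have split: "(\<Sum>i<dim UNIV. sc (g x (e i)) (e i))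
        = (\<Sum>i\<in>?I. sc (g x (e i)) (e i)) + (\<Sum>i\<in>?J. sc (g x (e i)) (e i))"
        unfolding IJ by (rule sum.union_disjoint) auto
      show "x = (\<Sum>i\<in>?I. sc (g x (e i)) (e i)) + (\<Sum>i\<in>?J. sc (g x (e i)) (e i))"
        by (rule trans[OF expand split])
      show "(\<Sum>i\<in>?I. sc (g x (e i)) (e i)) \<in> minus_space sc \<omega> g"
        unfolding Q using G.h_sum_orthonormal[OF e I] by (auto simp del: dim_UNIV)
      show "(\<Sum>i\<in>?J. sc (g x (e i)) (e i)) \<in> plus_space sc \<omega> g"
        unfolding P using G.h_sum_orthonormal[OF e J] by (auto simp del: dim_UNIV)
    qed
    show "0 < Im (\<omega> p p)" if p: "p \<in> plus_space sc \<omega> g" "p \<noteq> 0" for p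
    proof -
      obtain j where j: "j < dim UNIV" "g p (e j) \<noteq> 0" using nonzero[OF p(2)] by blast
      then have "r j < 0" using p(1) unfolding P by blast
      have "0 < (\<Sum>i<dim UNIV. - (r i * (cmod (g p (e i)))\<^sup>2))"
      proof (rule sum_pos2[of _ j])
        show "0 < - (r j * (cmod (g p (e j)))\<^sup>2)"
          using j \<open>r j < 0\<close> by (simp add: mult_less_0_iff)
        show "0 \<le> - (r i * (cmod (g p (e i)))\<^sup>2)" if "i \<in> {..<dim UNIV}" for i
          using p(1) that unfolding P by (cases "r i < 0") (auto simp: mult_le_0_iff)
      qed (use j in auto)
      then show ?thesis unfolding Im by (simp add: sum_negf)
    qed
    show "Im (\<omega> q q) < 0" if q: "q \<in> minus_space sc \<omega> g" "q \<noteq> 0" for q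
    proof -
      obtain j where j: "j < dim UNIV" "g q (e j) \<noteq> 0" using nonzero[OF q(2)] by blast
      then have "r j > 0" using q(1) unfolding Q by blast
      have "0 < (\<Sum>i<dim UNIV. r i * (cmod (g q (e i)))\<^sup>2)"
      proof (rule sum_pos2[of _ j])
        show "0 < r j * (cmod (g q (e j)))\<^sup>2"
          using j \<open>r j > 0\<close> by simp
        show "0 \<le> r i * (cmod (g q (e i)))\<^sup>2" if "i \<in> {..<dim UNIV}" for i
          using q(1) that unfolding Q by (cases "r i > 0") auto
      qed (use j in auto)
      then show ?thesis unfolding Im by simp
    qed
  qed
qed

end

section \<open>The Maslov index in terms of determinants and defects\<close>

locale maslov_space = polarized_space sc Basis \<Omega> "plus_space sc \<Omega> g" "minus_space sc \<Omega> g"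
  for sc :: "complex \<Rightarrow> 'a::ab_group_add \<Rightarrow> 'a" and Basis \<Omega> g
begin

abbreviation rel :: "'a set \<Rightarrow> 'a set \<Rightarrow> 'a \<Rightarrow> 'a"
  where "rel \<equiv> relative_map (plus_space sc \<Omega> g) (minus_space sc \<Omega> g)"

lemma relative_operator_eq: "relative_operator sc \<Omega> g = rel"
proof -
  have *: "lagrangian_operator sc \<Omega> g = graph_map (plus_space sc \<Omega> g)"
    by (simp add: fun_eq_iff lagrangian_operator_def graph_map_def)
  show ?thesis by (intro ext) (simp add: relative_operator_def relative_map_def *)
qed

lemma det_rel_argument:
  fixes K :: "'p::real_normed_vector set"
  assumes "lagrangian_family sc \<Omega> K \<Lambda>" "lagrangian_family sc \<Omega> K \<mu>" "convex K"
  obtains \<delta> where "continuous_on K \<delta>" "\<And>p. p \<in> K \<Longrightarrow> det_on (rel (\<Lambda> p) (\<mu> p)) = cis (\<delta> p)"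
proof -
  have path: "operator_path K (\<lambda>p. rel (\<Lambda> p) (\<mu> p))"
    by (rule operator_path_relative_map[OF assms(1,2)])
  then have "continuous_on K (\<lambda>p. det_on (rel (\<Lambda> p) (\<mu> p)))"
    by (intro continuous_on_det_on) (auto simp: operator_path_def)
  moreover have "cmod (det_on (rel (\<Lambda> p) (\<mu> p))) = 1" if "p \<in> K" for p
    using path that by (simp add: det_on_unitary operator_path_def)
  ultimately obtain \<delta> where "continuous_on K \<delta>" "\<And>p. p \<in> K \<Longrightarrow> det_on (rel (\<Lambda> p) (\<mu> p)) = cis (\<delta> p)"
    using continuous_argument[OF _ assms(3)] by blast
  then show ?thesis by (rule that)
qed

text \<open>The choice operator in \<open>maslov_index\<close> returns genuine eigenangles because
  some exist. Nothing further about them is used, since \<open>sum_ceiling_eigenangles\<close>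
  applies to every admissible choice.\<close>

lemma maslov_index_eq:
  assumes fam: "lagrangian_family sc \<Omega> {a..b} \<Lambda>" "lagrangian_family sc \<Omega> {a..b} \<mu>" and ab: "a \<le> b"
    and \<delta>: "continuous_on {a..b} \<delta>" "\<And>t. t \<in> {a..b} \<Longrightarrow> det_on (rel (\<Lambda> t) (\<mu> t)) = cis (\<delta> t)"
  shows "real_of_int (maslov_index sc \<Omega> g a b \<Lambda> \<mu>)
    = (\<delta> b - \<delta> a) / (2 * pi) + defect (rel (\<Lambda> b) (\<mu> b)) - defect (rel (\<Lambda> a) (\<mu> a))"
proof -
  have path: "operator_path {a..b} (\<lambda>t. rel (\<Lambda> t) (\<mu> t))"
    by (rule operator_path_relative_map[OF fam])
  have "lagrangian sc \<Omega> (\<Lambda> a)" using fam(1) ab by (simp add: lagrangian_family_def)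
  \<comment> \<open>The existence of one Lagrangian subspace forces both halves to have its
    dimension, so the number of angles in the index is the dimension of the positive half.\<close>
  then have N: "dim (UNIV :: 'a set) div 2 = dim (plus_space sc \<Omega> g)"
    using dim_UNIV_if_lagrangian by (simp del: dim_UNIV)
  have angles_iff: "eigenangles sc \<Omega> g (dim (plus_space sc \<Omega> g)) a b \<Lambda> \<mu> \<theta> \<longleftrightarrow>
    (\<forall>j<dim (plus_space sc \<Omega> g). continuous_on {a..b} (\<theta> j)) \<and>
    (\<forall>t\<in>{a..b}. has_spectrum (rel (\<Lambda> t) (\<mu> t)) (\<lambda>j. cis (\<theta> j t)))" for \<theta>
    unfolding eigenangles_def relative_operator_eq has_spectrum_def eigenspace_def ..
  define \<theta> where "\<theta> = (SOME \<theta>. eigenangles sc \<Omega> g (dim (plus_space sc \<Omega> g)) a b \<Lambda> \<mu> \<theta>)"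
  have "\<exists>\<theta>. eigenangles sc \<Omega> g (dim (plus_space sc \<Omega> g)) a b \<Lambda> \<mu> \<theta>"
    unfolding angles_iff by (rule continuous_eigenangles_exist[OF path compact_Icc \<delta>])
  then have "eigenangles sc \<Omega> g (dim (plus_space sc \<Omega> g)) a b \<Lambda> \<mu> \<theta>"
    unfolding \<theta>_def by (rule someI_ex)
  then have \<theta>: "\<And>j. j < dim (plus_space sc \<Omega> g) \<Longrightarrow> continuous_on {a..b} (\<theta> j)"
    "\<And>t. t \<in> {a..b} \<Longrightarrow> has_spectrum (rel (\<Lambda> t) (\<mu> t)) (\<lambda>j. cis (\<theta> j t))"
    unfolding angles_iff by auto
  show ?thesis
    unfolding maslov_index_def N Let_def \<theta>_def[symmetric]
    by (rule sum_ceiling_eigenangles[OF path ab \<delta> \<theta>])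
qed

lemma argument_change_if_constant_dim:
  fixes a b :: real
  assumes fam: "lagrangian_family sc \<Omega> {a..b} \<Lambda>" "lagrangian_family sc \<Omega> {a..b} \<mu>" and ab: "a \<le> b"
    and \<delta>: "continuous_on {a..b} \<delta>" "\<And>t. t \<in> {a..b} \<Longrightarrow> det_on (rel (\<Lambda> t) (\<mu> t)) = cis (\<delta> t)"
    and const: "\<And>t. t \<in> {a..b} \<Longrightarrow> dim (\<Lambda> t \<inter> \<mu> t) = d"
  shows "(\<delta> b - \<delta> a) / (2 * pi) = defect (rel (\<Lambda> a) (\<mu> a)) - defect (rel (\<Lambda> b) (\<mu> b))"
proof (rule defect_if_constant_multiplicity[OF operator_path_relative_map[OF fam] ab \<delta>])
  fix t assume t: "t \<in> {a..b}"
  then have "lagrangian sc \<Omega> (\<Lambda> t)" "lagrangian sc \<Omega> (\<mu> t)" using fam by (auto simp: lagrangian_family_def)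
  then show "dim (eigenspace (rel (\<Lambda> t) (\<mu> t)) 1) = d"
    using const[OF t] by (simp add: dim_eigenspace_relative_map)
qed

end

section \<open>Families of graphs, images and products of Lagrangian subspaces\<close>

lemma lagrangian_family_compose:
  assumes "lagrangian_family sc \<Omega> K L" "continuous_on K' \<phi>" "\<phi> ` K' \<subseteq> K"
  shows "lagrangian_family sc \<Omega> K' (\<lambda>p. L (\<phi> p))"
proof -
  obtain \<Phi> where \<Phi>: "\<And>p. p \<in> K \<Longrightarrow> L p = (\<lambda>f. f p) ` \<Phi>"
    "\<And>f x. f \<in> \<Phi> \<Longrightarrow> continuous_on K (\<lambda>p. \<Omega> x (f p))"
    using assms(1) by (auto simp: lagrangian_family_def)
  have "\<forall>p\<in>K'. L (\<phi> p) = (\<lambda>f. f p) ` (\<lambda>f. f \<circ> \<phi>) ` \<Phi>"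
    using \<Phi>(1) assms(3) by (force simp: image_image)
  moreover have "\<forall>f\<in>(\<lambda>f. f \<circ> \<phi>) ` \<Phi>. \<forall>x. continuous_on K' (\<lambda>p. \<Omega> x (f p))"
    using continuous_on_compose2[OF \<Phi>(2) assms(2,3)] by auto
  moreover have "\<forall>p\<in>K'. lagrangian sc \<Omega> (L (\<phi> p))"
    using assms(1,3) by (auto simp: lagrangian_family_def)
  ultimately show ?thesis unfolding lagrangian_family_def by blast
qed

lemma lagrangian_family_const:
  assumes "lagrangian sc \<Omega> W"
  shows "lagrangian_family sc \<Omega> K (\<lambda>_. W)"
  unfolding lagrangian_family_def using assms
  by (auto intro!: exI[of _ "(\<lambda>w _. w) ` W"] simp: image_image)

context complex_symplectic_space
begin

lemma \<omega>_add_left: "\<omega> (x + y) z = \<omega> x z + \<omega> y z"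
  and \<omega>_add_right: "\<omega> x (y + z) = \<omega> x y + \<omega> x z"
  and \<omega>_scale_left: "\<omega> (sc c x) y = c * \<omega> x y"
  and \<omega>_scale_right: "\<omega> x (sc c y) = cnj c * \<omega> x y"
  using sesquilinear_form by (auto simp: sesquilinear_def)

lemma \<omega>_zero [simp]: "\<omega> 0 y = 0" "\<omega> x 0 = 0"
  using \<omega>_scale_left[of 0 0 y] \<omega>_scale_right[of x 0 0] by simp_all

lemma \<omega>_diff_left: "\<omega> (x - y) z = \<omega> x z - \<omega> y z"
  using \<omega>_add_left[of "x - y" y z] by simp

sublocale prod: finite_dimensional_vector_space_prod sc sc Basis Basis ..

lemma prod_scale_eq: "prod_scale sc c (x, y) = (sc c x, sc c y)"
  by (rule prod.scale_prod)

lemma prod_symplectic: "complex_symplectic_space (prod_scale sc) prod.Basis_pair (neg_plus_form \<omega>)"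
proof
  show "sesquilinear (prod_scale sc) (neg_plus_form \<omega>)"
    unfolding sesquilinear_def neg_plus_form_def
    by (auto simp: prod_scale_eq \<omega>_add_left \<omega>_add_right \<omega>_scale_left \<omega>_scale_right algebra_simps)
  show "neg_plus_form \<omega> x y = - cnj (neg_plus_form \<omega> y x)" for x y
    using skew_hermitian[of "fst x" "fst y"] skew_hermitian[of "snd x" "snd y"]
    by (simp add: neg_plus_form_def)
  show "x = 0" if x: "\<And>y. neg_plus_form \<omega> x y = 0" for x
  proof -
    have "\<omega> (fst x) u = 0" for u using x[of "(u, 0)"] by (simp add: neg_plus_form_def)
    moreover have "\<omega> (snd x) u = 0" for u using x[of "(0, u)"] by (simp add: neg_plus_form_def)
    ultimately show "x = 0" using nondegenerate by (simp add: prod_eq_iff)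
  qed
qed

lemma symplectic_groupD:
  assumes "A \<in> symplectic_group sc \<omega>"
  shows "Vector_Spaces.linear sc sc A" "bij A" "\<omega> (A x) (A y) = \<omega> x y" "\<omega> x (inv_into UNIV A y) = \<omega> (A x) y"
    "A (x + y) = A x + A y" "A (sc c x) = sc c (A x)"
proof -
  show lin: "Vector_Spaces.linear sc sc A" and bij: "bij A"
    and \<omega>: "\<omega> (A x) (A y) = \<omega> x y" for x y
    using assms by (auto simp: symplectic_group_def)
  show "\<omega> x (inv_into UNIV A y) = \<omega> (A x) y"
    using \<omega>[of x "inv_into UNIV A y"] bij by (simp add: bij_is_surj surj_f_inv_f)
  show "A (x + y) = A x + A y" "A (sc c x) = sc c (A x)"
    using lin by (simp_all add: Vector_Spaces.linear_iff)
qed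

lemma symplectic_group_compose:
  assumes A: "A \<in> symplectic_group sc \<omega>" and B: "B \<in> symplectic_group sc \<omega>"
  shows "A \<circ> B \<in> symplectic_group sc \<omega>"
  using symplectic_groupD[OF A] symplectic_groupD[OF B]
  by (auto simp: symplectic_group_def bij_comp intro: Vector_Spaces.linear_compose)

lemma symplectic_group_inv:
  assumes A: "A \<in> symplectic_group sc \<omega>"
  shows "inv_into UNIV A \<in> symplectic_group sc \<omega>"
proof -
  note * = symplectic_groupD[OF A]
  have AI: "A (inv_into UNIV A x) = x" for x using *(2) by (simp add: bij_is_surj surj_f_inv_f)
  have inj: "A x = A y \<Longrightarrow> x = y" for x y using *(2) by (simp add: bij_is_inj inj_eq)
  have "inv_into UNIV A (x + y) = inv_into UNIV A x + inv_into UNIV A y" for x y by (rule inj) (simp add: AI *(5))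
  moreover have "inv_into UNIV A (sc c x) = sc c (inv_into UNIV A x)" for c x by (rule inj) (simp add: AI *(6))
  moreover have "\<omega> (inv_into UNIV A x) (inv_into UNIV A y) = \<omega> x y" for x y using *(3)[of "inv_into UNIV A x" "inv_into UNIV A y"] by (simp add: AI)
  ultimately show ?thesis
    using *(1,2) by (simp add: symplectic_group_def bij_imp_bij_inv Vector_Spaces.linear_iff)
qed

lemma lagrangian_image:
  assumes A: "A \<in> symplectic_group sc \<omega>" and L: "lagrangian sc \<omega> L"
  shows "lagrangian sc \<omega> (A ` L)"
proof -
  note * = symplectic_groupD[OF A]
  interpret A: Vector_Spaces.linear sc sc A by (rule *(1))
  have sub: "subspace L" and ann: "annihilator \<omega> L = L" using L by (auto simp: lagrangian_def)
  have "annihilator \<omega> (A ` L) = A ` L"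
  proof (intro Set.set_eqI iffI)
    fix x assume x: "x \<in> annihilator \<omega> (A ` L)"
    obtain y where y: "x = A y" using *(2) by (metis bij_is_surj surjD)
    have "y \<in> annihilator \<omega> L" using x *(3) by (auto simp: annihilator_def y)
    then show "x \<in> A ` L" using ann y by simp
  next
    fix x assume "x \<in> A ` L"
    then obtain y where y: "y \<in> L" "x = A y" by blast
    then have "\<omega> y z = 0" if "z \<in> L" for z using ann that by (auto simp: annihilator_def)
    then show "x \<in> annihilator \<omega> (A ` L)" using *(3) y by (auto simp: annihilator_def)
  qed
  then show ?thesis using A.subspace_image[OF sub] by (simp add: lagrangian_def)
qed

lemma lagrangian_Times:
  assumes A: "lagrangian sc \<omega> A" and B: "lagrangian sc \<omega> B"
  shows "lagrangian (prod_scale sc) (neg_plus_form \<omega>) (A \<times> B)"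
proof -
  have sub: "subspace A" "subspace B" and ann: "annihilator \<omega> A = A" "annihilator \<omega> B = B"
    using A B by (auto simp: lagrangian_def)
  have "annihilator (neg_plus_form \<omega>) (A \<times> B) = A \<times> B"
  proof (intro Set.set_eqI iffI)
    fix x assume x: "x \<in> annihilator (neg_plus_form \<omega>) (A \<times> B)"
    have "\<omega> (fst x) a = 0" if "a \<in> A" for a
      using x that subspace_0[OF sub(2)]
      by (force simp: annihilator_def neg_plus_form_def dest: bspec[of _ _ "(a, 0)"])
    moreover have "\<omega> (snd x) b = 0" if "b \<in> B" for b
      using x that subspace_0[OF sub(1)]
      by (force simp: annihilator_def neg_plus_form_def dest: bspec[of _ _ "(0, b)"])
    ultimately have "fst x \<in> annihilator \<omega> A" "snd x \<in> annihilator \<omega> B" by (auto simp: annihilator_def)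
    then show "x \<in> A \<times> B" using ann by (simp add: mem_Times_iff)
  next
    fix x assume "x \<in> A \<times> B"
    then have "fst x \<in> annihilator \<omega> A" "snd x \<in> annihilator \<omega> B" using ann by auto
    then show "x \<in> annihilator (neg_plus_form \<omega>) (A \<times> B)"
      by (auto simp: annihilator_def neg_plus_form_def)
  qed
  then show ?thesis using prod.subspace_Times[OF sub] by (simp add: lagrangian_def)
qed

lemma lagrangian_graph:
  assumes A: "A \<in> symplectic_group sc \<omega>"
  shows "lagrangian (prod_scale sc) (neg_plus_form \<omega>) (graph_of A)"
proof -
  note * = symplectic_groupD[OF A]
  have A0: "A 0 = 0" using *(6)[of 0 0] by simp
  have "annihilator (neg_plus_form \<omega>) (graph_of A) = graph_of A"
  proof (intro Set.set_eqI iffI)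
    fix x assume x: "x \<in> annihilator (neg_plus_form \<omega>) (graph_of A)"
    have "\<omega> (snd x - A (fst x)) (A u) = 0" for u
      using x *(3)[of "fst x" u] by (auto simp: annihilator_def neg_plus_form_def graph_of_def \<omega>_diff_left)
    then have "\<omega> (snd x - A (fst x)) y = 0" for y using *(2) by (metis bij_is_surj surjD)
    then have "snd x - A (fst x) = 0" by (rule nondegenerate)
    then show "x \<in> graph_of A" by (auto simp: graph_of_def prod_eq_iff)
  qed (auto simp: annihilator_def neg_plus_form_def graph_of_def *(3))
  moreover have "prod.p.subspace (graph_of A)"
    unfolding prod.p.subspace_def graph_of_def
    by (auto simp: prod_scale_eq zero_prod_def A0 *(5,6))
  ultimately show ?thesis by (simp add: lagrangian_def)
qed

lemma linear_\<omega>_left: "Vector_Spaces.linear sc (*) (\<lambda>x. \<omega> x y)"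
  using vector_space_axioms vector_space_over_itself.vector_space_axioms
  by (simp add: Vector_Spaces.linear_iff \<omega>_add_left \<omega>_scale_left)

lemma continuous_on_\<omega>_path:
  assumes "continuous_operator_path sc T \<gamma>"
  shows "continuous_on T (\<lambda>t. \<omega> (\<gamma> t x) y)" "continuous_on T (\<lambda>t. \<omega> y (\<gamma> t x))"
proof -
  show 1: "continuous_on T (\<lambda>t. \<omega> (\<gamma> t x) y)"
    using assms linear_\<omega>_left unfolding continuous_operator_path_def by blast
  have "continuous_on T (\<lambda>t. - cnj (\<omega> (\<gamma> t x) y))" by (intro continuous_intros 1)
  also have "(\<lambda>t. - cnj (\<omega> (\<gamma> t x) y)) = (\<lambda>t. \<omega> y (\<gamma> t x))"
    using skew_hermitian[of y] by (auto simp: fun_eq_iff)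
  finally show "continuous_on T (\<lambda>t. \<omega> y (\<gamma> t x))" .
qed

lemma lagrangian_family_graph_compose:
  assumes \<gamma>1: "\<gamma>1 \<in> symplectic_paths sc \<omega> \<tau>1" and \<gamma>2: "\<gamma>2 \<in> symplectic_paths sc \<omega> \<tau>2"
  shows "lagrangian_family (prod_scale sc) (neg_plus_form \<omega>) ({0..\<tau>1} \<times> {0..\<tau>2})
    (\<lambda>p. graph_of (\<gamma>2 (snd p) \<circ> \<gamma>1 (fst p)))"
proof -
  let ?K = "{0..\<tau>1} \<times> {0..\<tau>2}"
  \<comment> \<open>Continuity in each variable becomes joint continuity by expanding \<gamma>1(s) u
    in the fixed basis: every term is a product of a function of \<open>s\<close> and a function of
    \<open>t\<close>.\<close>
  have cont: "continuous_on ?K (\<lambda>p. \<omega> x (\<gamma>2 (snd p) (\<gamma>1 (fst p) u)))" for x u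
  proof -
    let ?c = "\<lambda>b v. representation Basis v b"
    have lin: "Vector_Spaces.linear sc (*) (?c b)" for b
      using vector_space_axioms vector_space_over_itself.vector_space_axioms
      by (simp add: Vector_Spaces.linear_iff representation_add[OF independent_Basis]
          representation_scale[OF independent_Basis] span_Basis)
    have "continuous_on {0..\<tau>1} (\<lambda>s. ?c b (\<gamma>1 s u))" for b
      using \<gamma>1 lin unfolding symplectic_paths_def continuous_operator_path_def by blast
    then have c: "continuous_on ?K (\<lambda>p. ?c b (\<gamma>1 (fst p) u))" for b
      by (rule continuous_on_compose2) (auto intro!: continuous_intros)
    have "continuous_on {0..\<tau>2} (\<lambda>t. \<omega> x (\<gamma>2 t b))" for b
      using \<gamma>2 continuous_on_\<omega>_path(2) by (simp add: symplectic_paths_def)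
    then have d: "continuous_on ?K (\<lambda>p. \<omega> x (\<gamma>2 (snd p) b))" for b
      by (rule continuous_on_compose2) (auto intro!: continuous_intros)
    have "continuous_on ?K (\<lambda>p. \<Sum>b\<in>Basis. cnj (?c b (\<gamma>1 (fst p) u)) * \<omega> x (\<gamma>2 (snd p) b))"
      by (intro continuous_intros c d)
    moreover have "(\<Sum>b\<in>Basis. cnj (?c b (\<gamma>1 (fst p) u)) * \<omega> x (\<gamma>2 (snd p) b))
      = \<omega> x (\<gamma>2 (snd p) (\<gamma>1 (fst p) u))" if "p \<in> ?K" for p
    proof -
      have "\<gamma>2 (snd p) \<in> symplectic_group sc \<omega>" using \<gamma>2 that by (auto simp: symplectic_paths_def)
      then interpret G: Vector_Spaces.linear sc sc "\<gamma>2 (snd p)" by (rule symplectic_groupD)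
      have sum_right: "\<omega> x (\<Sum>b\<in>I. f b) = (\<Sum>b\<in>I. \<omega> x (f b))" for f and I :: "'a set"
        by (induction I rule: infinite_finite_induct) (auto simp: \<omega>_add_right)
      have "\<gamma>1 (fst p) u = (\<Sum>b\<in>Basis. sc (?c b (\<gamma>1 (fst p) u)) b)"
        by (rule sum_representation_eq[symmetric]) (auto simp: independent_Basis span_Basis finite_Basis)
      then have "\<gamma>2 (snd p) (\<gamma>1 (fst p) u) = (\<Sum>b\<in>Basis. sc (?c b (\<gamma>1 (fst p) u)) (\<gamma>2 (snd p) b))"
        by (metis (no_types, lifting) G.sum G.scale sum.cong)
      then show ?thesis by (simp add: sum_right \<omega>_scale_right)
    qed
    ultimately show ?thesis by (rule continuous_on_eq)
  qed
  have "graph_of (\<gamma>2 (snd p) \<circ> \<gamma>1 (fst p)) = (\<lambda>f. f p) ` range (\<lambda>u p. (u, \<gamma>2 (snd p) (\<gamma>1 (fst p) u)))" for p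
    by (auto simp: graph_of_def)
  moreover have "\<forall>f\<in>range (\<lambda>u p. (u, \<gamma>2 (snd p) (\<gamma>1 (fst p) u))).
      \<forall>x. continuous_on ?K (\<lambda>p. neg_plus_form \<omega> x (f p))"
    unfolding neg_plus_form_def by (auto intro!: continuous_intros cont)
  moreover have "lagrangian (prod_scale sc) (neg_plus_form \<omega>) (graph_of (\<gamma>2 (snd p) \<circ> \<gamma>1 (fst p)))"
    if "p \<in> ?K" for p
    using \<gamma>1 \<gamma>2 that
    by (intro lagrangian_graph symplectic_group_compose) (auto simp: symplectic_paths_def)
  ultimately show ?thesis unfolding lagrangian_family_def by (intro conjI ballI exI) auto
qed

text \<open>Invariance of \<omega> moves the inverse to the other argument, so continuity of the
  inverse operators is continuity of \<gamma> itself.\<close>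

lemma lagrangian_family_inv_image:
  assumes \<gamma>: "\<gamma> \<in> symplectic_paths sc \<omega> \<tau>" and A: "lagrangian sc \<omega> A" and B: "lagrangian sc \<omega> B"
  shows "lagrangian_family (prod_scale sc) (neg_plus_form \<omega>) {0..\<tau>} (\<lambda>s. (inv_into UNIV (\<gamma> s) ` A) \<times> B)"
proof -
  have sp: "\<gamma> s \<in> symplectic_group sc \<omega>" if "s \<in> {0..\<tau>}" for s using \<gamma> that by (simp add: symplectic_paths_def)
  have cont: "continuous_on {0..\<tau>} (\<lambda>s. \<omega> x (inv_into UNIV (\<gamma> s) a))" for x a
  proof -
    have "continuous_on {0..\<tau>} (\<lambda>s. \<omega> (\<gamma> s x) a)"
      using \<gamma> continuous_on_\<omega>_path(1) by (simp add: symplectic_paths_def)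
    then show ?thesis by (rule continuous_on_eq) (simp add: symplectic_groupD(4)[OF sp])
  qed
  let ?\<Phi> = "(\<lambda>(a, b) s. (inv_into UNIV (\<gamma> s) a, b)) ` (A \<times> B)"
  have "(inv_into UNIV (\<gamma> s) ` A) \<times> B = (\<lambda>f. f s) ` ?\<Phi>" for s
    by (force simp: image_image)
  moreover have "\<forall>f\<in>?\<Phi>. \<forall>x. continuous_on {0..\<tau>} (\<lambda>s. neg_plus_form \<omega> x (f s))"
    unfolding neg_plus_form_def by (auto intro!: continuous_intros cont)
  moreover have "lagrangian (prod_scale sc) (neg_plus_form \<omega>) ((inv_into UNIV (\<gamma> s) ` A) \<times> B)" if "s \<in> {0..\<tau>}" for s
    by (intro lagrangian_Times lagrangian_image symplectic_group_inv sp that A B)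
  ultimately show ?thesis unfolding lagrangian_family_def by blast
qed

text \<open>Applying \<open>A\<close> to the first coordinate carries one intersection bijectively
  onto the other. The right side is free of \<open>A\<close>, which gives constancy along
  \<open>s\<close> in the rectangle.\<close>

lemma dim_graph_compose_Int:
  assumes A: "A \<in> symplectic_group sc \<omega>" and B: "B \<in> symplectic_group sc \<omega>"
    and C: "subspace C" and D: "subspace D"
  shows "prod.p.dim (graph_of (B \<circ> A) \<inter> ((inv_into UNIV A ` C) \<times> D)) = prod.p.dim (graph_of B \<inter> (C \<times> D))"
proof -
  note a = symplectic_groupD[OF A]
  have AI: "A (inv_into UNIV A x) = x" for x using a(2) by (simp add: bij_is_surj surj_f_inv_f)
  define T where "T p = (A (fst p), snd p)" for p :: "'a \<times> 'a"
  have T: "Vector_Spaces.linear (prod_scale sc) (prod_scale sc) T"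
    using prod.p.vector_space_axioms
    by (auto simp: Vector_Spaces.linear_iff T_def prod_scale_eq a(5,6))
  have inj: "inj T" using bij_is_inj[OF a(2)] by (auto simp: inj_on_def T_def)
  interpret pair: finite_dimensional_vector_space_pair_1 "prod_scale sc" prod.Basis_pair "prod_scale sc" ..
  have "T ` (graph_of (B \<circ> A) \<inter> ((inv_into UNIV A ` C) \<times> D)) = graph_of B \<inter> (C \<times> D)"
  proof (intro Set.set_eqI iffI)
    fix p assume "p \<in> T ` (graph_of (B \<circ> A) \<inter> ((inv_into UNIV A ` C) \<times> D))"
    then show "p \<in> graph_of B \<inter> (C \<times> D)" by (auto simp: T_def graph_of_def AI)
  next
    fix p assume "p \<in> graph_of B \<inter> (C \<times> D)"
    then have "p = T (inv_into UNIV A (fst p), snd p)" "(inv_into UNIV A (fst p), snd p) \<in> graph_of (B \<circ> A) \<inter> ((inv_into UNIV A ` C) \<times> D)"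
      by (auto simp: T_def graph_of_def AI)
    then show "p \<in> T ` (graph_of (B \<circ> A) \<inter> ((inv_into UNIV A ` C) \<times> D))" by blast
  qed
  then show ?thesis
    using pair.dim_image_eq[OF T inj_on_subset[OF inj subset_UNIV],
        of "graph_of (B \<circ> A) \<inter> ((inv_into UNIV A ` C) \<times> D)"] by simp
qed

end

section \<open>The rectangle argument\<close>

theorem theorem4p11:
  fixes sc :: "complex \<Rightarrow> 'v::ab_group_add \<Rightarrow> 'v"
    and Basis :: "'v set"
    and \<omega> :: "'v \<Rightarrow> 'v \<Rightarrow> complex"
    and g :: "'v \<times> 'v \<Rightarrow> 'v \<times> 'v \<Rightarrow> complex"
    and n :: nat
    and \<alpha> \<alpha>1 \<alpha>2 :: "'v set"
    and \<gamma>1 \<gamma>2 :: "real \<Rightarrow> 'v \<Rightarrow> 'v"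
    and \<tau>1 \<tau>2 :: real
  assumes "complex_symplectic_space sc Basis \<omega>"
    and "vector_space.dim sc (UNIV :: 'v set) = 2 * n"
    and "inner_product (prod_scale sc) g"
    and "lagrangian sc \<omega> \<alpha>1" and "lagrangian sc \<omega> \<alpha>2"
    and "direct_sum_decomposition \<alpha>1 \<alpha>2"
    and "lagrangian sc \<omega> \<alpha>"
    and "0 \<le> \<tau>1" and "0 \<le> \<tau>2"
    and "\<gamma>1 \<in> symplectic_paths sc \<omega> \<tau>1" and "\<gamma>2 \<in> symplectic_paths sc \<omega> \<tau>2"
  defines "M1 \<equiv> \<gamma>1 \<tau>1" and "M2 \<equiv> \<gamma>2 \<tau>2"
  shows "maslov_type_index sc \<omega> g (\<alpha> \<times> \<alpha>1) (\<tau>1 + \<tau>2) (path_iteration \<tau>1 \<gamma>1 \<gamma>2)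
      - maslov_type_index sc \<omega> g (\<alpha> \<times> \<alpha>1) \<tau>1 \<gamma>1
      - maslov_type_index sc \<omega> g (\<alpha>1 \<times> \<alpha>1) \<tau>2 \<gamma>2
    \<ge> int (quotient_dim (prod_scale sc)
          (graph_of M2 \<inter> (\<alpha>1 \<times> \<alpha>1))
          (graph_of M2 \<inter> ((\<alpha>1 \<inter> M1 ` \<alpha>) \<times> \<alpha>1)))
      + int (vector_space.dim sc (M1 ` \<alpha> \<inter> \<alpha>1)) - int n"
proof -
  interpret V: complex_symplectic_space sc Basis \<omega> by fact
  interpret X: complex_symplectic_space "prod_scale sc" V.prod.Basis_pair "neg_plus_form \<omega>"
    by (rule V.prod_symplectic)
  interpret M: maslov_space "prod_scale sc" V.prod.Basis_pair "neg_plus_form \<omega>" g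
    unfolding maslov_space_def by (rule X.polarization) fact
  note \<alpha>1 = \<open>lagrangian sc \<omega> \<alpha>1\<close> and \<alpha> = \<open>lagrangian sc \<omega> \<alpha>\<close>
  note \<tau> = \<open>0 \<le> \<tau>1\<close> \<open>0 \<le> \<tau>2\<close> and \<gamma>1 = \<open>\<gamma>1 \<in> symplectic_paths sc \<omega> \<tau>1\<close> and \<gamma>2 = \<open>\<gamma>2 \<in> symplectic_paths sc \<omega> \<tau>2\<close>
  have sp: "s \<in> {0..\<tau>1} \<Longrightarrow> \<gamma>1 s \<in> symplectic_group sc \<omega>" "t \<in> {0..\<tau>2} \<Longrightarrow> \<gamma>2 t \<in> symplectic_group sc \<omega>"
    and \<gamma>0: "\<gamma>1 0 = id" "\<gamma>2 0 = id" for s t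
    using \<gamma>1 \<gamma>2 by (auto simp: symplectic_paths_def)
  have M1: "M1 \<in> symplectic_group sc \<omega>" and M2: "M2 \<in> symplectic_group sc \<omega>"
    unfolding M1_def M2_def using sp \<tau> by auto
  define \<beta> where "\<beta> = M1 ` \<alpha>"
  have \<beta>: "lagrangian sc \<omega> \<beta>" unfolding \<beta>_def by (rule V.lagrangian_image[OF M1 \<alpha>])
  \<comment> \<open>From here on \<open>K\<close> is the rectangle of parameters; the Lagrangian
    subspace that the overview calls K is \<open>W'\<close>.\<close>
  define K where "K = {0..\<tau>1} \<times> {0..\<tau>2}"
  define G where "G p = graph_of (\<gamma>2 (snd p) \<circ> \<gamma>1 (fst p))" for p
  \<comment> \<open>The first factor undoes \<gamma>1(s), so \<open>R s\<close> keeps pace with the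
    graphs \<open>G (s, t)\<close>. It joins \<open>W'\<close> at \<open>s = 0\<close> to \<alpha>
    \<times> \<alpha>1 at \<open>s = \<tau>1\<close>.\<close>
  define R where "R s = (inv_into UNIV (\<gamma>1 s) ` \<beta>) \<times> \<alpha>1" for s
  define W where "W = \<alpha>1 \<times> \<alpha>1"
  define W' where "W' = \<beta> \<times> \<alpha>1"
  let ?lagr = "lagrangian (prod_scale sc) (neg_plus_form \<omega>)"
  let ?fam = "lagrangian_family (prod_scale sc) (neg_plus_form \<omega>)"
  have W: "?lagr W" and W': "?lagr W'"
    unfolding W_def W'_def by (intro V.lagrangian_Times \<alpha>1 \<beta>)+
  have G: "?fam K G" unfolding K_def G_def by (rule V.lagrangian_family_graph_compose[OF \<gamma>1 \<gamma>2])
  have R: "?fam {0..\<tau>1} R" unfolding R_def by (rule V.lagrangian_family_inv_image[OF \<gamma>1 \<beta> \<alpha>1])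
  have G_lagr: "?lagr (G p)" if "p \<in> K" for p using G that by (simp add: lagrangian_family_def)
  have R_lagr: "?lagr (R s)" if "s \<in> {0..\<tau>1}" for s using R that by (simp add: lagrangian_family_def)
  have R0: "R 0 = W'" by (simp add: R_def W'_def \<gamma>0)
  have "inv_into UNIV M1 ` M1 ` \<alpha> = \<alpha>"
    using V.symplectic_groupD(2)[OF M1] by (simp add: bij_is_inj image_inv_f_f)
  then have R\<tau>: "R \<tau>1 = \<alpha> \<times> \<alpha>1" by (simp add: R_def \<beta>_def M1_def)
  have G_id: "G (0, 0) = graph_of id" "G (0, t) = graph_of (\<gamma>2 t)" "G (s, 0) = graph_of (\<gamma>1 s)" for s t
    by (simp_all add: G_def \<gamma>0)
  note const = lagrangian_family_const
  obtain \<delta> where \<delta>: "continuous_on K \<delta>" "\<And>p. p \<in> K \<Longrightarrow> M.det_on (M.rel (G p) W) = cis (\<delta> p)"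
    using M.det_rel_argument[OF G const[OF W]] unfolding K_def by (metis convex_Times convex_real_interval(5))
  obtain \<epsilon> where \<epsilon>: "continuous_on {0..\<tau>1} \<epsilon>" "\<And>s. s \<in> {0..\<tau>1} \<Longrightarrow> M.det_on (M.rel (R s) W) = cis (\<epsilon> s)"
    using M.det_rel_argument[OF R const[OF W] convex_real_interval(5)] by blast
  \<comment> \<open>All arguments are measured against \<open>W\<close>: multiplicativity of the
    determinant expresses every comparison by one function \<delta> on the rectangle and one
    function \<epsilon> on the interval.\<close>
  have det: "M.det_on (M.rel (G p) (R s)) = cis (\<delta> p - \<epsilon> s)" if "p \<in> K" "s \<in> {0..\<tau>1}" for p s
  proof -
    have "cis (\<delta> p) = M.det_on (M.rel (G p) (R s)) * cis (\<epsilon> s)"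
      using M.det_on_relative_map_compose[OF G_lagr[OF that(1)] R_lagr[OF that(2)] W] \<delta>(2) \<epsilon>(2) that by simp
    then show ?thesis by (simp add: cis_divide[symmetric])
  qed
  have along: "?fam I (\<lambda>t. G (\<phi> t))" "continuous_on I (\<lambda>t. \<delta> (\<phi> t))"
    if "continuous_on I \<phi>" "\<phi> ` I \<subseteq> K" for I :: "real set" and \<phi>
    using lagrangian_family_compose[OF G that] continuous_on_compose2[OF \<delta>(1) that] by auto
  \<comment> \<open>The iterated path follows the edge \<open>t = 0\<close> and then the edge
    \<open>s = \<tau>1\<close>; \<open>min\<close> and \<open>max\<close> hold one coordinate fixed
    while the other moves.\<close>
  define \<phi> where "\<phi> t = (min t \<tau>1, max 0 (t - \<tau>1))" for t :: real
  have \<phi>: "continuous_on {0..\<tau>1 + \<tau>2} \<phi>" "\<phi> ` {0..\<tau>1 + \<tau>2} \<subseteq> K"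
    unfolding \<phi>_def K_def using \<tau> by (auto intro!: continuous_intros)
  have G\<phi>: "(\<lambda>t. graph_of (path_iteration \<tau>1 \<gamma>1 \<gamma>2 t)) = (\<lambda>t. G (\<phi> t))"
    by (auto simp: fun_eq_iff G_def \<phi>_def path_iteration_def \<gamma>0 min_def max_def)
  have \<tau>K: "\<tau>1 \<in> {0..\<tau>1}" using \<tau> by simp
  let ?d = "\<lambda>L L'. M.defect (M.rel L L')"
  have I1: "real_of_int (maslov_type_index sc \<omega> g (\<alpha> \<times> \<alpha>1) (\<tau>1 + \<tau>2) (path_iteration \<tau>1 \<gamma>1 \<gamma>2))
    = (\<delta> (\<tau>1, \<tau>2) - \<delta> (0, 0)) / (2 * pi) + ?d (G (\<tau>1, \<tau>2)) (R \<tau>1) - ?d (G (0, 0)) (R \<tau>1)"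
  proof -
    have "real_of_int (maslov_index (prod_scale sc) (neg_plus_form \<omega>) g 0 (\<tau>1 + \<tau>2) (\<lambda>t. G (\<phi> t)) (\<lambda>_. R \<tau>1))
      = ((\<delta> (\<phi> (\<tau>1 + \<tau>2)) - \<epsilon> \<tau>1) - (\<delta> (\<phi> 0) - \<epsilon> \<tau>1)) / (2 * pi)
        + ?d (G (\<phi> (\<tau>1 + \<tau>2))) (R \<tau>1) - ?d (G (\<phi> 0)) (R \<tau>1)"
      by (rule M.maslov_index_eq[OF along(1)[OF \<phi>] const[OF R_lagr[OF \<tau>K]]])
        (use \<tau> \<phi>(2) in \<open>auto intro!: continuous_intros along(2)[OF \<phi>] det[OF _ \<tau>K]\<close>)
    then show ?thesis
      unfolding maslov_type_index_def G\<phi> R\<tau>[symmetric] using \<tau> by (simp add: \<phi>_def)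
  qed
  have I2: "real_of_int (maslov_type_index sc \<omega> g (\<alpha> \<times> \<alpha>1) \<tau>1 \<gamma>1)
    = (\<delta> (\<tau>1, 0) - \<delta> (0, 0)) / (2 * pi) + ?d (G (\<tau>1, 0)) (R \<tau>1) - ?d (G (0, 0)) (R \<tau>1)"
  proof -
    have \<psi>: "continuous_on {0..\<tau>1} (\<lambda>s. (s, 0))" "(\<lambda>s. (s, 0)) ` {0..\<tau>1} \<subseteq> K"
      unfolding K_def using \<tau> by (auto intro!: continuous_intros)
    have "real_of_int (maslov_index (prod_scale sc) (neg_plus_form \<omega>) g 0 \<tau>1 (\<lambda>s. G (s, 0)) (\<lambda>_. R \<tau>1))
      = ((\<delta> (\<tau>1, 0) - \<epsilon> \<tau>1) - (\<delta> (0, 0) - \<epsilon> \<tau>1)) / (2 * pi) + ?d (G (\<tau>1, 0)) (R \<tau>1) - ?d (G (0, 0)) (R \<tau>1)"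
      by (rule M.maslov_index_eq[OF along(1)[OF \<psi>] const[OF R_lagr[OF \<tau>K]]])
        (use \<tau> \<psi>(2) in \<open>auto intro!: continuous_intros along(2)[OF \<psi>] det[OF _ \<tau>K]\<close>)
    then show ?thesis unfolding maslov_type_index_def G_id(3) R\<tau> by simp
  qed
  have I3: "real_of_int (maslov_type_index sc \<omega> g (\<alpha>1 \<times> \<alpha>1) \<tau>2 \<gamma>2)
    = (\<delta> (0, \<tau>2) - \<delta> (0, 0)) / (2 * pi) + ?d (G (0, \<tau>2)) W - ?d (G (0, 0)) W"
  proof -
    have \<psi>: "continuous_on {0..\<tau>2} (\<lambda>t. (0, t))" "(\<lambda>t. (0, t)) ` {0..\<tau>2} \<subseteq> K"
      unfolding K_def using \<tau> by (auto intro!: continuous_intros)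
    have "real_of_int (maslov_index (prod_scale sc) (neg_plus_form \<omega>) g 0 \<tau>2 (\<lambda>t. G (0, t)) (\<lambda>_. W))
      = (\<delta> (0, \<tau>2) - \<delta> (0, 0)) / (2 * pi) + ?d (G (0, \<tau>2)) W - ?d (G (0, 0)) W"
      by (rule M.maslov_index_eq[OF along(1)[OF \<psi>] const[OF W]])
        (use \<tau> \<psi>(2) in \<open>auto intro!: along(2)[OF \<psi>] \<delta>(2)\<close>)
    then show ?thesis unfolding maslov_type_index_def G_id(2) W_def by simp
  qed
  \<comment> \<open>Needed on the two edges \<open>t = 0\<close> and \<open>t = \<tau>2\<close>,
    where the reference subspace moves with \<open>s\<close>.\<close>
  have I4: "((\<delta> (\<tau>1, t) - \<epsilon> \<tau>1) - (\<delta> (0, t) - \<epsilon> 0)) / (2 * pi)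
    = ?d (G (0, t)) (R 0) - ?d (G (\<tau>1, t)) (R \<tau>1)" if t: "t \<in> {0..\<tau>2}" for t
  proof -
    have \<psi>: "continuous_on {0..\<tau>1} (\<lambda>s. (s, t))" "(\<lambda>s. (s, t)) ` {0..\<tau>1} \<subseteq> K"
      unfolding K_def using \<tau> t by (auto intro!: continuous_intros)
    show ?thesis
    proof (rule M.argument_change_if_constant_dim[OF along(1)[OF \<psi>] R \<tau>(1)])
      show "continuous_on {0..\<tau>1} (\<lambda>s. \<delta> (s, t) - \<epsilon> s)"
        by (intro continuous_intros along(2)[OF \<psi>] \<epsilon>)
      fix s assume s: "s \<in> {0..\<tau>1}"
      then show "M.det_on (M.rel (G (s, t)) (R s)) = cis (\<delta> (s, t) - \<epsilon> s)" using det \<psi>(2) by blast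
      show "V.prod.p.dim (G (s, t) \<inter> R s) = V.prod.p.dim (graph_of (\<gamma>2 t) \<inter> (\<beta> \<times> \<alpha>1))"
        unfolding G_def R_def using V.dim_graph_compose_Int[OF sp(1)[OF s] sp(2)[OF t]] \<beta> \<alpha>1
        by (simp add: lagrangian_def)
    qed
  qed
  have K_corners: "(0, 0) \<in> K" "(0, \<tau>2) \<in> K" using \<tau> by (auto simp: K_def)
  \<comment> \<open>The defect for \<open>W\<close> and \<open>W'\<close> occurs in both bounds with
    opposite effect and drops out when they are combined.\<close>
  note upper = M.defect_relative_map_triple(1)[OF G_lagr[OF K_corners(1)] W W']
  note lower = M.defect_relative_map_triple(2)[OF G_lagr[OF K_corners(2)] W W']
  \<comment> \<open>Subtracting \<open>I4\<close> at 0 from \<open>I4\<close> at \<tau>2 removes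
    \<epsilon>. Added to the difference of \<open>I1\<close> and \<open>I2\<close>, it replaces the
    corners with \<open>s = \<tau>1\<close> by those with \<open>s = 0\<close>; the remaining change
    of \<delta> is the one in \<open>I3\<close>.\<close>
  have I: "real_of_int (maslov_type_index sc \<omega> g (\<alpha> \<times> \<alpha>1) (\<tau>1 + \<tau>2) (path_iteration \<tau>1 \<gamma>1 \<gamma>2)
      - maslov_type_index sc \<omega> g (\<alpha> \<times> \<alpha>1) \<tau>1 \<gamma>1 - maslov_type_index sc \<omega> g (\<alpha>1 \<times> \<alpha>1) \<tau>2 \<gamma>2)
    = ?d (G (0, \<tau>2)) W' - ?d (G (0, 0)) W' - ?d (G (0, \<tau>2)) W + ?d (G (0, 0)) W"
    using I1 I2 I3 I4[of \<tau>2] I4[of 0] \<tau> unfolding R0 by (simp add: diff_divide_distrib)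
  have sub: "V.subspace \<alpha>1" "V.subspace \<beta>" using \<alpha>1 \<beta> by (auto simp: lagrangian_def)
  have dimP: "V.prod.p.dim (plus_space (prod_scale sc) (neg_plus_form \<omega>) g) = 2 * n"
  proof -
    have "V.prod.p.dim (UNIV :: ('v \<times> 'v) set) = 4 * n"
      using V.prod.dim_Times[OF V.subspace_UNIV V.subspace_UNIV] assms(2) by (simp del: V.dim_UNIV V.prod.p.dim_UNIV)
    then show ?thesis using M.dim_UNIV_if_lagrangian[OF W] by simp
  qed
  have "2 * V.dim \<alpha>1 = 2 * n"
    using M.dim_lagrangian[OF W] V.prod.dim_Times[OF sub(1,1)] dimP by (simp add: W_def)
  then have dim\<alpha>1: "V.dim \<alpha>1 = n" by simp
  have WW': "V.prod.p.dim (W \<inter> W') = V.dim (\<beta> \<inter> \<alpha>1) + n"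
    using V.prod.dim_Times[OF V.subspace_inter[OF sub(2,1)] sub(1)] dim\<alpha>1
    by (simp add: W_def W'_def Times_Int_Times Int_commute)
  have G2: "G (0, \<tau>2) = graph_of M2" by (simp add: G_id M2_def)
  have GWW': "G (0, \<tau>2) \<inter> W \<inter> W' = graph_of M2 \<inter> ((\<alpha>1 \<inter> \<beta>) \<times> \<alpha>1)"
    by (auto simp: G2 W_def W'_def)
  have "V.prod.p.subspace (graph_of M2)" using V.lagrangian_graph[OF M2] by (simp add: lagrangian_def)
  then have "quotient_dim (prod_scale sc) (graph_of M2 \<inter> (\<alpha>1 \<times> \<alpha>1)) (graph_of M2 \<inter> ((\<alpha>1 \<inter> \<beta>) \<times> \<alpha>1))
      = V.prod.p.dim (graph_of M2 \<inter> W) - V.prod.p.dim (graph_of M2 \<inter> ((\<alpha>1 \<inter> \<beta>) \<times> \<alpha>1))"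
    unfolding W_def using sub
    by (intro V.prod.p.quotient_dim_eq V.prod.p.subspace_inter V.prod.subspace_Times V.subspace_inter) auto
  \<comment> \<open>The quotient dimension is a truncated difference of natural numbers; this
    inequality makes it a true difference over the reals.\<close>
  moreover have "V.prod.p.dim (graph_of M2 \<inter> ((\<alpha>1 \<inter> \<beta>) \<times> \<alpha>1)) \<le> V.prod.p.dim (graph_of M2 \<inter> W)"
    unfolding W_def by (rule V.prod.p.dim_subset) auto
  ultimately have q: "real (quotient_dim (prod_scale sc) (graph_of M2 \<inter> (\<alpha>1 \<times> \<alpha>1)) (graph_of M2 \<inter> ((\<alpha>1 \<inter> \<beta>) \<times> \<alpha>1)))
      = real (V.prod.p.dim (graph_of M2 \<inter> W)) - real (V.prod.p.dim (graph_of M2 \<inter> ((\<alpha>1 \<inter> \<beta>) \<times> \<alpha>1)))"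
    by simp
  have "real (quotient_dim (prod_scale sc) (graph_of M2 \<inter> (\<alpha>1 \<times> \<alpha>1)) (graph_of M2 \<inter> ((\<alpha>1 \<inter> \<beta>) \<times> \<alpha>1)))
      + real (V.dim (\<beta> \<inter> \<alpha>1)) - real n
    \<le> ?d (G (0, \<tau>2)) W' - ?d (G (0, 0)) W' - ?d (G (0, \<tau>2)) W + ?d (G (0, 0)) W"
    using upper lower q unfolding WW' dimP GWW' unfolding G2 by simp
  then show ?thesis unfolding I[symmetric] \<beta>_def[symmetric] by linarith
qed

end
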